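(* Let $p:E\to B$ be a surjective map in $\mathrm{Hopf}_{\mathrm{coc}}(\mathrm{Vec}_G)$, where $B$ is nilpotent in $\mathrm{Hopf}_{\mathrm{coc}}(\mathrm{Vec}_G)$. If $\mathrm{Hker}(p)\subseteq[N,N]$ for a nilpotent normal color Hopf subalgebra $N$ of $E$, then $E$ is nilpotent. Furthermore, if $N$ is of nilpotency class $c$ and $B$ is of nilpotency class $d$, then $E$ is of nilpotency class at most $\frac{c(c+1)}{2}(d-1)+c$.
   Context: Let $\Bbbk$ be a field of characteristic different from $2$, $G$ a finitely generated abelian group, and $\phi:G\times G\to\Bbbk\setminus\{0\}$ a bicharacter ($\phi(gh,l)=\phi(g,l)\phi(h,l)$, $\phi(g,hl)=\phi(g,h)\phi(g,l)$) with $\phi(g,h)\phi(h,g)=1$ for all $g,h$. $\mathrm{Vec}_G$ is the category of $G$-graded vector spaces and degree-preserving linear maps, symmetric monoidal with $\otimes=\otimes_{\Bbbk}$ and braiding $x\otimes y\mapsto\phi(g,h)\,y\otimes x$ for $x$ of degree $g$, $y$ of degree $h$. $|x|$ denotes the degree of a homogeneous element $x$; formulas involving $\phi$ are written for homogeneous elements and extended linearly. Sweedler notation $\Delta(x)=x_1\otimes x_2$ is used (sum understood, components homogeneous). A color Hopf algebra is a Hopf monoid in $\mathrm{Vec}_G$: a $G$-graded algebra and $G$-graded coalgebra $(A,m,u,\Delta,\epsilon)$ with $\epsilon$ an algebra map, $\Delta(1)=1\otimes 1$, $\Delta(ab)=\phi(|a_2|,|b_1|)a_1b_1\otimes a_2b_2$,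 and a degree-preserving antipode $S$. It is cocommutative if $a_1\otimes a_2=\phi(|a_1|,|a_2|)a_2\otimes a_1$. $\mathrm{Hopf}_{\mathrm{coc}}(\mathrm{Vec}_G)$ is the category of cocommutative color Hopf algebras with degree-preserving maps that are both algebra and coalgebra maps; it is semi-abelian, with zero object $\Bbbk$. For a morphism $f:A\to B$, $\mathrm{Hker}(f)=\{a\in A\mid a_1\otimes f(a_2)=a\otimes 1_B\}$ is its kernel object. A color Hopf subalgebra of $A$ is a graded subspace which is a subalgebra (containing $1_A$), a subcoalgebra, and closed under $S$. It is normal if $\phi(|a_2|,|x|)a_1xS(a_2)\in X$ for all $a\in A$, $x\in X$ (where $X$ is the subalgebra in question). For normal color Hopf subalgebras $X,Y$ of $A$, $[X,Y]$ is the graded subalgebra of $A$ generated by the elements $\phi(|x_2|,|y_1|)x_1y_1S(x_2)S(y_2)$, $x\in X$, $y\in Y$; it is a normal color Hopf subalgebra of $A$ (the Huq commutator of $X$ and $Y$). A cocommutative color Hopf algebra $A$ is nilpotent if $\gamma_A^n(A)$ is the zero object $\Bbbk 1_A$ for some non-negative integer $n$, where $\gamma_A$ sends a normal color Hopf subalgebra $X$ of $A$ to $[A,X]$; the least such $n$ is the nilpotency class of $A$.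
   Formalization: The bound on the nilpotency class of E is claimed only when c ≥ 1 or d = 0: for c = 0 and d ≥ 1 one has N = k1, E isomorphic to B of class d, while the printed bound is 0, so it fails; nilpotency of E is claimed in all cases. *)

theory Defs
  imports
    Complex_Main
    "HOL-Library.Poly_Mapping"
    "HOL-Computational_Algebra.Group_Closure"
    "HOL-Computational_Algebra.Computational_Algebra"
begin

(* The group G is the additive group of a type of class ab_group_add, so that the laws of the
   bicharacter read phi (g + h) l = phi g l * phi h l and so on. *)

definition finitely_generated_group :: "'g::ab_group_add itself \<Rightarrow> bool" where
  "finitely_generated_group _ \<longleftrightarrow> (\<exists>S::'g set. finite S \<and> group_closure S = UNIV)"

locale skew_bicharacter =
  fixes \<phi> :: "'g::ab_group_add \<Rightarrow> 'g \<Rightarrow> 'k::field"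
  assumes nonzero: "\<phi> g h \<noteq> 0"
    and add_left: "\<phi> (g + h) l = \<phi> g l * \<phi> h l"
    and add_right: "\<phi> g (h + l) = \<phi> g h * \<phi> g l"
    and skew: "\<phi> g h * \<phi> h g = 1"


(* Tensor products. An element of A \<otimes> B is represented by a finitely supported function on
   A \<times> B, i.e. by an element of the free vector space on A \<times> B; two representatives
   are equal in A \<otimes> B if they differ by an element of the span of the bilinearity
   relations. Likewise for A \<otimes> A \<otimes> A and triples. *)

definition free_scale :: "'k::field \<Rightarrow> ('x \<Rightarrow>\<^sub>0 'k) \<Rightarrow> ('x \<Rightarrow>\<^sub>0 'k)" where
  "free_scale c t = Poly_Mapping.map ((*) c) t"

definition linear_ext ::
    "('k::field \<Rightarrow> 'c \<Rightarrow> 'c::ab_group_add) \<Rightarrow> ('x \<Rightarrow> 'c) \<Rightarrow> ('x \<Rightarrow>\<^sub>0 'k) \<Rightarrow> 'c" where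
  "linear_ext s f t = (\<Sum>x\<in>Poly_Mapping.keys t. s (Poly_Mapping.lookup t x) (f x))"

abbreviation pure_tensor :: "'x \<Rightarrow> ('x \<Rightarrow>\<^sub>0 'k::field)" where
  "pure_tensor x \<equiv> Poly_Mapping.single x 1"

definition tensor_eq ::
    "('k::field \<Rightarrow> 'a \<Rightarrow> 'a::ab_group_add) \<Rightarrow> ('k \<Rightarrow> 'b \<Rightarrow> 'b::ab_group_add) \<Rightarrow>
     ('a \<times> 'b \<Rightarrow>\<^sub>0 'k) \<Rightarrow> ('a \<times> 'b \<Rightarrow>\<^sub>0 'k) \<Rightarrow> bool" where
  "tensor_eq sA sB t u \<longleftrightarrow> t - u \<in> module.span free_scale
     ({pure_tensor (x + x', y) - pure_tensor (x, y) - pure_tensor (x', y) | x x' y. True} \<union>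
      {pure_tensor (x, y + y') - pure_tensor (x, y) - pure_tensor (x, y') | x y y'. True} \<union>
      {pure_tensor (sA c x, y) - free_scale c (pure_tensor (x, y)) | c x y. True} \<union>
      {pure_tensor (x, sB c y) - free_scale c (pure_tensor (x, y)) | c x y. True})"

definition tensor3_eq ::
    "('k::field \<Rightarrow> 'a \<Rightarrow> 'a::ab_group_add) \<Rightarrow>
     ('a \<times> 'a \<times> 'a \<Rightarrow>\<^sub>0 'k) \<Rightarrow> ('a \<times> 'a \<times> 'a \<Rightarrow>\<^sub>0 'k) \<Rightarrow> bool" where
  "tensor3_eq s t u \<longleftrightarrow> t - u \<in> module.span free_scale
     ({pure_tensor (x + x', y, z) - pure_tensor (x, y, z) - pure_tensor (x', y, z) | x x' y z. True} \<union>
      {pure_tensor (x, y + y', z) - pure_tensor (x, y, z) - pure_tensor (x, y', z) | x y y' z. True} \<union>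
      {pure_tensor (x, y, z + z') - pure_tensor (x, y, z) - pure_tensor (x, y, z') | x y z z'. True} \<union>
      {pure_tensor (s c x, y, z) - free_scale c (pure_tensor (x, y, z)) | c x y z. True} \<union>
      {pure_tensor (x, s c y, z) - free_scale c (pure_tensor (x, y, z)) | c x y z. True} \<union>
      {pure_tensor (x, y, s c z) - free_scale c (pure_tensor (x, y, z)) | c x y z. True})"


(* The ring structure is that of the type 'a; every color Hopf algebra is nonzero (the counit
   maps 1 to 1), so class ring_1 excludes nothing. The value comult H a is a representative of
   \<Delta>(a) in the above sense, and all conditions on it are stated up to tensor_eq. *)

record (overloaded) ('g, 'k, 'a) color_hopf =
  scale :: "'k::field \<Rightarrow> 'a \<Rightarrow> 'a"
  homog :: "'g \<Rightarrow> 'a set"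
  comult :: "'a \<Rightarrow> ('a \<times> 'a \<Rightarrow>\<^sub>0 'k)"
  counit :: "'a \<Rightarrow> 'k"
  antipode :: "'a \<Rightarrow> 'a"

definition homog_decomp ::
    "('g, 'k::field, 'a::ring_1) color_hopf \<Rightarrow> 'a \<Rightarrow> ('g \<Rightarrow> 'a) \<Rightarrow> bool" where
  "homog_decomp H a d \<longleftrightarrow>
     (\<forall>g. d g \<in> homog H g) \<and> finite {g. d g \<noteq> 0} \<and> a = (\<Sum>g | d g \<noteq> 0. d g)"

definition homog_part ::
    "('g, 'k::field, 'a::ring_1) color_hopf \<Rightarrow> 'a \<Rightarrow> 'g \<Rightarrow> 'a" where
  "homog_part H a = (THE d. homog_decomp H a d)"

(* The bilinear extension, to all x and y, of phi(|x|,|y|) f x y given for homogeneous x and y;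
   s is the scalar multiplication of the space where f takes its values. *)
definition color_twist ::
    "('g \<Rightarrow> 'g \<Rightarrow> 'k) \<Rightarrow> ('g, 'k::field, 'a::ring_1) color_hopf \<Rightarrow>
     ('k \<Rightarrow> 'c \<Rightarrow> 'c::ab_group_add) \<Rightarrow> ('a \<Rightarrow> 'a \<Rightarrow> 'c) \<Rightarrow> 'a \<Rightarrow> 'a \<Rightarrow> 'c" where
  "color_twist \<phi> H s f x y =
     (\<Sum>g | homog_part H x g \<noteq> 0. \<Sum>h | homog_part H y h \<noteq> 0.
        s (\<phi> g h) (f (homog_part H x g) (homog_part H y h)))"

(* (a1 \<otimes> a2) (b1 \<otimes> b2) = phi(|a2|,|b1|) a1 b1 \<otimes> a2 b2 *)
definition tensor_mult ::
    "('g \<Rightarrow> 'g \<Rightarrow> 'k) \<Rightarrow> ('g, 'k::field, 'a::ring_1) color_hopf \<Rightarrow>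
     ('a \<times> 'a \<Rightarrow>\<^sub>0 'k) \<Rightarrow> ('a \<times> 'a \<Rightarrow>\<^sub>0 'k) \<Rightarrow> ('a \<times> 'a \<Rightarrow>\<^sub>0 'k)" where
  "tensor_mult \<phi> H t u =
     linear_ext free_scale (\<lambda>(a1, a2).
       linear_ext free_scale (\<lambda>(b1, b2).
         color_twist \<phi> H free_scale (\<lambda>x y. pure_tensor (a1 * y, x * b2)) a2 b1) u) t"

(* x \<otimes> y is sent to phi(|x|,|y|) y \<otimes> x *)
definition braiding ::
    "('g \<Rightarrow> 'g \<Rightarrow> 'k) \<Rightarrow> ('g, 'k::field, 'a::ring_1) color_hopf \<Rightarrow>
     ('a \<times> 'a \<Rightarrow>\<^sub>0 'k) \<Rightarrow> ('a \<times> 'a \<Rightarrow>\<^sub>0 'k)" where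
  "braiding \<phi> H t =
     linear_ext free_scale (\<lambda>(a1, a2). color_twist \<phi> H free_scale (\<lambda>x y. pure_tensor (y, x)) a1 a2) t"

locale color_hopf_algebra =
  fixes \<phi> :: "'g::ab_group_add \<Rightarrow> 'g \<Rightarrow> 'k::field"
    and H :: "('g, 'k, 'a::ring_1) color_hopf"
  assumes vector_space: "vector_space (scale H)"
    and homog_subspace: "module.subspace (scale H) (homog H g)"
    and homog_direct_sum: "\<exists>!d. homog_decomp H a d"
    \<comment> \<open>graded algebra\<close>
    and scale_mult_left: "scale H c a * b = scale H c (a * b)"
    and scale_mult_right: "a * scale H c b = scale H c (a * b)"
    and homog_one: "1 \<in> homog H 0"
    and homog_mult: "a \<in> homog H g \<Longrightarrow> b \<in> homog H h \<Longrightarrow> a * b \<in> homog H (g + h)"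
    \<comment> \<open>graded coalgebra\<close>
    and comult_add:
      "tensor_eq (scale H) (scale H) (comult H (a + b)) (comult H a + comult H b)"
    and comult_scale:
      "tensor_eq (scale H) (scale H) (comult H (scale H c a)) (free_scale c (comult H a))"
    and comult_homog: "a \<in> homog H g \<Longrightarrow>
      \<exists>t. tensor_eq (scale H) (scale H) (comult H a) t \<and>
          (\<forall>(x, y)\<in>Poly_Mapping.keys t. \<exists>h. x \<in> homog H h \<and> y \<in> homog H (g - h))"
    and coassoc: "tensor3_eq (scale H)
      (linear_ext free_scale (\<lambda>(x, y).
         linear_ext free_scale (\<lambda>(x1, x2). pure_tensor (x1, x2, y)) (comult H x)) (comult H a))
      (linear_ext free_scale (\<lambda>(x, y).
         linear_ext free_scale (\<lambda>(y1, y2). pure_tensor (x, y1, y2)) (comult H y)) (comult H a))"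
    and counit_linear: "Vector_Spaces.linear (scale H) (*) (counit H)"
    and counit_homog: "a \<in> homog H g \<Longrightarrow> g \<noteq> 0 \<Longrightarrow> counit H a = 0"
    and counit_left: "linear_ext (scale H) (\<lambda>(x, y). scale H (counit H x) y) (comult H a) = a"
    and counit_right: "linear_ext (scale H) (\<lambda>(x, y). scale H (counit H y) x) (comult H a) = a"
    \<comment> \<open>counit and comultiplication are algebra maps\<close>
    and counit_one: "counit H 1 = 1"
    and counit_mult: "counit H (a * b) = counit H a * counit H b"
    and comult_one: "tensor_eq (scale H) (scale H) (comult H 1) (pure_tensor (1, 1))"
    and comult_mult: "tensor_eq (scale H) (scale H)
      (comult H (a * b)) (tensor_mult \<phi> H (comult H a) (comult H b))"
    \<comment> \<open>antipode\<close>
    and antipode_linear: "Vector_Spaces.linear (scale H) (scale H) (antipode H)"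
    and antipode_homog: "a \<in> homog H g \<Longrightarrow> antipode H a \<in> homog H g"
    and antipode_left:
      "linear_ext (scale H) (\<lambda>(x, y). antipode H x * y) (comult H a) = scale H (counit H a) 1"
    and antipode_right:
      "linear_ext (scale H) (\<lambda>(x, y). x * antipode H y) (comult H a) = scale H (counit H a) 1"

locale cocommutative_color_hopf_algebra = color_hopf_algebra +
  assumes cocommutative: "tensor_eq (scale H) (scale H) (comult H a) (braiding \<phi> H (comult H a))"

locale color_hopf_morphism =
  source: color_hopf_algebra \<phi> A + target: color_hopf_algebra \<phi> B
  for \<phi> :: "'g::ab_group_add \<Rightarrow> 'g \<Rightarrow> 'k::field"
    and A :: "('g, 'k, 'a::ring_1) color_hopf"
    and B :: "('g, 'k, 'b::ring_1) color_hopf" +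
  fixes f :: "'a \<Rightarrow> 'b"
  assumes map_linear: "Vector_Spaces.linear (scale A) (scale B) f"
    and map_homog: "a \<in> homog A g \<Longrightarrow> f a \<in> homog B g"
    and map_one: "f 1 = 1"
    and map_mult: "f (a * b) = f a * f b"
    and map_counit: "counit B (f a) = counit A a"
    and map_comult: "tensor_eq (scale B) (scale B)
      (comult B (f a)) (linear_ext free_scale (\<lambda>(x, y). pure_tensor (f x, f y)) (comult A a))"

definition Hker ::
    "('g, 'k::field, 'a::ring_1) color_hopf \<Rightarrow> ('g, 'k, 'b::ring_1) color_hopf \<Rightarrow>
     ('a \<Rightarrow> 'b) \<Rightarrow> 'a set" where
  "Hker A B f = {a. tensor_eq (scale A) (scale B)
     (linear_ext free_scale (\<lambda>(x, y). pure_tensor (x, f y)) (comult A a)) (pure_tensor (a, 1))}"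

definition graded_subalgebra ::
    "('g, 'k::field, 'a::ring_1) color_hopf \<Rightarrow> 'a set \<Rightarrow> bool" where
  "graded_subalgebra H X \<longleftrightarrow>
     module.subspace (scale H) X \<and> (\<forall>x\<in>X. \<forall>g. homog_part H x g \<in> X) \<and>
     1 \<in> X \<and> (\<forall>x\<in>X. \<forall>y\<in>X. x * y \<in> X)"

(* The second conjunct says that \<Delta>(X) lies in the subspace X \<otimes> X of A \<otimes> A. *)
definition color_hopf_subalgebra ::
    "('g, 'k::field, 'a::ring_1) color_hopf \<Rightarrow> 'a set \<Rightarrow> bool" where
  "color_hopf_subalgebra H X \<longleftrightarrow>
     graded_subalgebra H X \<and>
     (\<forall>x\<in>X. \<exists>t. tensor_eq (scale H) (scale H) (comult H x) t \<and> Poly_Mapping.keys t \<subseteq> X \<times> X) \<and>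
     (\<forall>x\<in>X. antipode H x \<in> X)"

(* phi(|a2|,|x|) a1 x S(a2) *)
definition adjoint_action ::
    "('g \<Rightarrow> 'g \<Rightarrow> 'k) \<Rightarrow> ('g, 'k::field, 'a::ring_1) color_hopf \<Rightarrow> 'a \<Rightarrow> 'a \<Rightarrow> 'a" where
  "adjoint_action \<phi> H a x =
     linear_ext (scale H) (\<lambda>(a1, a2).
       color_twist \<phi> H (scale H) (\<lambda>b y. a1 * y * antipode H b) a2 x) (comult H a)"

definition normal_color_hopf_subalgebra ::
    "('g \<Rightarrow> 'g \<Rightarrow> 'k) \<Rightarrow> ('g, 'k::field, 'a::ring_1) color_hopf \<Rightarrow> 'a set \<Rightarrow> bool" where
  "normal_color_hopf_subalgebra \<phi> H X \<longleftrightarrow>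
     color_hopf_subalgebra H X \<and> (\<forall>a. \<forall>x\<in>X. adjoint_action \<phi> H a x \<in> X)"

(* phi(|x2|,|y1|) x1 y1 S(x2) S(y2) *)
definition commutator_element ::
    "('g \<Rightarrow> 'g \<Rightarrow> 'k) \<Rightarrow> ('g, 'k::field, 'a::ring_1) color_hopf \<Rightarrow> 'a \<Rightarrow> 'a \<Rightarrow> 'a" where
  "commutator_element \<phi> H x y =
     linear_ext (scale H) (\<lambda>(x1, x2).
       linear_ext (scale H) (\<lambda>(y1, y2).
         color_twist \<phi> H (scale H) (\<lambda>v w. x1 * w * antipode H v * antipode H y2) x2 y1)
       (comult H y)) (comult H x)"

definition huq_commutator ::
    "('g \<Rightarrow> 'g \<Rightarrow> 'k) \<Rightarrow> ('g, 'k::field, 'a::ring_1) color_hopf \<Rightarrow> 'a set \<Rightarrow> 'a set \<Rightarrow> 'a set" where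
  "huq_commutator \<phi> H X Y =
     \<Inter>{Z. graded_subalgebra H Z \<and> (\<forall>x\<in>X. \<forall>y\<in>Y. commutator_element \<phi> H x y \<in> Z)}"

(* Below, A is a color Hopf subalgebra of H, viewed as a color Hopf algebra with the operations
   restricted from H; A = UNIV is H itself. The commutators of color Hopf subalgebras of A formed
   in A and in H are the same set, so they are written with the operations of H. *)

definition gamma_iter ::
    "('g \<Rightarrow> 'g \<Rightarrow> 'k) \<Rightarrow> ('g, 'k::field, 'a::ring_1) color_hopf \<Rightarrow> 'a set \<Rightarrow> nat \<Rightarrow> 'a set" where
  "gamma_iter \<phi> H A n = ((\<lambda>X. huq_commutator \<phi> H A X) ^^ n) A"

definition nilpotent ::
    "('g \<Rightarrow> 'g \<Rightarrow> 'k) \<Rightarrow> ('g, 'k::field, 'a::ring_1) color_hopf \<Rightarrow> 'a set \<Rightarrow> bool" where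
  "nilpotent \<phi> H A \<longleftrightarrow> (\<exists>n. gamma_iter \<phi> H A n = range (\<lambda>c. scale H c 1))"

definition nilpotency_class ::
    "('g \<Rightarrow> 'g \<Rightarrow> 'k) \<Rightarrow> ('g, 'k::field, 'a::ring_1) color_hopf \<Rightarrow> 'a set \<Rightarrow> nat" where
  "nilpotency_class \<phi> H A = (LEAST n. gamma_iter \<phi> H A n = range (\<lambda>c. scale H c 1))"

end

theory Submission
  imports Defs "HOL-Algebra.Coset"
begin

text \<open>A cocommutative Hopf monoid is a group object in the category of cocommutative comonoids.
  Concretely, for every cocommutative color coalgebra \<open>C\<close> the degree-preserving coalgebra maps
  from \<open>C\<close> to a cocommutative color Hopf algebra (here called points) form a group under
  convolution, with composition with the antipode as the inverse (\<open>group_Pts\<close>, \<open>inv_Pts\<close>). The signs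
  of the braiding are absorbed in this group: the adjoint action and the commutator elements
  are the conjugates and the commutators of points (\<open>pconj_eq_adjoint_action\<close>,
  \<open>pcomm_eq_commutator_element\<close>), so that an identity between words in a group yields a
  statement about color Hopf algebras. The points with values in a normal color Hopf subalgebra
  form a normal subgroup (\<open>normal_Pts_in\<close>), and every subcoalgebra containing \<open>1\<close> is the linear span of
  the values of one point (\<open>subcoalgebra_point\<close>), so no information is lost by speaking of points.

  A Huq commutator is generated as an algebra only, so group identities give
  information on generators. To pass to products, a property is
  not proved for single elements, because they cannot be conjugated or convolved, but for the
  largest subcoalgebra of the subspace on which it holds (\<open>core\<close>, \<open>huq_subset_core\<close>). In this way
  commutators of normal color Hopf subalgebras are shown to be normal (\<open>normal_huq\<close>) and
  symmetric (\<open>huq_commute\<close>), the Hall-Witt identity becomes the three subgroups lemma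
  (\<open>huq_three_subgroups\<close>), and \<open>{z. [E, z] \<subseteq> W}\<close> has a normal color Hopf subalgebra as its
  core (\<open>normal_centralizer\<close>).

  The theorem then follows by P. Hall's argument. Write \<open>D X\<close> for \<open>[E, X]\<close> and let
  \<open>N = N\<^sub>0\<close>, \<open>N\<^sub>1 = [N, N]\<close>, \<open>N\<^sub>2 = [N, N\<^sub>1]\<close> and so on be the series of \<open>N\<close>.
  Since \<open>p\<close> maps the series of \<open>E\<close> into that of \<open>B\<close>, which is trivial after \<open>d\<close> steps, the
  \<open>d\<close>-th term for \<open>E\<close> lies in \<open>Hker p\<close> and so in \<open>N\<^sub>1\<close>. The three subgroups lemma makes \<open>D\<close> a derivation for the commutator, so
  \<open>D\<^sup>k [X, Y]\<close> is bounded by the \<open>[D\<^sup>a X, D\<^sup>b Y]\<close> with \<open>a + b = k\<close>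
  (\<open>descend_huq_subset\<close>). Applied to \<open>[N, N\<^sub>i]\<close>, this shows by induction that
  \<open>(i + 1) (d - 1) + 1\<close> steps of \<open>D\<close> lead from \<open>N\<^sub>i\<close> into the next term of the
  series: by the pigeonhole principle one of the two
  factors receives enough steps to descend (\<open>descend_series_subset\<close>). Summing the numbers of steps up to
  \<open>N\<^sub>c\<close> gives the bound (\<open>hall_subset\<close>).\<close>

section \<open>Linear extension and bilinear maps\<close>

lemma lookup_free_scale [simp]: "Poly_Mapping.lookup (free_scale c t) x = c * Poly_Mapping.lookup t x"
  by (auto simp: free_scale_def Poly_Mapping.map.rep_eq when_def)

lemma vector_space_free_scale: "vector_space (free_scale :: 'k::field \<Rightarrow> ('x \<Rightarrow>\<^sub>0 'k) \<Rightarrow> _)"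
  by unfold_locales (auto intro!: poly_mapping_eqI simp: lookup_add algebra_simps)

lemma vector_space_times: "vector_space ((*) :: 'k::field \<Rightarrow> 'k \<Rightarrow> 'k)"
  by unfold_locales (auto simp: algebra_simps)

lemma keys_free_scale: "Poly_Mapping.keys (free_scale c t) \<subseteq> Poly_Mapping.keys t"
  by (auto simp: in_keys_iff)

lemma linear_ext_cong:
  "t = u \<Longrightarrow> (\<And>x. x \<in> Poly_Mapping.keys u \<Longrightarrow> f x = g x) \<Longrightarrow> linear_ext s f t = linear_ext s g u"
  unfolding linear_ext_def by (auto intro: sum.cong)

context vector_space
begin

lemma linear_ext_superset:
  "finite S \<Longrightarrow> Poly_Mapping.keys t \<subseteq> S \<Longrightarrow>
    linear_ext scale f t = (\<Sum>x\<in>S. scale (Poly_Mapping.lookup t x) (f x))"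
  unfolding linear_ext_def by (rule sum.mono_neutral_left) (auto simp: in_keys_iff)

lemma linear_ext_add [simp]: "linear_ext scale f (t + u) = linear_ext scale f t + linear_ext scale f u"
proof -
  let ?S = "Poly_Mapping.keys t \<union> Poly_Mapping.keys u"
  have "Poly_Mapping.keys (t + u) \<subseteq> ?S" by (rule Poly_Mapping.keys_add)
  then show ?thesis
    by (simp add: linear_ext_superset[of ?S] lookup_add scale_left_distrib sum.distrib)
qed

lemma linear_ext_free_scale [simp]: "linear_ext scale f (free_scale c t) = scale c (linear_ext scale f t)"
  by (subst (1 2) linear_ext_superset[of "Poly_Mapping.keys t"]) (auto simp: keys_free_scale scale_sum_right)

lemma linear_ext_zero [simp]: "linear_ext scale f 0 = 0"
  by (simp add: linear_ext_def)

lemma linear_ext_uminus [simp]: "linear_ext scale f (- t) = - linear_ext scale f t"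
  by (simp add: linear_ext_def sum_negf)

lemma linear_ext_diff [simp]: "linear_ext scale f (t - u) = linear_ext scale f t - linear_ext scale f u"
  using linear_ext_add[of f t "- u"] by simp

lemma linear_ext_sum: "linear_ext scale f (\<Sum>x\<in>A. t x) = (\<Sum>x\<in>A. linear_ext scale f (t x))"
  by (induct A rule: infinite_finite_induct) auto

lemma linear_ext_single [simp]: "linear_ext scale f (Poly_Mapping.single x c) = scale c (f x)"
  by (simp add: linear_ext_def)

lemma linear_ext_fun_add: "linear_ext scale (\<lambda>x. f x + g x) t = linear_ext scale f t + linear_ext scale g t"
  by (simp add: linear_ext_def scale_right_distrib sum.distrib)

lemma linear_ext_fun_scale: "linear_ext scale (\<lambda>x. scale c (f x)) t = scale c (linear_ext scale f t)"
  by (simp add: linear_ext_def scale_sum_right scale_left_commute mult.commute)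

lemma linear_linear_ext: "Vector_Spaces.linear free_scale scale (linear_ext scale f)"
proof -
  interpret F: vector_space free_scale by (rule vector_space_free_scale)
  show ?thesis by unfold_locales auto
qed

text \<open>The free vector space is a monad with \<open>linear_ext\<close> as its bind, and by \<open>linear_ext_swap\<close> a
  commutative one. All manipulations of Sweedler sums rest on these two laws.\<close>

lemma linear_ext_bind:
  "linear_ext scale f (linear_ext free_scale g t) = linear_ext scale (\<lambda>x. linear_ext scale f (g x)) t"
  by (simp add: linear_ext_def[of _ g] linear_ext_def[of _ "\<lambda>x. linear_ext scale f (g x)"] linear_ext_sum)

lemma linear_ext_swap:
  "linear_ext scale (\<lambda>x. linear_ext scale (f x) u) t = linear_ext scale (\<lambda>y. linear_ext scale (\<lambda>x. f x y) t) u"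
proof -
  have "linear_ext scale (\<lambda>x. linear_ext scale (f x) u) t =
      (\<Sum>x\<in>Poly_Mapping.keys t. \<Sum>y\<in>Poly_Mapping.keys u.
        scale (Poly_Mapping.lookup t x) (scale (Poly_Mapping.lookup u y) (f x y)))"
    by (simp add: linear_ext_def scale_sum_right)
  also have "\<dots> = (\<Sum>y\<in>Poly_Mapping.keys u. \<Sum>x\<in>Poly_Mapping.keys t.
        scale (Poly_Mapping.lookup u y) (scale (Poly_Mapping.lookup t x) (f x y)))"
    by (subst sum.swap) (simp only: scale_left_commute)
  also have "\<dots> = linear_ext scale (\<lambda>y. linear_ext scale (\<lambda>x. f x y) t) u"
    by (simp only: linear_ext_def scale_sum_right)
  finally show ?thesis .
qed

lemma linear_ext_in_subspace:
  "subspace X \<Longrightarrow> (\<And>x. x \<in> Poly_Mapping.keys t \<Longrightarrow> f x \<in> X) \<Longrightarrow> linear_ext scale f t \<in> X"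
  unfolding linear_ext_def by (intro subspace_sum subspace_scale) auto

end

lemma linear_linear_ext_apply:
  assumes "Vector_Spaces.linear s s' h"
  shows "h (linear_ext s f t) = linear_ext s' (\<lambda>x. h (f x)) t"
proof -
  interpret Vector_Spaces.linear s s' h by fact
  show ?thesis by (simp add: linear_ext_def sum scale)
qed

lemma linear_ext_pure [simp]: "linear_ext free_scale pure_tensor t = t"
proof (rule poly_mapping_eqI)
  fix k
  interpret F: vector_space free_scale by (rule vector_space_free_scale)
  show "Poly_Mapping.lookup (linear_ext free_scale pure_tensor t) k = Poly_Mapping.lookup t k"
    by (auto simp: linear_ext_def lookup_sum lookup_single when_def if_distrib in_keys_iff cong: if_cong)
qed

lemma linear_mapI:
  assumes "vector_space s" "vector_space s'"
    and "\<And>x y. h (x + y) = h x + h y" "\<And>c x. h (s c x) = s' c (h x)"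
  shows "Vector_Spaces.linear s s' h"
proof -
  interpret A: vector_space s by fact
  interpret B: vector_space s' by fact
  show ?thesis by unfold_locales (simp_all add: assms)
qed

definition bilinear_map where
  "bilinear_map sA sB s b \<longleftrightarrow>
     (\<forall>y. Vector_Spaces.linear sA s (\<lambda>x. b x y)) \<and> (\<forall>x. Vector_Spaces.linear sB s (b x))"

lemma bilinear_mapI:
  assumes "vector_space sA" "vector_space sB" "vector_space s"
    and "\<And>x x' y. b (x + x') y = b x y + b x' y" "\<And>x y y'. b x (y + y') = b x y + b x y'"
    and "\<And>c x y. b (sA c x) y = s c (b x y)" "\<And>c x y. b x (sB c y) = s c (b x y)"
  shows "bilinear_map sA sB s b"
proof -
  interpret A: vector_space sA by fact
  interpret B: vector_space sB by fact
  interpret S: vector_space s by fact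
  show ?thesis unfolding bilinear_map_def
    by (intro conjI allI; unfold_locales; simp add: assms)
qed

lemma bilinear_mapD:
  assumes "bilinear_map sA sB s b"
  shows "b (x + x') y = b x y + b x' y" "b x (y + y') = b x y + b x y'"
    and "b (sA c x) y = s c (b x y)" "b x (sB c y) = s c (b x y)"
    and "b 0 y = 0" "b x 0 = 0"
proof -
  interpret L: Vector_Spaces.linear sA s "\<lambda>x. b x y" using assms by (simp add: bilinear_map_def)
  interpret R: Vector_Spaces.linear sB s "b x" using assms by (simp add: bilinear_map_def)
  show "b (x + x') y = b x y + b x' y" "b x (y + y') = b x y + b x y'"
    "b (sA c x) y = s c (b x y)" "b x (sB c y) = s c (b x y)" "b 0 y = 0" "b x 0 = 0"
    by (rule L.add R.add L.scale R.scale L.zero R.zero)+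
qed

lemma tensor_eq_bilinear_map:
  assumes eq: "tensor_eq sA sB t u" and b: "bilinear_map sA sB s b"
  shows "linear_ext s (\<lambda>(x, y). b x y) t = linear_ext s (\<lambda>(x, y). b x y) u"
proof -
  interpret L: Vector_Spaces.linear sA s "\<lambda>x. b x undefined" using b by (simp add: bilinear_map_def)
  interpret P: vector_space_pair free_scale s
    by (intro vector_space_pair.intro vector_space_free_scale L.vs2.vector_space_axioms)
  have "linear_ext s (\<lambda>(x, y). b x y) (t - u) = 0"
    by (rule P.linear_eq_0_on_span[OF L.vs2.linear_linear_ext _ eq[unfolded tensor_eq_def]])
      (auto simp: bilinear_mapD[OF b])
  then show ?thesis by (simp add: L.vs2.linear_ext_diff)
qed

text \<open>A maximal independent subset of \<open>S\<close> stays independent when \<open>v\<close> is added, and a linear map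
  can be prescribed on an independent set.\<close>

lemma separating_functional:
  fixes s :: "'k::field \<Rightarrow> 'v::ab_group_add \<Rightarrow> 'v"
  assumes "vector_space s" "v \<notin> module.span s S"
  obtains h where "Vector_Spaces.linear s (*) h" "h v = 1" "\<And>x. x \<in> S \<Longrightarrow> h x = 0"
proof -
  interpret S: vector_space s by fact
  interpret P: vector_space_pair s "(*) :: 'k \<Rightarrow> 'k \<Rightarrow> 'k"
    by unfold_locales (auto simp: algebra_simps)
  obtain B where B: "B \<subseteq> S" "S.independent B" "S \<subseteq> S.span B" "S.span S = S.span B"
    by (metis S.maximal_independent_subset S.span_minimal S.span_mono S.subspace_span subset_antisym)
  have v: "v \<notin> S.span B" using assms B by simp
  have "S.independent (insert v B)" using v B S.independent_insertI by blast
  then obtain h where h: "Vector_Spaces.linear s (*) h" "\<forall>x\<in>insert v B. h x = (if x = v then 1 else 0)"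
    using P.linear_independent_extend[of "insert v B" "\<lambda>x. if x = v then 1 else 0"] by blast
  have "h x = 0" if "x \<in> S" for x
    by (rule P.linear_eq_0_on_span[OF h(1), of B]) (use that B h v S.span_base in auto)
  then show ?thesis using that h by auto
qed

text \<open>A functional on the free vector space that kills the bilinearity relations is the same as
  a bilinear form. If two representatives were different tensors, such a functional would
  separate them. Thus identities between tensors can be checked on scalar-valued bilinear forms,
  and tensor products never have to be constructed.\<close>

lemma tensor_eqI:
  fixes sA :: "'k::field \<Rightarrow> 'a::ab_group_add \<Rightarrow> 'a" and sB :: "'k \<Rightarrow> 'b::ab_group_add \<Rightarrow> 'b"
  assumes "vector_space sA" "vector_space sB"
    and "\<And>b. bilinear_map sA sB (*) b \<Longrightarrow>
      linear_ext (*) (\<lambda>(x, y). b x y) t = linear_ext (*) (\<lambda>(x, y). b x y) u"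
  shows "tensor_eq sA sB t u"
proof (rule ccontr)
  interpret K: vector_space "(*) :: 'k \<Rightarrow> 'k \<Rightarrow> 'k" by (rule vector_space_times)
  assume "\<not> tensor_eq sA sB t u"
  from separating_functional[OF vector_space_free_scale this[unfolded tensor_eq_def]]
  obtain h where h: "Vector_Spaces.linear free_scale (*) h" "h (t - u) = 1"
    and 0: "\<And>x. x \<in> {pure_tensor (x + x', y) - pure_tensor (x, y) - pure_tensor (x', y) | x x' y. True} \<union>
      {pure_tensor (x, y + y') - pure_tensor (x, y) - pure_tensor (x, y') | x y y'. True} \<union>
      {pure_tensor (sA c x, y) - free_scale c (pure_tensor (x, y)) | c x y. True} \<union>
      {pure_tensor (x, sB c y) - free_scale c (pure_tensor (x, y)) | c x y. True} \<Longrightarrow> h x = 0" by blast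
  have h0: "h (pure_tensor (x + x', y) - pure_tensor (x, y) - pure_tensor (x', y)) = 0"
    "h (pure_tensor (x, y + y') - pure_tensor (x, y) - pure_tensor (x, y')) = 0"
    "h (pure_tensor (sA c x, y) - free_scale c (pure_tensor (x, y))) = 0"
    "h (pure_tensor (x, sB c y) - free_scale c (pure_tensor (x, y))) = 0" for x x' y y' c
    by (rule 0, blast)+
  interpret h: Vector_Spaces.linear free_scale "(*)" h by fact
  have "bilinear_map sA sB (*) (\<lambda>x y. h (pure_tensor (x, y)))"
    using h0 by (intro bilinear_mapI assms(1,2) vector_space_times)
      (simp_all add: h.diff h.add h.scale diff_diff_eq)
  from assms(3)[OF this]
  have "linear_ext (*) (\<lambda>p. h (pure_tensor p)) t = linear_ext (*) (\<lambda>p. h (pure_tensor p)) u"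
    by (simp add: case_prod_unfold)
  then have "h t = h u"
    unfolding linear_linear_ext_apply[OF h(1), of pure_tensor, symmetric] by simp
  then show False using h(2) by (simp add: h.diff)
qed

section \<open>Cocommutative color coalgebras on free vector spaces\<close>

text \<open>A coalgebra structure on the free vector space over the index type, given by structure
  constants. Since the space is free, the tensor products of the coalgebra with itself are free
  as well, and the coalgebra laws can be stated as equations instead of up to equality of
  tensors.\<close>

record (overloaded) ('g, 'k, 'i) color_coalg =
  cdeg :: "'i \<Rightarrow> 'g"
  cdelta :: "'i \<Rightarrow> ('i \<times> 'i \<Rightarrow>\<^sub>0 'k)"
  ceps :: "'i \<Rightarrow> 'k"

text \<open>The sum written \<open>F(i\<^sub>1, i\<^sub>2)\<close> in Sweedler notation.\<close>

definition sweedler ::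
    "('k::field \<Rightarrow> 'v \<Rightarrow> 'v::ab_group_add) \<Rightarrow> ('g, 'k, 'i) color_coalg \<Rightarrow> ('i \<Rightarrow> 'i \<Rightarrow> 'v) \<Rightarrow> 'i \<Rightarrow> 'v" where
  "sweedler s C F i = linear_ext s (\<lambda>(j, k). F j k) (cdelta C i)"

lemma sweedler_map:
  "Vector_Spaces.linear s s' h \<Longrightarrow> h (sweedler s C F i) = sweedler s' C (\<lambda>j k. h (F j k)) i"
  by (simp add: sweedler_def linear_linear_ext_apply case_prod_unfold)

context vector_space
begin

lemma sweedler_linear_ext:
  "linear_ext scale f (sweedler free_scale C F i) = sweedler scale C (\<lambda>j k. linear_ext scale f (F j k)) i"
  by (rule sweedler_map[OF linear_linear_ext])

lemma sweedler_scale: "scale c (sweedler scale C F i) = sweedler scale C (\<lambda>j k. scale c (F j k)) i"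
  by (simp add: sweedler_def linear_ext_fun_scale[symmetric] case_prod_unfold)

lemma sweedler_swap:
  "sweedler scale C (\<lambda>a b. sweedler scale D (F a b) j) i =
   sweedler scale D (\<lambda>c d. sweedler scale C (\<lambda>a b. F a b c d) i) j"
  unfolding sweedler_def case_prod_unfold by (rule linear_ext_swap)

lemma sweedler_linear_ext_swap:
  "sweedler scale C (\<lambda>a b. linear_ext scale (F a b) t) i =
   linear_ext scale (\<lambda>x. sweedler scale C (\<lambda>a b. F a b x) i) t"
  unfolding sweedler_def case_prod_unfold by (rule linear_ext_swap)

lemma sweedler_in_subspace:
  "subspace X \<Longrightarrow> (\<And>j k. (j, k) \<in> Poly_Mapping.keys (cdelta C i) \<Longrightarrow> F j k \<in> X) \<Longrightarrow> sweedler scale C F i \<in> X"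
  unfolding sweedler_def by (rule linear_ext_in_subspace) auto

end

locale color_coalgebra = skew_bicharacter \<phi>
  for \<phi> :: "'g::ab_group_add \<Rightarrow> 'g \<Rightarrow> 'k::field" +
  fixes C :: "('g, 'k, 'i) color_coalg"
  assumes delta_deg: "(j, k) \<in> Poly_Mapping.keys (cdelta C i) \<Longrightarrow> cdeg C j + cdeg C k = cdeg C i"
    and eps_deg: "ceps C i \<noteq> 0 \<Longrightarrow> cdeg C i = 0"
    and delta_coassoc:
      "sweedler free_scale C (\<lambda>j k. sweedler free_scale C (\<lambda>a b. pure_tensor (a, b, k)) j) i =
       sweedler free_scale C (\<lambda>j k. sweedler free_scale C (\<lambda>b c. pure_tensor (j, b, c)) k) i"
    and delta_eps_left: "sweedler free_scale C (\<lambda>j k. free_scale (ceps C j) (pure_tensor k)) i = pure_tensor i"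
    and delta_eps_right: "sweedler free_scale C (\<lambda>j k. free_scale (ceps C k) (pure_tensor j)) i = pure_tensor i"
    and delta_cocomm:
      "sweedler free_scale C (\<lambda>j k. free_scale (\<phi> (cdeg C j) (cdeg C k)) (pure_tensor (k, j))) i = cdelta C i"
begin

lemma sweedler_cong:
  "(\<And>j k. cdeg C j + cdeg C k = cdeg C i \<Longrightarrow> F j k = G j k) \<Longrightarrow> sweedler s C F i = sweedler s C G i"
  unfolding sweedler_def by (rule linear_ext_cong) (auto dest: delta_deg)

lemma sweedler_assoc:
  assumes "vector_space s"
  shows "sweedler s C (\<lambda>j k. sweedler s C (\<lambda>a b. F a b k) j) i =
         sweedler s C (\<lambda>j k. sweedler s C (\<lambda>b c. F j b c) k) i"
proof -
  interpret vector_space s by fact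
  from arg_cong[OF delta_coassoc[of i], of "linear_ext s (\<lambda>(a, b, c). F a b c)"]
  show ?thesis by (simp add: sweedler_linear_ext)
qed

lemma sweedler_cocomm:
  assumes "vector_space s"
  shows "sweedler s C (\<lambda>j k. s (\<phi> (cdeg C j) (cdeg C k)) (F k j)) i = sweedler s C F i"
proof -
  interpret vector_space s by fact
  from arg_cong[OF delta_cocomm[of i], of "linear_ext s (\<lambda>(a, b). F a b)"]
  show ?thesis by (simp add: sweedler_linear_ext) (simp add: sweedler_def)
qed

lemma sweedler_eps_left:
  assumes "vector_space s"
  shows "sweedler s C (\<lambda>j k. s (ceps C j) (F k)) i = F i"
proof -
  interpret vector_space s by fact
  from arg_cong[OF delta_eps_left[of i], of "linear_ext s F"]
  show ?thesis by (simp add: sweedler_linear_ext)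
qed

lemma sweedler_eps_right:
  assumes "vector_space s"
  shows "sweedler s C (\<lambda>j k. s (ceps C k) (F j)) i = F i"
proof -
  interpret vector_space s by fact
  from arg_cong[OF delta_eps_right[of i], of "linear_ext s F"]
  show ?thesis by (simp add: sweedler_linear_ext)
qed

lemma sweedler_swap_last:
  assumes "vector_space s"
  shows "sweedler s C (\<lambda>j k. sweedler s C (\<lambda>a b. F a b k) j) i =
         sweedler s C (\<lambda>j k. sweedler s C (\<lambda>a b. s (\<phi> (cdeg C b) (cdeg C k)) (F a k b)) j) i"
  by (simp add: sweedler_assoc[OF assms] sweedler_cocomm[OF assms])

text \<open>The comultiplication of a cocommutative coalgebra is itself a coalgebra map: in \<open>i\<^sub>1 \<otimes> i\<^sub>2
  \<otimes> i\<^sub>3 \<otimes> i\<^sub>4\<close> the two middle factors may be exchanged at the cost of a sign. This is the form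
  in which cocommutativity enters all later proofs.\<close>

lemma sweedler_middle_swap:
  assumes "vector_space s"
  shows "sweedler s C (\<lambda>j k. sweedler s C (\<lambda>a b. sweedler s C (\<lambda>c d. F a b c d) k) j) i =
         sweedler s C (\<lambda>j k. sweedler s C (\<lambda>a b.
           sweedler s C (\<lambda>c d. s (\<phi> (cdeg C b) (cdeg C c)) (F a c b d)) k) j) i"
proof -
  have inner: "sweedler s C (\<lambda>b k. sweedler s C (F a b) k) m =
      sweedler s C (\<lambda>b k. sweedler s C (\<lambda>c d. s (\<phi> (cdeg C b) (cdeg C c)) (F a c b d)) k) m" for a m
    by (simp add: sweedler_assoc[OF assms, symmetric] sweedler_cocomm[OF assms])
  show ?thesis by (simp add: sweedler_assoc[OF assms] inner)
qed

end

context skew_bicharacter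
begin

lemma phi_zero_right [simp]: "\<phi> g 0 = 1"
  using add_right[of g 0 0] nonzero[of g 0] by simp

lemma phi_zero_left [simp]: "\<phi> 0 g = 1"
  using add_left[of 0 0 g] nonzero[of 0 g] by simp

definition tensor_coalg ::
    "('g, 'k, 'i) color_coalg \<Rightarrow> ('g, 'k, 'j) color_coalg \<Rightarrow> ('g, 'k, 'i \<times> 'j) color_coalg" where
  "tensor_coalg C D =
     \<lparr>cdeg = (\<lambda>(i, j). cdeg C i + cdeg D j),
      cdelta = (\<lambda>(i, j). sweedler free_scale C (\<lambda>a a'. sweedler free_scale D (\<lambda>b b'.
        free_scale (\<phi> (cdeg C a') (cdeg D b)) (pure_tensor ((a, b), (a', b')))) j) i),
      ceps = (\<lambda>(i, j). ceps C i * ceps D j)\<rparr>"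

lemma tensor_coalg_simps [simp]:
  "cdeg (tensor_coalg C D) (i, j) = cdeg C i + cdeg D j"
  "ceps (tensor_coalg C D) (i, j) = ceps C i * ceps D j"
  by (simp_all add: tensor_coalg_def)

lemma sweedler_tensor_coalg:
  assumes "vector_space s"
  shows "sweedler s (tensor_coalg C D) F (i, j) = sweedler s C (\<lambda>a a'. sweedler s D (\<lambda>b b'.
    s (\<phi> (cdeg C a') (cdeg D b)) (F (a, b) (a', b'))) j) i"
proof -
  interpret vector_space s by fact
  have "sweedler s (tensor_coalg C D) F (i, j) = linear_ext s (\<lambda>(x, y). F x y)
      (sweedler free_scale C (\<lambda>a a'. sweedler free_scale D (\<lambda>b b'.
        free_scale (\<phi> (cdeg C a') (cdeg D b)) (pure_tensor ((a, b), (a', b')))) j) i)"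
    unfolding sweedler_def[of s "tensor_coalg C D"] by (simp add: tensor_coalg_def)
  also have "\<dots> = sweedler s C (\<lambda>a a'. sweedler s D (\<lambda>b b'.
    s (\<phi> (cdeg C a') (cdeg D b)) (F (a, b) (a', b'))) j) i"
    by (simp add: sweedler_linear_ext)
  finally show ?thesis .
qed

text \<open>Both sides reduce to one sixfold sum. Its sign collects a factor for each index of \<open>C\<close> and
  index of \<open>D\<close> that pass each other.\<close>

lemma tensor_coalg_coassoc:
  fixes F :: "'i \<times> 'j \<Rightarrow> 'i \<times> 'j \<Rightarrow> 'i \<times> 'j \<Rightarrow> 'v::ab_group_add"
  assumes C: "color_coalgebra \<phi> C" and D: "color_coalgebra \<phi> D" and s: "vector_space s"
  shows "sweedler s (tensor_coalg C D) (\<lambda>x z. sweedler s (tensor_coalg C D) (\<lambda>a b. F a b z) x) ij =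
         sweedler s (tensor_coalg C D) (\<lambda>x z. sweedler s (tensor_coalg C D) (\<lambda>b c. F x b c) z) ij"
proof -
  interpret C: color_coalgebra \<phi> C by fact
  interpret D: color_coalgebra \<phi> D by fact
  interpret s: vector_space s by fact
  obtain i j where ij: "ij = (i, j)" by (cases ij)
  \<comment> \<open>\<open>a\<close>, \<open>b\<close>, \<open>z\<close> and \<open>c\<close>, \<open>d\<close>, \<open>r\<close> are the threefold coproducts of \<open>i\<close> and \<open>j\<close>.\<close>
  define K where "K a b z c d r =
    s (\<phi> (cdeg C z) (cdeg D c) * \<phi> (cdeg C z) (cdeg D d) * \<phi> (cdeg C b) (cdeg D c))
      (F (a, c) (b, d) (z, r))" for a b z c d r
  have sign: "s (\<phi> l g) (s (\<phi> k h) v) = s (\<phi> k g * \<phi> k h * \<phi> j g) v" if "j + k = l" for j k l g h v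
    using that by (auto simp: add_left mult_ac)
  have "sweedler s (tensor_coalg C D) (\<lambda>x z. sweedler s (tensor_coalg C D) (\<lambda>a b. F a b z) x) (i, j) =
    sweedler s C (\<lambda>x z. sweedler s D (\<lambda>p r. sweedler s C (\<lambda>a b. sweedler s D (\<lambda>c d. K a b z c d r) p) x) j) i"
    unfolding sweedler_tensor_coalg[OF s] s.sweedler_scale K_def
    by (intro C.sweedler_cong D.sweedler_cong) (simp add: add_right[symmetric])
  also have "\<dots> = sweedler s C (\<lambda>x z. sweedler s C (\<lambda>a b. sweedler s D (\<lambda>p r. sweedler s D (\<lambda>c d. K a b z c d r) p) j) x) i"
    by (subst s.sweedler_swap) (rule refl)
  also have "\<dots> = sweedler s C (\<lambda>a y. sweedler s C (\<lambda>b z. sweedler s D (\<lambda>c q. sweedler s D (\<lambda>d r. K a b z c d r) q) j) y) i"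
    unfolding C.sweedler_assoc[OF s] D.sweedler_assoc[OF s] ..
  also have "\<dots> = sweedler s C (\<lambda>a y. sweedler s D (\<lambda>c q. sweedler s C (\<lambda>b z. sweedler s D (\<lambda>d r. K a b z c d r) q) y) j) i"
    by (subst s.sweedler_swap) (rule refl)
  also have "\<dots> = sweedler s (tensor_coalg C D) (\<lambda>x z. sweedler s (tensor_coalg C D) (\<lambda>b c. F x b c) z) (i, j)"
    unfolding sweedler_tensor_coalg[OF s] s.sweedler_scale K_def
    by (intro C.sweedler_cong D.sweedler_cong) (rule sign[symmetric])
  finally show ?thesis by (simp add: ij)
qed

lemma tensor_coalg_cocomm:
  fixes F :: "'i \<times> 'j \<Rightarrow> 'i \<times> 'j \<Rightarrow> 'v::ab_group_add"
  assumes C: "color_coalgebra \<phi> C" and D: "color_coalgebra \<phi> D" and s: "vector_space s"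
  shows "sweedler s (tensor_coalg C D)
      (\<lambda>x y. s (\<phi> (cdeg (tensor_coalg C D) x) (cdeg (tensor_coalg C D) y)) (F y x)) ij =
    sweedler s (tensor_coalg C D) F ij"
proof -
  interpret C: color_coalgebra \<phi> C by fact
  interpret D: color_coalgebra \<phi> D by fact
  interpret s: vector_space s by fact
  obtain i j where ij: "ij = (i, j)" by (cases ij)
  have sign: "\<phi> a' b * \<phi> (a + b) (a' + b') = \<phi> a a' * (\<phi> b b' * \<phi> a b')" for a a' b b'
  proof -
    have "\<phi> a' b * \<phi> (a + b) (a' + b') = (\<phi> a' b * \<phi> b a') * (\<phi> a a' * (\<phi> b b' * \<phi> a b'))"
      by (simp add: add_left add_right mult_ac)
    then show ?thesis by (simp add: skew)
  qed
  have "sweedler s (tensor_coalg C D)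
      (\<lambda>x y. s (\<phi> (cdeg (tensor_coalg C D) x) (cdeg (tensor_coalg C D) y)) (F y x)) (i, j) =
    sweedler s C (\<lambda>a a'. s (\<phi> (cdeg C a) (cdeg C a')) (sweedler s D (\<lambda>b b'.
      s (\<phi> (cdeg D b) (cdeg D b')) (s (\<phi> (cdeg C a) (cdeg D b')) (F (a', b') (a, b)))) j)) i"
    by (simp add: sweedler_tensor_coalg[OF s] s.sweedler_scale sign)
  also have "\<dots> = sweedler s C (\<lambda>a a'. sweedler s D (\<lambda>b b'.
      s (\<phi> (cdeg D b) (cdeg D b')) (s (\<phi> (cdeg C a') (cdeg D b')) (F (a, b') (a', b)))) j) i"
    by (rule C.sweedler_cocomm[OF s])
  also have "\<dots> = sweedler s C (\<lambda>a a'. sweedler s D (\<lambda>b b'. s (\<phi> (cdeg C a') (cdeg D b)) (F (a, b) (a', b'))) j) i"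
    by (subst D.sweedler_cocomm[OF s]) (rule refl)
  finally show ?thesis by (simp add: ij sweedler_tensor_coalg[OF s])
qed

lemma tensor_coalg_eps_left:
  assumes C: "color_coalgebra \<phi> C" and D: "color_coalgebra \<phi> D" and s: "vector_space s"
  shows "sweedler s (tensor_coalg C D) (\<lambda>x y. s (ceps (tensor_coalg C D) x) (F y)) (i, j) = F (i, j)"
proof -
  interpret C: color_coalgebra \<phi> C by fact
  interpret D: color_coalgebra \<phi> D by fact
  interpret s: vector_space s by fact
  have *: "\<phi> g (cdeg D b) * (c * ceps D b) = c * ceps D b" for g b c
    using D.eps_deg[of b] by (cases "ceps D b = 0") auto
  have "sweedler s (tensor_coalg C D) (\<lambda>x y. s (ceps (tensor_coalg C D) x) (F y)) (i, j) =
     sweedler s C (\<lambda>a a'. s (ceps C a) (sweedler s D (\<lambda>b b'. s (ceps D b) (F (a', b'))) j)) i"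
    by (simp add: sweedler_tensor_coalg[OF s] s.sweedler_scale *)
  then show ?thesis by (simp add: C.sweedler_eps_left[OF s] D.sweedler_eps_left[OF s])
qed

lemma tensor_coalg_eps_right:
  assumes C: "color_coalgebra \<phi> C" and D: "color_coalgebra \<phi> D" and s: "vector_space s"
  shows "sweedler s (tensor_coalg C D) (\<lambda>x y. s (ceps (tensor_coalg C D) y) (F x)) (i, j) = F (i, j)"
proof -
  interpret C: color_coalgebra \<phi> C by fact
  interpret D: color_coalgebra \<phi> D by fact
  interpret s: vector_space s by fact
  have *: "\<phi> (cdeg C b) g * (ceps C b * c) = ceps C b * c" for g b c
    using C.eps_deg[of b] by (cases "ceps C b = 0") auto
  have "sweedler s (tensor_coalg C D) (\<lambda>x y. s (ceps (tensor_coalg C D) y) (F x)) (i, j) =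
     sweedler s C (\<lambda>a a'. s (ceps C a') (sweedler s D (\<lambda>b b'. s (ceps D b') (F (a, b))) j)) i"
    by (simp add: sweedler_tensor_coalg[OF s] s.sweedler_scale *)
  then show ?thesis by (simp add: C.sweedler_eps_right[OF s] D.sweedler_eps_right[OF s])
qed

lemma color_coalgebra_tensor_coalg:
  fixes C :: "('g, 'k, 'i) color_coalg" and D :: "('g, 'k, 'j) color_coalg"
  assumes C: "color_coalgebra \<phi> C" and D: "color_coalgebra \<phi> D"
  shows "color_coalgebra \<phi> (tensor_coalg C D)"
proof unfold_locales
  interpret C: color_coalgebra \<phi> C by fact
  interpret D: color_coalgebra \<phi> D by fact
  interpret F: vector_space "free_scale :: 'k \<Rightarrow> (('i \<times> 'j) \<times> ('i \<times> 'j) \<Rightarrow>\<^sub>0 'k) \<Rightarrow> _"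
    by (rule vector_space_free_scale)
  let ?T = "tensor_coalg C D"
  fix ij :: "'i \<times> 'j"
  obtain i j where ij: "ij = (i, j)" by (cases ij)
  show "ceps ?T ij \<noteq> 0 \<Longrightarrow> cdeg ?T ij = 0"
    using C.eps_deg D.eps_deg by (simp add: ij)
  show "cdeg ?T x + cdeg ?T y = cdeg ?T ij" if xy: "(x, y) \<in> Poly_Mapping.keys (cdelta ?T ij)" for x y
  proof -
    let ?P = "{t::('i \<times> 'j) \<times> ('i \<times> 'j) \<Rightarrow>\<^sub>0 'k. \<forall>(x, y) \<in> Poly_Mapping.keys t. cdeg ?T x + cdeg ?T y = cdeg ?T ij}"
    have sub: "F.subspace ?P"
    proof (rule F.subspaceI)
      show "t + u \<in> ?P" if "t \<in> ?P" "u \<in> ?P" for t u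
        using that Poly_Mapping.keys_add[of t u] by blast
      show "free_scale c t \<in> ?P" if "t \<in> ?P" for c t
        using that keys_free_scale[of c t] by blast
    qed simp
    have "cdelta ?T ij = sweedler free_scale C (\<lambda>a a'. sweedler free_scale D (\<lambda>b b'.
        free_scale (\<phi> (cdeg C a') (cdeg D b)) (pure_tensor ((a, b), (a', b')))) j) i"
      by (simp add: tensor_coalg_def ij)
    also have "\<dots> \<in> ?P"
    proof (intro vector_space.sweedler_in_subspace[OF vector_space_free_scale sub])
      fix a a' b b' assume "(a, a') \<in> Poly_Mapping.keys (cdelta C i)" "(b, b') \<in> Poly_Mapping.keys (cdelta D j)"
      then have "cdeg C a + cdeg C a' = cdeg C i" "cdeg D b + cdeg D b' = cdeg D j"
        using C.delta_deg D.delta_deg by auto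
      then have "cdeg ?T (a, b) + cdeg ?T (a', b') = cdeg ?T ij" by (simp add: ij algebra_simps)
      then show "free_scale (\<phi> (cdeg C a') (cdeg D b)) (pure_tensor ((a, b), (a', b'))) \<in> ?P"
        using keys_free_scale[of "\<phi> (cdeg C a') (cdeg D b)" "pure_tensor ((a, b), (a', b'))"] by auto
    qed
    finally show ?thesis using xy by auto
  qed
  show "sweedler free_scale ?T (\<lambda>x z. sweedler free_scale ?T (\<lambda>a b. pure_tensor (a, b, z)) x) ij =
    sweedler free_scale ?T (\<lambda>x z. sweedler free_scale ?T (\<lambda>b c. pure_tensor (x, b, c)) z) ij"
    by (rule tensor_coalg_coassoc[OF C D vector_space_free_scale])
  show "sweedler free_scale ?T (\<lambda>j k. free_scale (ceps ?T j) (pure_tensor k)) ij = pure_tensor ij"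
    unfolding ij by (rule tensor_coalg_eps_left[OF C D vector_space_free_scale])
  show "sweedler free_scale ?T (\<lambda>j k. free_scale (ceps ?T k) (pure_tensor j)) ij = pure_tensor ij"
    unfolding ij by (rule tensor_coalg_eps_right[OF C D vector_space_free_scale])
  have "sweedler free_scale ?T (\<lambda>j k. pure_tensor (j, k)) ij = cdelta ?T ij"
    by (simp add: sweedler_def case_prod_unfold)
  then show "sweedler free_scale ?T (\<lambda>j k. free_scale (\<phi> (cdeg ?T j) (cdeg ?T k)) (pure_tensor (k, j))) ij = cdelta ?T ij"
    by (simp add: tensor_coalg_cocomm[OF C D vector_space_free_scale])
qed

end

section \<open>Commutators in groups\<close>

context Group.group
begin

definition gconj where "gconj x y = x \<otimes> y \<otimes> inv x"

definition gcomm where "gcomm x y = x \<otimes> y \<otimes> inv x \<otimes> inv y"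

lemma inv_cancel [simp]:
  "\<lbrakk>x \<in> carrier G; y \<in> carrier G\<rbrakk> \<Longrightarrow> x \<otimes> (inv x \<otimes> y) = y"
  "\<lbrakk>x \<in> carrier G; y \<in> carrier G\<rbrakk> \<Longrightarrow> inv x \<otimes> (x \<otimes> y) = y"
  by (simp_all add: m_assoc[symmetric])

lemmas word_simps = gconj_def gcomm_def m_assoc inv_mult_group

lemma gconj_closed [simp]: "\<lbrakk>x \<in> carrier G; y \<in> carrier G\<rbrakk> \<Longrightarrow> gconj x y \<in> carrier G"
  and gcomm_closed [simp]: "\<lbrakk>x \<in> carrier G; y \<in> carrier G\<rbrakk> \<Longrightarrow> gcomm x y \<in> carrier G"
  by (simp_all add: word_simps)

lemma gconj_mult:
  "\<lbrakk>a \<in> carrier G; x \<in> carrier G; y \<in> carrier G\<rbrakk> \<Longrightarrow> gconj a (x \<otimes> y) = gconj a x \<otimes> gconj a y"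
  by (simp add: word_simps)

lemma gcomm_eq_gconj_mult: "\<lbrakk>x \<in> carrier G; y \<in> carrier G\<rbrakk> \<Longrightarrow> gcomm x y = gconj x y \<otimes> inv y"
  by (simp add: word_simps)

lemma gconj_eq_gcomm_mult: "\<lbrakk>x \<in> carrier G; y \<in> carrier G\<rbrakk> \<Longrightarrow> gconj x y = gcomm x y \<otimes> y"
  by (simp add: word_simps)

lemma inv_gcomm: "\<lbrakk>x \<in> carrier G; y \<in> carrier G\<rbrakk> \<Longrightarrow> inv (gcomm x y) = gcomm y x"
  by (simp add: word_simps)

text \<open>The inverse stays a commutator with the arguments in the same order: when \<open>y\<close> belongs to a
  normal subgroup, so does \<open>gconj x y\<close>.\<close>

lemma inv_gcomm_eq_gcomm_inv:
  "\<lbrakk>x \<in> carrier G; y \<in> carrier G\<rbrakk> \<Longrightarrow> inv (gcomm x y) = gcomm (inv x) (gconj x y)"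
  by (simp add: word_simps)

lemma gconj_gcomm:
  "\<lbrakk>a \<in> carrier G; x \<in> carrier G; y \<in> carrier G\<rbrakk> \<Longrightarrow> gconj a (gcomm x y) = gcomm (gconj a x) (gconj a y)"
  by (simp add: word_simps)

lemma gcomm_mult_right:
  "\<lbrakk>a \<in> carrier G; x \<in> carrier G; y \<in> carrier G\<rbrakk> \<Longrightarrow> gcomm a (x \<otimes> y) = gcomm a x \<otimes> gconj x (gcomm a y)"
  by (simp add: word_simps)

lemma gcomm_inv_right:
  "\<lbrakk>a \<in> carrier G; x \<in> carrier G\<rbrakk> \<Longrightarrow> gcomm a (inv x) = gconj (inv x) (inv (gcomm a x))"
  by (simp add: word_simps)

text \<open>The Hall-Witt identity for \<open>inv x\<close>, \<open>y\<close> and \<open>a\<close>, solved for the factor that contains the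
  commutator of \<open>x\<close> and \<open>y\<close>.\<close>

lemma hall_witt:
  "\<lbrakk>a \<in> carrier G; x \<in> carrier G; y \<in> carrier G\<rbrakk> \<Longrightarrow> gcomm a (gcomm x y) =
    gconj x (inv (gconj y (gcomm (inv x) (gcomm (inv y) a)) \<otimes> gconj a (gcomm y (gcomm (inv a) (inv x)))))"
  by (simp add: word_simps)

lemma gconj_in_normal: "N \<lhd> G \<Longrightarrow> x \<in> carrier G \<Longrightarrow> y \<in> N \<Longrightarrow> gconj x y \<in> N"
  unfolding gconj_def by (rule normal.inv_op_closed2)

lemma three_subgroups:
  assumes "N \<lhd> G" "a \<in> carrier G" "x \<in> carrier G" "y \<in> carrier G"
    and "gcomm (inv x) (gcomm (inv y) a) \<in> N" "gcomm y (gcomm (inv a) (inv x)) \<in> N"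
  shows "gcomm a (gcomm x y) \<in> N"
proof -
  interpret N: normal N G by fact
  show ?thesis unfolding hall_witt[OF assms(2-4)]
    using assms by (intro gconj_in_normal N.m_inv_closed N.m_closed) auto
qed

end

section \<open>Bilinear calculus in a color Hopf algebra\<close>

locale cocommutative_color_hopf =
  skew_bicharacter \<phi> + cocommutative_color_hopf_algebra \<phi> H
  for \<phi> :: "'g::ab_group_add \<Rightarrow> 'g \<Rightarrow> 'k::field"
    and H :: "('g, 'k, 'a::ring_1) color_hopf"
begin

sublocale V: vector_space "scale H" by (rule vector_space)

sublocale S: Vector_Spaces.linear "scale H" "scale H" "antipode H" by (rule antipode_linear)

sublocale counit: Vector_Spaces.linear "scale H" "(*)" "counit H" by (rule counit_linear)

abbreviation bil where "bil s b \<equiv> bilinear_map (scale H) (scale H) s b"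

abbreviation huq where "huq \<equiv> huq_commutator \<phi> H"
abbreviation comm where "comm \<equiv> commutator_element \<phi> H"
abbreviation adj where "adj \<equiv> adjoint_action \<phi> H"
abbreviation normal_sub where "normal_sub \<equiv> normal_color_hopf_subalgebra \<phi> H"
abbreviation ssum where "ssum \<equiv> sweedler (scale H)"
abbreviation comult_eq where "comult_eq x t \<equiv> tensor_eq (scale H) (scale H) (comult H x) t"

lemmas bilI = bilinear_mapI[OF vector_space vector_space]

lemma homog_decompI:
  assumes "\<And>g. d g \<in> homog H g" "finite S" "\<And>g. g \<notin> S \<Longrightarrow> d g = 0" "a = (\<Sum>g\<in>S. d g)"
  shows "homog_decomp H a d"
proof -
  have "{g. d g \<noteq> 0} \<subseteq> S" using assms(3) by blast
  then have "(\<Sum>g | d g \<noteq> 0. d g) = (\<Sum>g\<in>S. d g)"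
    using assms(2) by (intro sum.mono_neutral_left) auto
  then show ?thesis
    unfolding homog_decomp_def using assms finite_subset[OF \<open>{g. d g \<noteq> 0} \<subseteq> S\<close>] by auto
qed

lemma homog_decomp_homog_part: "homog_decomp H a (homog_part H a)"
  using theI'[OF homog_direct_sum[of a]] by (simp only: homog_part_def)

lemma homog_part_eqI: "homog_decomp H a d \<Longrightarrow> homog_part H a = d"
  using homog_direct_sum[of a] homog_decomp_homog_part[of a] by auto

lemma homog_part_homog: "homog_part H a g \<in> homog H g"
  using homog_decomp_homog_part[of a] by (simp add: homog_decomp_def)

lemma finite_homog_part: "finite {g. homog_part H a g \<noteq> 0}"
  using homog_decomp_homog_part[of a] by (simp add: homog_decomp_def)

lemma sum_homog_part:
  assumes "finite T" "{g. homog_part H a g \<noteq> 0} \<subseteq> T"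
  shows "(\<Sum>g\<in>T. homog_part H a g) = a"
proof -
  have "a = (\<Sum>g | homog_part H a g \<noteq> 0. homog_part H a g)"
    using homog_decomp_homog_part[of a] by (simp add: homog_decomp_def)
  also have "\<dots> = (\<Sum>g\<in>T. homog_part H a g)"
    using assms by (intro sum.mono_neutral_left) auto
  finally show ?thesis by simp
qed

lemma homog_part_add: "homog_part H (a + b) g = homog_part H a g + homog_part H b g"
proof -
  let ?T = "{g. homog_part H a g \<noteq> 0} \<union> {g. homog_part H b g \<noteq> 0}"
  have "homog_decomp H (a + b) (\<lambda>g. homog_part H a g + homog_part H b g)"
  proof (rule homog_decompI)
    show "finite ?T" by (simp add: finite_homog_part)
    show "a + b = (\<Sum>g\<in>?T. homog_part H a g + homog_part H b g)"
      by (simp add: sum.distrib sum_homog_part finite_homog_part)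
    show "homog_part H a g + homog_part H b g \<in> homog H g" for g
      by (rule V.subspace_add[OF homog_subspace homog_part_homog homog_part_homog])
  qed auto
  from homog_part_eqI[OF this] show ?thesis by simp
qed

lemma homog_part_scale: "homog_part H (scale H c a) g = scale H c (homog_part H a g)"
proof -
  have "homog_decomp H (scale H c a) (\<lambda>g. scale H c (homog_part H a g))"
  proof (rule homog_decompI)
    show "finite {g. homog_part H a g \<noteq> 0}" by (rule finite_homog_part)
    show "scale H c a = (\<Sum>g | homog_part H a g \<noteq> 0. scale H c (homog_part H a g))"
      by (simp add: V.scale_sum_right[symmetric] sum_homog_part finite_homog_part)
    show "scale H c (homog_part H a g) \<in> homog H g" for g
      by (rule V.subspace_scale[OF homog_subspace homog_part_homog])
  qed auto
  from homog_part_eqI[OF this] show ?thesis by simp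
qed

lemma homog_part_of_homog: "a \<in> homog H g \<Longrightarrow> homog_part H a h = (if h = g then a else 0)"
proof -
  assume a: "a \<in> homog H g"
  have "homog_decomp H a (\<lambda>h. if h = g then a else 0)"
    by (rule homog_decompI[of _ "{g}"]) (auto simp: a V.subspace_0[OF homog_subspace])
  from homog_part_eqI[OF this] show ?thesis by simp
qed

lemma homog_part_zero [simp]: "homog_part H 0 g = 0"
  using homog_part_of_homog[OF V.subspace_0[OF homog_subspace]] by auto

text \<open>Passing an element of degree \<open>h\<close> over \<open>x\<close> from the right multiplies the
  component of degree \<open>g\<close> of \<open>x\<close> by \<open>\<phi> g h\<close>. Collecting these signs in one linear map
  keeps every formula below bilinear.\<close>

definition twist :: "'g \<Rightarrow> 'a \<Rightarrow> 'a" where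
  "twist h x = (\<Sum>g | homog_part H x g \<noteq> 0. scale H (\<phi> g h) (homog_part H x g))"

lemma twist_superset:
  assumes "finite T" "{g. homog_part H x g \<noteq> 0} \<subseteq> T"
  shows "twist h x = (\<Sum>g\<in>T. scale H (\<phi> g h) (homog_part H x g))"
  unfolding twist_def using assms by (intro sum.mono_neutral_left) auto

lemma twist_add: "twist h (x + y) = twist h x + twist h y"
proof -
  let ?T = "{g. homog_part H x g \<noteq> 0} \<union> {g. homog_part H y g \<noteq> 0}"
  have "{g. homog_part H (x + y) g \<noteq> 0} \<subseteq> ?T" by (auto simp: homog_part_add)
  then show ?thesis
    by (simp add: twist_superset[of ?T] finite_homog_part homog_part_add V.scale_right_distrib sum.distrib)
qed

lemma twist_scale: "twist h (scale H c x) = scale H c (twist h x)"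
proof -
  let ?T = "{g. homog_part H x g \<noteq> 0}"
  have "{g. homog_part H (scale H c x) g \<noteq> 0} \<subseteq> ?T" by (auto simp: homog_part_scale)
  then show ?thesis
    by (simp add: twist_superset[of ?T] finite_homog_part homog_part_scale V.scale_sum_right mult.commute)
qed

lemma twist_homog: "x \<in> homog H g \<Longrightarrow> twist h x = scale H (\<phi> g h) x"
  by (subst twist_superset[of "{g}"]) (auto simp: homog_part_of_homog)

lemma homog_induct:
  assumes "\<And>x g. x \<in> homog H g \<Longrightarrow> P x" "\<And>x y. P x \<Longrightarrow> P y \<Longrightarrow> P (x + y)"
  shows "P x"
proof -
  have "P 0" using assms(1) V.subspace_0[OF homog_subspace] by blast
  then have "P (\<Sum>g\<in>T. homog_part H x g)" for T
    by (induct T rule: infinite_finite_induct) (auto intro: assms homog_part_homog)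
  then show ?thesis using sum_homog_part[OF finite_homog_part order_refl, of x] by metis
qed

lemma twist_twist: "twist h (twist g x) = twist (g + h) x"
  by (induct x rule: homog_induct) (simp_all add: twist_homog twist_add twist_scale add_right mult_ac)

lemma twist_zero [simp]: "twist 0 x = x"
  by (induct x rule: homog_induct) (simp_all add: twist_homog twist_add)

lemma twist_one [simp]: "twist h 1 = 1"
  using twist_homog[OF homog_one] by simp

lemma twist_mult_homog: "y \<in> homog H g \<Longrightarrow> twist h (x * y) = scale H (\<phi> g h) (twist h x * y)"
proof (induct x rule: homog_induct)
  case (1 x g')
  then show ?case
    by (simp add: twist_homog[OF homog_mult[OF 1(1,2)]] twist_homog[OF 1(1)] scale_mult_left add_left mult_ac)
qed (simp add: distrib_right twist_add V.scale_right_distrib)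

lemma color_twist_homog_right:
  assumes b: "bil s f" and s: "vector_space s" and y: "y \<in> homog H h"
  shows "color_twist \<phi> H s f x y = f (twist h x) y"
proof (cases "y = 0")
  case True
  then show ?thesis by (simp add: color_twist_def bilinear_mapD[OF b])
next
  case False
  interpret L: Vector_Spaces.linear "scale H" s "\<lambda>x. f x y" using b by (simp add: bilinear_map_def)
  have "{h. homog_part H y h \<noteq> 0} = {h}" using y False by (auto simp: homog_part_of_homog)
  then show ?thesis
    using y by (simp add: color_twist_def homog_part_of_homog twist_def L.sum L.scale)
qed

lemma color_twist_homog:
  assumes b: "bil s f" and s: "vector_space s" and "x \<in> homog H g" "y \<in> homog H h"
  shows "color_twist \<phi> H s f x y = s (\<phi> g h) (f x y)"
  using assms by (simp add: color_twist_homog_right twist_homog bilinear_mapD[OF b])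

text \<open>Bilinearity makes the terms outside the supports vanish, so the supports may be enlarged
  to compare different arguments.\<close>

lemma color_twist_superset:
  assumes b: "bil s f" and s: "vector_space s" and "finite T" "{g. homog_part H x g \<noteq> 0} \<subseteq> T"
    and "finite U" "{g. homog_part H y g \<noteq> 0} \<subseteq> U"
  shows "color_twist \<phi> H s f x y =
    (\<Sum>g\<in>T. \<Sum>h\<in>U. s (\<phi> g h) (f (homog_part H x g) (homog_part H y h)))"
proof -
  interpret s: vector_space s by fact
  have "(\<Sum>h | homog_part H y h \<noteq> 0. s (\<phi> g h) (f (homog_part H x g) (homog_part H y h))) =
      (\<Sum>h\<in>U. s (\<phi> g h) (f (homog_part H x g) (homog_part H y h)))" for g
    using assms by (intro sum.mono_neutral_left) (auto simp: bilinear_mapD[OF b])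
  then show ?thesis unfolding color_twist_def
    using assms by (simp, intro sum.mono_neutral_left) (auto simp: bilinear_mapD[OF b])
qed

lemma bil_color_twist:
  assumes b: "bil s f" and s: "vector_space s"
  shows "bil s (color_twist \<phi> H s f)"
proof (rule bilI[OF s])
  interpret s: vector_space s by fact
  let ?T = "\<lambda>x. {g. homog_part H x g \<noteq> 0}"
  note sup = color_twist_superset[OF b s]
  note simps = sum.distrib homog_part_add homog_part_scale bilinear_mapD[OF b] s.scale_right_distrib
    finite_homog_part s.scale_sum_right mult.commute
  have sub: "?T (x + x') \<subseteq> ?T x \<union> ?T x'" "?T (scale H c x) \<subseteq> ?T x" for x x' c
    by (auto simp: homog_part_add homog_part_scale)
  fix x x' y y' c
  show "color_twist \<phi> H s f (x + x') y = color_twist \<phi> H s f x y + color_twist \<phi> H s f x' y"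
    using sub(1) by (simp add: sup[of "?T x \<union> ?T x'" _ "?T y"] simps)
  show "color_twist \<phi> H s f x (y + y') = color_twist \<phi> H s f x y + color_twist \<phi> H s f x y'"
    using sub(1) by (simp add: sup[of "?T x" _ "?T y \<union> ?T y'"] simps)
  show "color_twist \<phi> H s f (scale H c x) y = s c (color_twist \<phi> H s f x y)"
    using sub(2) by (simp add: sup[of "?T x" _ "?T y"] simps)
  show "color_twist \<phi> H s f x (scale H c y) = s c (color_twist \<phi> H s f x y)"
    using sub(2) by (simp add: sup[of "?T x" _ "?T y"] simps)
qed

lemma color_twist_map:
  assumes "Vector_Spaces.linear s s' h"
  shows "h (color_twist \<phi> H s f x y) = color_twist \<phi> H s' (\<lambda>x y. h (f x y)) x y"
proof -
  interpret Vector_Spaces.linear s s' h by fact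
  show ?thesis by (simp add: color_twist_def sum scale)
qed

lemma color_twist_fun_add:
  assumes "vector_space s"
  shows "color_twist \<phi> H s (\<lambda>x y. f x y + f' x y) x y = color_twist \<phi> H s f x y + color_twist \<phi> H s f' x y"
proof -
  interpret vector_space s by fact
  show ?thesis by (simp add: color_twist_def sum.distrib scale_right_distrib)
qed

lemma color_twist_fun_scale:
  assumes "vector_space s"
  shows "color_twist \<phi> H s (\<lambda>x y. s c (f x y)) x y = s c (color_twist \<phi> H s f x y)"
proof -
  interpret vector_space s by fact
  show ?thesis by (simp add: color_twist_def scale_sum_right mult.commute)
qed

text \<open>The value on \<open>\<Delta>(x)\<close> of the linear map that the bilinear map \<open>b\<close> induces on the tensor
  square.\<close>

definition comult_sum :: "('k \<Rightarrow> 'v \<Rightarrow> 'v::ab_group_add) \<Rightarrow> ('a \<Rightarrow> 'a \<Rightarrow> 'v) \<Rightarrow> 'a \<Rightarrow> 'v" where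
  "comult_sum s b x = linear_ext s (\<lambda>(u, v). b u v) (comult H x)"

lemma comult_sum_add:
  assumes "bil s b" "vector_space s"
  shows "comult_sum s b (x + y) = comult_sum s b x + comult_sum s b y"
  unfolding comult_sum_def
  by (simp add: tensor_eq_bilinear_map[OF comult_add assms(1)] vector_space.linear_ext_add[OF assms(2)])

lemma comult_sum_scale:
  assumes "bil s b" "vector_space s"
  shows "comult_sum s b (scale H c x) = s c (comult_sum s b x)"
  unfolding comult_sum_def
  by (simp add: tensor_eq_bilinear_map[OF comult_scale assms(1)] vector_space.linear_ext_free_scale[OF assms(2)])

lemma linear_comult_sum:
  assumes "bil s b" "vector_space s"
  shows "Vector_Spaces.linear (scale H) s (comult_sum s b)"
  by (rule linear_mapI) (simp_all add: assms vector_space comult_sum_add comult_sum_scale)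

lemma comult_sum_one:
  assumes "bil s b" "vector_space s"
  shows "comult_sum s b 1 = b 1 1"
proof -
  interpret vector_space s by fact
  show ?thesis unfolding comult_sum_def
    by (simp add: tensor_eq_bilinear_map[OF comult_one assms(1)])
qed

lemma comult_sum_fun_add:
  assumes "vector_space s"
  shows "comult_sum s (\<lambda>u v. b u v + b' u v) x = comult_sum s b x + comult_sum s b' x"
  unfolding comult_sum_def vector_space.linear_ext_fun_add[OF assms, symmetric]
  by (simp add: case_prod_unfold)

lemma comult_sum_fun_scale:
  assumes "vector_space s"
  shows "comult_sum s (\<lambda>u v. s c (b u v)) x = s c (comult_sum s b x)"
  unfolding comult_sum_def vector_space.linear_ext_fun_scale[OF assms, symmetric]
  by (simp add: case_prod_unfold)

lemma comult_sum_mult: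
  assumes b: "bil s b" and s: "vector_space s"
  shows "comult_sum s b (x * y) = comult_sum s (\<lambda>u v. comult_sum s
    (\<lambda>p q. color_twist \<phi> H s (\<lambda>v p. b (u * p) (v * q)) v p) y) x"
proof -
  interpret s: vector_space s by fact
  have "comult_sum s b (x * y) =
      linear_ext s (\<lambda>(u, v). b u v) (tensor_mult \<phi> H (comult H x) (comult H y))"
    unfolding comult_sum_def by (rule tensor_eq_bilinear_map[OF comult_mult b])
  also have "\<dots> = comult_sum s (\<lambda>u v. comult_sum s
    (\<lambda>p q. color_twist \<phi> H s (\<lambda>v p. b (u * p) (v * q)) v p) y) x"
    unfolding tensor_mult_def comult_sum_def
    by (simp add: s.linear_ext_bind case_prod_unfold color_twist_map[OF s.linear_linear_ext])
  finally show ?thesis .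
qed

section \<open>The group of points\<close>

text \<open>A degree-preserving coalgebra map, given by its values on the basis.\<close>

definition point :: "('g, 'k, 'i) color_coalg \<Rightarrow> ('i \<Rightarrow> 'a) \<Rightarrow> bool" where
  "point C f \<longleftrightarrow> (\<forall>i. f i \<in> homog H (cdeg C i)) \<and> (\<forall>i. counit H (f i) = ceps C i) \<and>
     (\<forall>i. tensor_eq (scale H) (scale H) (comult H (f i))
       (sweedler free_scale C (\<lambda>j k. pure_tensor (f j, f k)) i))"

lemma point_homog: "point C f \<Longrightarrow> f i \<in> homog H (cdeg C i)"
  and point_counit: "point C f \<Longrightarrow> counit H (f i) = ceps C i"
  by (simp_all add: point_def)

lemma comult_sum_point:
  assumes "point C f" "bil s b" and s: "vector_space s"
  shows "comult_sum s b (f i) = sweedler s C (\<lambda>j k. b (f j) (f k)) i"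
proof -
  interpret s: vector_space s by fact
  have "comult_sum s b (f i) = linear_ext s (\<lambda>(x, y). b x y) (sweedler free_scale C (\<lambda>j k. pure_tensor (f j, f k)) i)"
    unfolding comult_sum_def using assms(1) by (intro tensor_eq_bilinear_map[OF _ assms(2)]) (simp add: point_def)
  then show ?thesis by (simp add: s.sweedler_linear_ext)
qed

lemma pointI:
  assumes "\<And>i. f i \<in> homog H (cdeg C i)" "\<And>i. counit H (f i) = ceps C i"
    and "\<And>b i. bil (*) b \<Longrightarrow> comult_sum (*) b (f i) = sweedler (*) C (\<lambda>j k. b (f j) (f k)) i"
  shows "point C f"
  unfolding point_def
proof (intro conjI allI assms(1,2) tensor_eqI[OF vector_space vector_space])
  fix i b assume b: "bil (*) b"
  show "linear_ext (*) (\<lambda>(x, y). b x y) (comult H (f i)) =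
    linear_ext (*) (\<lambda>(x, y). b x y) (sweedler free_scale C (\<lambda>j k. pure_tensor (f j, f k)) i)"
    using assms(3)[OF b] by (simp add: vector_space.sweedler_linear_ext[OF vector_space_times]) (simp add: comult_sum_def)
qed

text \<open>The sign comes from passing the first part of \<open>f j\<close> over the second part of \<open>x\<close>; the
  right-hand side is again bilinear in the two parts of \<open>x\<close>, which permits iteration.\<close>

lemma comult_sum_mult_point:
  assumes f: "point C f" and b: "bil s b" and s: "vector_space s"
  shows "comult_sum s b (x * f j) =
    sweedler s C (\<lambda>k l. comult_sum s (\<lambda>u v. b (u * f k) (twist (cdeg C k) v * f l)) x) j"
proof -
  interpret s: vector_space s by fact
  note bD = bilinear_mapD[OF b]
  have b1: "bil s (\<lambda>v p. b (u * p) (v * q))" for u q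
    by (rule bilI[OF s]) (simp_all add: distrib_left distrib_right bD scale_mult_left scale_mult_right)
  note cD = bilinear_mapD[OF bil_color_twist[OF b1 s]]
  have b2: "bil s (\<lambda>p q. color_twist \<phi> H s (\<lambda>v p. b (u * p) (v * q)) v p)" for u v
    by (rule bilI[OF s]) (simp_all add: cD, simp_all add: distrib_left bD scale_mult_right
        color_twist_fun_add[OF s] color_twist_fun_scale[OF s])
  have "comult_sum s b (x * f j) = comult_sum s (\<lambda>u v. sweedler s C
      (\<lambda>k l. b (u * f k) (twist (cdeg C k) v * f l)) j) x"
    by (simp add: comult_sum_mult[OF b s] comult_sum_point[OF f b2 s]
        color_twist_homog_right[OF b1 s point_homog[OF f]])
  also have "\<dots> = sweedler s C (\<lambda>k l. comult_sum s (\<lambda>u v. b (u * f k) (twist (cdeg C k) v * f l)) x) j"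
    unfolding comult_sum_def s.sweedler_linear_ext_swap by (simp add: case_prod_unfold)
  finally show ?thesis .
qed

definition conv :: "('g, 'k, 'i) color_coalg \<Rightarrow> ('i \<Rightarrow> 'a) \<Rightarrow> ('i \<Rightarrow> 'a) \<Rightarrow> 'i \<Rightarrow> 'a" where
  "conv C f g = ssum C (\<lambda>j k. f j * g k)"

definition conv_one :: "('g, 'k, 'i) color_coalg \<Rightarrow> 'i \<Rightarrow> 'a" where
  "conv_one C i = scale H (ceps C i) 1"

lemma mult_sweedler_right: "x * ssum C F i = ssum C (\<lambda>j k. x * F j k) i"
  by (rule sweedler_map[OF linear_mapI[OF vector_space vector_space]]) (simp_all add: distrib_left scale_mult_right)

lemma mult_sweedler_left: "ssum C F i * x = ssum C (\<lambda>j k. F j k * x) i"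
  by (rule sweedler_map[OF linear_mapI[OF vector_space vector_space]]) (simp_all add: distrib_right scale_mult_left)

lemma conv_assoc:
  assumes "color_coalgebra \<phi> C"
  shows "conv C (conv C f g) h = conv C f (conv C g h)"
proof -
  interpret C: color_coalgebra \<phi> C by fact
  show ?thesis
    by (rule ext) (simp add: conv_def mult_sweedler_left mult_sweedler_right mult.assoc
        C.sweedler_assoc[OF vector_space])
qed

lemma conv_one_left:
  assumes "color_coalgebra \<phi> C"
  shows "conv C (conv_one C) f = f"
proof -
  interpret C: color_coalgebra \<phi> C by fact
  show ?thesis
    by (rule ext) (simp add: conv_def conv_one_def scale_mult_left C.sweedler_eps_left[OF vector_space])
qed

lemma antipode_mult_bil: "bil (scale H) (\<lambda>x y. antipode H x * y)"
  and mult_antipode_bil: "bil (scale H) (\<lambda>x y. x * antipode H y)"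
  by (intro bilI vector_space; simp add: distrib_left distrib_right scale_mult_left scale_mult_right S.add S.scale)+

lemma conv_antipode_left:
  assumes "point C f"
  shows "conv C (\<lambda>i. antipode H (f i)) f = conv_one C"
proof (rule ext)
  fix i
  have "comult_sum (scale H) (\<lambda>x y. antipode H x * y) (f i) = scale H (counit H (f i)) 1"
    unfolding comult_sum_def by (rule antipode_left)
  then show "conv C (\<lambda>i. antipode H (f i)) f i = conv_one C i"
    by (simp add: comult_sum_point[OF assms antipode_mult_bil vector_space] point_counit[OF assms]
        conv_def conv_one_def)
qed

lemma conv_antipode_right:
  assumes "point C f"
  shows "conv C f (\<lambda>i. antipode H (f i)) = conv_one C"
proof (rule ext)
  fix i
  have "comult_sum (scale H) (\<lambda>x y. x * antipode H y) (f i) = scale H (counit H (f i)) 1"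
    unfolding comult_sum_def by (rule antipode_right)
  then show "conv C f (\<lambda>i. antipode H (f i)) i = conv_one C i"
    by (simp add: comult_sum_point[OF assms mult_antipode_bil vector_space] point_counit[OF assms]
        conv_def conv_one_def)
qed

lemma conv_homog:
  assumes "color_coalgebra \<phi> C" "\<And>i. f i \<in> homog H (cdeg C i)" "\<And>i. g i \<in> homog H (cdeg C i)"
  shows "conv C f g i \<in> homog H (cdeg C i)"
proof -
  interpret C: color_coalgebra \<phi> C by fact
  show ?thesis unfolding conv_def
    by (rule V.sweedler_in_subspace[OF homog_subspace])
      (metis C.delta_deg assms(2,3) homog_mult)
qed

lemma counit_conv:
  assumes "color_coalgebra \<phi> C" "\<And>i. counit H (f i) = ceps C i" "\<And>i. counit H (g i) = ceps C i"
  shows "counit H (conv C f g i) = ceps C i"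
proof -
  interpret C: color_coalgebra \<phi> C by fact
  show ?thesis unfolding conv_def
    by (simp add: sweedler_map[OF counit_linear] counit_mult assms(2,3) C.sweedler_eps_left[OF vector_space_times])
qed

lemma bil_mult_twist:
  assumes "bil s b" "vector_space s"
  shows "bil s (\<lambda>u v. b (u * x) (twist h v * y))"
  by (rule bilI[OF assms(2)])
    (simp_all add: distrib_right scale_mult_left twist_add twist_scale bilinear_mapD[OF assms(1)])

lemma bil_sweedler:
  assumes "bil s b"
  shows "b (ssum C F i) (ssum D G j) =
    sweedler s C (\<lambda>p q. sweedler s D (\<lambda>c d. b (F p q) (G c d)) j) i"
proof -
  have "Vector_Spaces.linear (scale H) s (\<lambda>x. b x y)" "Vector_Spaces.linear (scale H) s (b x)" for x y
    using assms by (auto simp: bilinear_map_def)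
  note lin = this
  have "b (ssum C F i) (ssum D G j) =
      sweedler s C (\<lambda>p q. b (F p q) (ssum D G j)) i"
    by (rule sweedler_map[OF lin(1)])
  then show ?thesis by (simp only: sweedler_map[OF lin(2)])
qed

text \<open>The multiplication is a coalgebra map for the braided coproduct, and by
  \<open>sweedler_middle_swap\<close> so is the coproduct of \<open>C\<close>. The two exchanges of middle factors undo
  each other, signs included.\<close>

lemma point_conv:
  assumes C: "color_coalgebra \<phi> C" and f: "point C f" and g: "point C g"
  shows "point C (conv C f g)"
proof (rule pointI)
  interpret C: color_coalgebra \<phi> C by fact
  note K = vector_space_times
  show "conv C f g i \<in> homog H (cdeg C i)" for i
    by (rule conv_homog[OF C point_homog[OF f] point_homog[OF g]])
  show "counit H (conv C f g i) = ceps C i" for i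
    by (rule counit_conv[OF C point_counit[OF f] point_counit[OF g]])
  fix i and b :: "'a \<Rightarrow> 'a \<Rightarrow> 'k" assume b: "bil (*) b"
  note bD = bilinear_mapD[OF b]
  have "comult_sum (*) b (conv C f g i) = sweedler (*) C (\<lambda>j k. comult_sum (*) b (f j * g k)) i"
    unfolding conv_def by (rule sweedler_map[OF linear_comult_sum[OF b K]])
  also have "\<dots> = sweedler (*) C (\<lambda>j k. sweedler (*) C (\<lambda>c d. sweedler (*) C (\<lambda>a a'.
      \<phi> (cdeg C a') (cdeg C c) * b (f a * g c) (f a' * g d)) j) k) i"
    by (simp add: comult_sum_mult_point[OF g b K] comult_sum_point[OF f bil_mult_twist[OF b K] K]
        twist_homog[OF point_homog[OF f]] scale_mult_left bD)
  also have "\<dots> = sweedler (*) C (\<lambda>j k. sweedler (*) C (\<lambda>a a'. sweedler (*) C (\<lambda>c d.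
      \<phi> (cdeg C a') (cdeg C c) * b (f a * g c) (f a' * g d)) k) j) i"
    by (subst vector_space.sweedler_swap[OF K]) (rule refl)
  also have "\<dots> = sweedler (*) C (\<lambda>j k. sweedler (*) C (\<lambda>a a'. sweedler (*) C (\<lambda>c d.
      b (f a * g a') (f c * g d)) k) j) i"
    by (rule C.sweedler_middle_swap[OF K, symmetric])
  also have "\<dots> = sweedler (*) C (\<lambda>j k. b (conv C f g j) (conv C f g k)) i"
    by (simp add: conv_def bil_sweedler[OF b])
  finally show "comult_sum (*) b (conv C f g i) = sweedler (*) C (\<lambda>j k. b (conv C f g j) (conv C f g k)) i" .
qed

lemma point_conv_one:
  assumes C: "color_coalgebra \<phi> C"
  shows "point C (conv_one C)"
proof (rule pointI)
  interpret C: color_coalgebra \<phi> C by fact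
  note K = vector_space_times
  show "conv_one C i \<in> homog H (cdeg C i)" for i
  proof (cases "ceps C i = 0")
    case True then show ?thesis by (simp add: conv_one_def V.subspace_0[OF homog_subspace])
  next
    case False
    then show ?thesis
      using C.eps_deg[of i] by (simp add: conv_one_def V.subspace_scale[OF homog_subspace homog_one])
  qed
  show "counit H (conv_one C i) = ceps C i" for i
    by (simp add: conv_one_def counit.scale counit_one)
  fix i and b :: "'a \<Rightarrow> 'a \<Rightarrow> 'k" assume b: "bil (*) b"
  show "comult_sum (*) b (conv_one C i) = sweedler (*) C (\<lambda>j k. b (conv_one C j) (conv_one C k)) i"
    using C.sweedler_eps_right[OF K, of "\<lambda>j. ceps C j * b 1 1" i]
    by (simp add: conv_one_def comult_sum_scale[OF b K] comult_sum_one[OF b K] bilinear_mapD[OF b])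
qed

lemma counit_antipode_point:
  assumes C: "color_coalgebra \<phi> C" and f: "point C f"
  shows "counit H (antipode H (f i)) = ceps C i"
proof -
  interpret C: color_coalgebra \<phi> C by fact
  have "counit H (conv C (\<lambda>i. antipode H (f i)) f i) = ceps C i"
    by (simp add: conv_antipode_left[OF f] conv_one_def counit.scale counit_one)
  then show ?thesis
    by (simp add: conv_def sweedler_map[OF counit_linear] counit_mult point_counit[OF f] mult.commute[of _ "ceps C _"]
        C.sweedler_eps_right[OF vector_space_times])
qed

text \<open>Let \<open>g = S \<circ> f\<close>. In the convolution algebra of linear maps from \<open>C\<close> to the tensor square
  of the Hopf algebra, both \<open>\<Delta> \<circ> g\<close> and \<open>(g \<otimes> g) \<circ> \<Delta>\<close> are inverse to \<open>\<Delta> \<circ> f\<close>, hence they are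
  equal. The tensor square acts faithfully on bilinear forms by right translation, and the
  computation is carried out with these translations.\<close>

lemma point_antipode:
  assumes C: "color_coalgebra \<phi> C" and f: "point C f"
  shows "point C (\<lambda>i. antipode H (f i))"
proof (rule pointI)
  interpret C: color_coalgebra \<phi> C by fact
  note K = vector_space_times
  let ?g = "\<lambda>i. antipode H (f i)"
  have g_homog: "?g i \<in> homog H (cdeg C i)" for i
    by (rule antipode_homog[OF point_homog[OF f]])
  show "?g i \<in> homog H (cdeg C i)" for i by (rule g_homog)
  show "counit H (?g i) = ceps C i" for i
    by (rule counit_antipode_point[OF C f])
  fix i and b :: "'a \<Rightarrow> 'a \<Rightarrow> 'k" assume b: "bil (*) b"
  note bD = bilinear_mapD[OF b]
  \<comment> \<open>\<open>R h p q\<close> is the translation by \<open>p \<otimes> q\<close>, where \<open>h\<close> is the degree of \<open>p\<close>.\<close>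
  define R where "R h p q b' u v = b' (u * p) (twist h v * q)" for h p q and b' :: "'a \<Rightarrow> 'a \<Rightarrow> 'k" and u v
  have R: "bil (*) (R h p q b')" if "bil (*) b'" for h p q b'
    unfolding R_def by (rule bil_mult_twist[OF that K])
  have Rmult: "comult_sum (*) b' (x * f m) =
      sweedler (*) C (\<lambda>p q. comult_sum (*) (R (cdeg C p) (f p) (f q) b') x) m" if "bil (*) b'" for b' x m
    unfolding comult_sum_mult_point[OF f that K] R_def[abs_def] ..
  \<comment> \<open>\<open>(\<Delta> \<circ> f) * ((g \<otimes> g) \<circ> \<Delta>)\<close> is the unit of the convolution algebra.\<close>
  have cancel: "sweedler (*) C (\<lambda>j k. sweedler (*) C (\<lambda>p q. sweedler (*) C (\<lambda>c d.
      R (cdeg C p) (f p) (f q) (R (cdeg C c) (?g c) (?g d) b) u v) k) j) i = ceps C i * b u v" for u v i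
  proof -
    have "sweedler (*) C (\<lambda>j k. sweedler (*) C (\<lambda>p q. sweedler (*) C (\<lambda>c d.
        R (cdeg C p) (f p) (f q) (R (cdeg C c) (?g c) (?g d) b) u v) k) j) i =
      sweedler (*) C (\<lambda>j k. sweedler (*) C (\<lambda>p q. sweedler (*) C (\<lambda>c d. \<phi> (cdeg C q) (cdeg C c) *
        b (u * (f p * ?g c)) (twist (cdeg C p + cdeg C c) v * (f q * ?g d))) k) j) i"
      unfolding R_def
      by (simp add: twist_mult_homog[OF point_homog[OF f]] twist_twist scale_mult_left bD mult.assoc)
    also have "\<dots> = sweedler (*) C (\<lambda>j k. sweedler (*) C (\<lambda>p q. sweedler (*) C (\<lambda>c d.
        b (u * (f p * ?g q)) (twist (cdeg C p + cdeg C q) v * (f c * ?g d))) k) j) i"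
      by (rule C.sweedler_middle_swap[OF K, symmetric])
    also have "\<dots> = sweedler (*) C (\<lambda>j k. sweedler (*) C (\<lambda>p q. sweedler (*) C (\<lambda>c d.
        b (u * (f p * ?g q)) (twist (cdeg C j) v * (f c * ?g d))) k) j) i"
      by (intro C.sweedler_cong) simp
    also have "\<dots> = sweedler (*) C (\<lambda>j k. b (u * conv C f ?g j) (twist (cdeg C j) v * conv C f ?g k)) i"
      by (simp add: conv_def mult_sweedler_right bil_sweedler[OF b])
    also have "\<dots> = sweedler (*) C (\<lambda>j k. ceps C k * (ceps C j * b u (twist (cdeg C j) v))) i"
      by (simp add: conv_antipode_right[OF f] conv_one_def scale_mult_right bD)
    also have "\<dots> = sweedler (*) C (\<lambda>j k. ceps C k * (ceps C j * b u v)) i"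
    proof (rule C.sweedler_cong)
      fix j k show "ceps C k * (ceps C j * b u (twist (cdeg C j) v)) = ceps C k * (ceps C j * b u v)"
        using C.eps_deg[of j] by (cases "ceps C j = 0") auto
    qed
    also have "\<dots> = ceps C i * b u v"
      by (rule C.sweedler_eps_right[OF K, where F = "\<lambda>j. ceps C j * b u v"])
    finally show ?thesis .
  qed
  let ?Q = "\<lambda>b' x. comult_sum (*) b' x"
  \<comment> \<open>Insert this unit behind \<open>\<Delta> \<circ> g\<close>, reassociate, and cancel \<open>\<Delta> \<circ> g\<close> against \<open>\<Delta> \<circ> f\<close>.\<close>
  have "?Q b (?g i) = sweedler (*) C (\<lambda>j k. ceps C k * ?Q b (?g j)) i"
    by (rule C.sweedler_eps_right[OF K, symmetric])
  also have "\<dots> = sweedler (*) C (\<lambda>j k. ?Q (\<lambda>u v. ceps C k * b u v) (?g j)) i"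
    by (simp add: comult_sum_fun_scale[OF K])
  also have "\<dots> = sweedler (*) C (\<lambda>j k. sweedler (*) C (\<lambda>m n. sweedler (*) C (\<lambda>p q. sweedler (*) C (\<lambda>c d.
      ?Q (R (cdeg C p) (f p) (f q) (R (cdeg C c) (?g c) (?g d) b)) (?g j)) n) m) k) i"
    unfolding comult_sum_def cancel[symmetric]
    by (simp add: vector_space.sweedler_linear_ext_swap[OF K] case_prod_unfold)
  also have "\<dots> = sweedler (*) C (\<lambda>j k. sweedler (*) C (\<lambda>m n. sweedler (*) C (\<lambda>c d. sweedler (*) C (\<lambda>p q.
      ?Q (R (cdeg C p) (f p) (f q) (R (cdeg C c) (?g c) (?g d) b)) (?g j)) m) n) k) i"
    by (subst (2) vector_space.sweedler_swap[OF K]) (rule refl)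
  also have "\<dots> = sweedler (*) C (\<lambda>j k. sweedler (*) C (\<lambda>m n. sweedler (*) C (\<lambda>c d.
      ?Q (R (cdeg C c) (?g c) (?g d) b) (?g j * f m)) n) k) i"
    by (simp only: Rmult[OF R[OF b]])
  also have "\<dots> = sweedler (*) C (\<lambda>k n. sweedler (*) C (\<lambda>j m. sweedler (*) C (\<lambda>c d.
      ?Q (R (cdeg C c) (?g c) (?g d) b) (?g j * f m)) n) k) i"
    by (rule C.sweedler_assoc[OF K, symmetric])
  also have "\<dots> = sweedler (*) C (\<lambda>k n. sweedler (*) C (\<lambda>c d. sweedler (*) C (\<lambda>j m.
      ?Q (R (cdeg C c) (?g c) (?g d) b) (?g j * f m)) k) n) i"
    by (subst vector_space.sweedler_swap[OF K]) (rule refl)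
  also have "\<dots> = sweedler (*) C (\<lambda>k n. sweedler (*) C (\<lambda>c d.
      ?Q (R (cdeg C c) (?g c) (?g d) b) (conv C ?g f k)) n) i"
    by (simp add: conv_def sweedler_map[OF linear_comult_sum[OF R[OF b] K]])
  also have "\<dots> = sweedler (*) C (\<lambda>k n. ceps C k * sweedler (*) C (\<lambda>c d. b (?g c) (?g d)) n) i"
    by (simp add: conv_antipode_left[OF f] conv_one_def comult_sum_scale[OF R[OF b] K]
        comult_sum_one[OF R[OF b] K] vector_space.sweedler_scale[OF K])
      (simp add: R_def)
  also have "\<dots> = sweedler (*) C (\<lambda>c d. b (?g c) (?g d)) i"
    by (rule C.sweedler_eps_left[OF K])
  finally show "?Q b (?g i) = sweedler (*) C (\<lambda>j k. b (?g j) (?g k)) i" .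
qed

definition Pts :: "('g, 'k, 'i) color_coalg \<Rightarrow> ('i \<Rightarrow> 'a) monoid" where
  "Pts C = \<lparr>carrier = {f. point C f}, mult = conv C, one = conv_one C\<rparr>"

lemma Pts_simps [simp]:
  "carrier (Pts C) = {f. point C f}" "f \<otimes>\<^bsub>Pts C\<^esub> g = conv C f g" "\<one>\<^bsub>Pts C\<^esub> = conv_one C"
  by (simp_all add: Pts_def)

lemma group_Pts:
  assumes C: "color_coalgebra \<phi> C"
  shows "Group.group (Pts C)"
proof (rule groupI)
  fix f assume "f \<in> carrier (Pts C)"
  then show "\<exists>g\<in>carrier (Pts C). g \<otimes>\<^bsub>Pts C\<^esub> f = \<one>\<^bsub>Pts C\<^esub>"
    using conv_antipode_left[of C f] point_antipode[OF C, of f] by auto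
qed (simp_all add: point_conv[OF C] point_conv_one[OF C] conv_assoc[OF C] conv_one_left[OF C])

lemma inv_Pts:
  assumes C: "color_coalgebra \<phi> C" and f: "point C f"
  shows "inv\<^bsub>Pts C\<^esub> f = (\<lambda>i. antipode H (f i))"
proof -
  interpret Group.group "Pts C" by (rule group_Pts[OF C])
  show ?thesis
    by (rule inv_equality) (simp_all add: f conv_antipode_left[OF f] point_antipode[OF C f])
qed

text \<open>The points \<open>f\<close> and \<open>g\<close> pulled back along the projections of a tensor coalgebra, which
  apply the counit to the other factor. The tensor coalgebra with its two projections is the
  product of \<open>C\<close> and \<open>D\<close> among cocommutative coalgebras.\<close>

definition fst_point :: "('g, 'k, 'j) color_coalg \<Rightarrow> ('i \<Rightarrow> 'a) \<Rightarrow> 'i \<times> 'j \<Rightarrow> 'a" where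
  "fst_point D f = (\<lambda>(i, j). scale H (ceps D j) (f i))"

definition snd_point :: "('g, 'k, 'i) color_coalg \<Rightarrow> ('j \<Rightarrow> 'a) \<Rightarrow> 'i \<times> 'j \<Rightarrow> 'a" where
  "snd_point C g = (\<lambda>(i, j). scale H (ceps C i) (g j))"

lemma eps_phi_right:
  assumes "color_coalgebra \<phi> C"
  shows "\<phi> g (cdeg C i) * ceps C i = ceps C i"
proof -
  interpret C: color_coalgebra \<phi> C by fact
  show ?thesis using C.eps_deg[of i] by (cases "ceps C i = 0") auto
qed

lemma eps_phi_left:
  assumes "color_coalgebra \<phi> C"
  shows "\<phi> (cdeg C i) g * ceps C i = ceps C i"
proof -
  interpret C: color_coalgebra \<phi> C by fact
  show ?thesis using C.eps_deg[of i] by (cases "ceps C i = 0") auto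
qed

lemma bilinear_map_scale_scale:
  assumes "bil s b"
  shows "b (scale H c x) (scale H d y) = s c (s d (b x y))"
  by (simp only: bilinear_mapD(3)[OF assms], simp only: bilinear_mapD(4)[OF assms])

text \<open>The pair of projections of the product is the identity: both parts of the coproduct that
  are hit by a counit drop out, and with them the sign.\<close>

lemma sweedler_fst_snd_point:
  assumes C: "color_coalgebra \<phi> C" and D: "color_coalgebra \<phi> D" and b: "bil s b" and s: "vector_space s"
  shows "sweedler s (tensor_coalg C D) (\<lambda>x y. b (fst_point D f x) (snd_point C g y)) (i, j) = b (f i) (g j)"
proof -
  interpret C: color_coalgebra \<phi> C by fact
  interpret D: color_coalgebra \<phi> D by fact
  interpret s: vector_space s by fact
  have "s (\<phi> (cdeg C a') (cdeg D c)) (b (fst_point D f (a, c)) (snd_point C g (a', c'))) =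
      s (ceps C a') (s (ceps D c) (b (f a) (g c')))" for a a' c c'
    unfolding fst_point_def snd_point_def prod.case bilinear_map_scale_scale[OF b]
    by (subst (2) s.scale_left_commute)
      (simp only: s.scale_scale mult.assoc[symmetric] eps_phi_right[OF D])
  then show ?thesis
    by (simp only: sweedler_tensor_coalg[OF s] s.sweedler_scale[symmetric]
        D.sweedler_eps_left[OF s] C.sweedler_eps_right[OF s])
qed

lemma sweedler_fst_point:
  assumes C: "color_coalgebra \<phi> C" and D: "color_coalgebra \<phi> D" and b: "bil s b" and s: "vector_space s"
  shows "sweedler s (tensor_coalg C D) (\<lambda>x y. b (fst_point D f x) (fst_point D f' y)) (i, j) =
    s (ceps D j) (sweedler s C (\<lambda>x y. b (f x) (f' y)) i)"
proof -
  interpret D: color_coalgebra \<phi> D by fact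
  interpret s: vector_space s by fact
  have "s (\<phi> (cdeg C a') (cdeg D c)) (b (fst_point D f (a, c)) (fst_point D f' (a', c'))) =
      s (ceps D c) (s (ceps D c') (b (f a) (f' a')))" for a a' c c'
    unfolding fst_point_def prod.case bilinear_map_scale_scale[OF b]
    by (simp only: s.scale_scale mult.assoc[symmetric] eps_phi_right[OF D])
  then show ?thesis
    by (simp only: sweedler_tensor_coalg[OF s] D.sweedler_eps_left[OF s, where F = "\<lambda>k. s (ceps D k) _"] s.sweedler_scale)
qed

lemma sweedler_snd_point:
  assumes C: "color_coalgebra \<phi> C" and D: "color_coalgebra \<phi> D" and b: "bil s b" and s: "vector_space s"
  shows "sweedler s (tensor_coalg C D) (\<lambda>x y. b (snd_point C g x) (snd_point C g' y)) (i, j) =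
    s (ceps C i) (sweedler s D (\<lambda>x y. b (g x) (g' y)) j)"
proof -
  interpret C: color_coalgebra \<phi> C by fact
  interpret s: vector_space s by fact
  have "s (\<phi> (cdeg C a') (cdeg D c)) (b (snd_point C g (a, c)) (snd_point C g' (a', c'))) =
      s (ceps C a) (s (ceps C a') (b (g c) (g' c')))" for a a' c c'
    unfolding snd_point_def prod.case bilinear_map_scale_scale[OF b]
    by (subst s.scale_left_commute) (simp only: s.scale_scale eps_phi_left[OF C])
  then show ?thesis
    by (simp only: sweedler_tensor_coalg[OF s] s.sweedler_scale[symmetric])
      (simp only: C.sweedler_eps_left[OF s, where F = "\<lambda>k. s (ceps C k) _"])
qed

lemma point_fst_point:
  assumes C: "color_coalgebra \<phi> C" and D: "color_coalgebra \<phi> D" and f: "point C f"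
  shows "point (tensor_coalg C D) (fst_point D f)"
proof (rule pointI; clarify?)
  interpret D: color_coalgebra \<phi> D by fact
  fix i j
  show "fst_point D f (i, j) \<in> homog H (cdeg (tensor_coalg C D) (i, j))"
    using point_homog[OF f, of i] D.eps_deg[of j]
    by (cases "ceps D j = 0")
      (simp_all add: fst_point_def V.subspace_0[OF homog_subspace] V.subspace_scale[OF homog_subspace])
  show "counit H (fst_point D f (i, j)) = ceps (tensor_coalg C D) (i, j)"
    by (simp add: fst_point_def counit.scale point_counit[OF f] mult.commute)
  fix b :: "'a \<Rightarrow> 'a \<Rightarrow> 'k" assume b: "bil (*) b"
  show "comult_sum (*) b (fst_point D f (i, j)) =
      sweedler (*) (tensor_coalg C D) (\<lambda>j k. b (fst_point D f j) (fst_point D f k)) (i, j)"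
    unfolding sweedler_fst_point[OF C D b vector_space_times]
    by (simp add: fst_point_def comult_sum_scale[OF b vector_space_times] comult_sum_point[OF f b vector_space_times])
qed

lemma point_snd_point:
  assumes C: "color_coalgebra \<phi> C" and D: "color_coalgebra \<phi> D" and g: "point D g"
  shows "point (tensor_coalg C D) (snd_point C g)"
proof (rule pointI; clarify?)
  interpret C: color_coalgebra \<phi> C by fact
  fix i j
  show "snd_point C g (i, j) \<in> homog H (cdeg (tensor_coalg C D) (i, j))"
    using point_homog[OF g, of j] C.eps_deg[of i]
    by (cases "ceps C i = 0")
      (simp_all add: snd_point_def V.subspace_0[OF homog_subspace] V.subspace_scale[OF homog_subspace])
  show "counit H (snd_point C g (i, j)) = ceps (tensor_coalg C D) (i, j)"
    by (simp add: snd_point_def counit.scale point_counit[OF g] mult.commute)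
  fix b :: "'a \<Rightarrow> 'a \<Rightarrow> 'k" assume b: "bil (*) b"
  show "comult_sum (*) b (snd_point C g (i, j)) =
      sweedler (*) (tensor_coalg C D) (\<lambda>j k. b (snd_point C g j) (snd_point C g k)) (i, j)"
    unfolding sweedler_snd_point[OF C D b vector_space_times]
    by (simp add: snd_point_def comult_sum_scale[OF b vector_space_times] comult_sum_point[OF g b vector_space_times])
qed

lemma mult_bil: "bil (scale H) (*)"
  by (rule bilI[OF vector_space]) (simp_all add: distrib_left distrib_right scale_mult_left scale_mult_right)

section \<open>Commutators and conjugates of points\<close>

lemma bil_adjoint_kernel: "bil (scale H) (\<lambda>b y. x * y * antipode H b)"
  by (rule bilI[OF vector_space])
    (simp_all add: distrib_left distrib_right scale_mult_left scale_mult_right S.add S.scale mult.assoc)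

lemma bil_adjoint_kernel': "bil (scale H) (\<lambda>x b. color_twist \<phi> H (scale H) (\<lambda>b y. x * y * antipode H b) b y)"
  by (rule bilI[OF vector_space])
    (simp_all add: bilinear_mapD[OF bil_color_twist[OF bil_adjoint_kernel vector_space]],
     simp_all add: distrib_right scale_mult_left color_twist_fun_add[OF vector_space] color_twist_fun_scale[OF vector_space])

lemma adjoint_action_eq:
  "adj a y = comult_sum (scale H)
     (\<lambda>x b. color_twist \<phi> H (scale H) (\<lambda>b y. x * y * antipode H b) b y) a"
  by (simp add: adjoint_action_def comult_sum_def)

lemma bil_adjoint_action: "bil (scale H) adj"
  by (rule bilI[OF vector_space])
    (simp_all add: adjoint_action_eq comult_sum_add[OF bil_adjoint_kernel' vector_space]
      comult_sum_scale[OF bil_adjoint_kernel' vector_space]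
      bilinear_mapD[OF bil_color_twist[OF bil_adjoint_kernel vector_space]]
      comult_sum_fun_add[OF vector_space] comult_sum_fun_scale[OF vector_space])

lemma adjoint_action_point:
  assumes "point C f" "y \<in> homog H h"
  shows "adj (f i) y =
    ssum C (\<lambda>j k. scale H (\<phi> (cdeg C k) h) (f j * y * antipode H (f k))) i"
  by (simp add: adjoint_action_eq comult_sum_point[OF assms(1) bil_adjoint_kernel' vector_space]
      color_twist_homog[OF bil_adjoint_kernel vector_space point_homog[OF assms(1)] assms(2)])

lemma bil_commutator_kernel: "bil (scale H) (\<lambda>v w. x * w * antipode H v * z)"
  by (rule bilI[OF vector_space])
    (simp_all add: distrib_left distrib_right scale_mult_left scale_mult_right S.add S.scale mult.assoc)

lemma bil_commutator_kernel1:
  "bil (scale H) (\<lambda>y z. color_twist \<phi> H (scale H) (\<lambda>v w. x * w * antipode H v * antipode H z) v y)"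
  by (rule bilI[OF vector_space])
    (simp_all add: bilinear_mapD[OF bil_color_twist[OF bil_commutator_kernel vector_space]],
     simp_all add: distrib_left scale_mult_right S.add S.scale
       color_twist_fun_add[OF vector_space] color_twist_fun_scale[OF vector_space])

lemma bil_commutator_kernel2:
  "bil (scale H) (\<lambda>x v. comult_sum (scale H)
     (\<lambda>y z. color_twist \<phi> H (scale H) (\<lambda>v w. x * w * antipode H v * antipode H z) v y) a)"
  by (rule bilI[OF vector_space])
    (simp_all add: bilinear_mapD[OF bil_color_twist[OF bil_commutator_kernel vector_space]]
       comult_sum_fun_add[OF vector_space] comult_sum_fun_scale[OF vector_space],
     simp_all add: distrib_right scale_mult_left
       color_twist_fun_add[OF vector_space] color_twist_fun_scale[OF vector_space]
       comult_sum_fun_add[OF vector_space] comult_sum_fun_scale[OF vector_space])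

lemma commutator_element_eq:
  "comm a b = comult_sum (scale H) (\<lambda>x v. comult_sum (scale H)
     (\<lambda>y z. color_twist \<phi> H (scale H) (\<lambda>v w. x * w * antipode H v * antipode H z) v y) b) a"
  by (simp add: commutator_element_def comult_sum_def)

lemma bil_commutator_element: "bil (scale H) comm"
  by (rule bilI[OF vector_space])
    (simp_all add: commutator_element_eq comult_sum_add[OF bil_commutator_kernel2 vector_space]
      comult_sum_scale[OF bil_commutator_kernel2 vector_space]
      comult_sum_add[OF bil_commutator_kernel1 vector_space]
      comult_sum_scale[OF bil_commutator_kernel1 vector_space]
      comult_sum_fun_add[OF vector_space] comult_sum_fun_scale[OF vector_space])

lemma commutator_element_point:
  assumes "point C f" "point D g"
  shows "comm (f i) (g j) = ssum C (\<lambda>a b. ssum D (\<lambda>c d.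
    scale H (\<phi> (cdeg C b) (cdeg D c)) (f a * g c * antipode H (f b) * antipode H (g d))) j) i"
  by (simp only: commutator_element_eq comult_sum_point[OF assms(1) bil_commutator_kernel2 vector_space])
    (simp add: comult_sum_point[OF assms(2) bil_commutator_kernel1 vector_space]
      color_twist_homog[OF bil_commutator_kernel vector_space point_homog[OF assms(1)] point_homog[OF assms(2)]])

abbreviation pconj :: "('g, 'k, 'i) color_coalg \<Rightarrow> ('i \<Rightarrow> 'a) \<Rightarrow> ('i \<Rightarrow> 'a) \<Rightarrow> 'i \<Rightarrow> 'a" where
  "pconj C \<equiv> group.gconj (Pts C)"

abbreviation pcomm :: "('g, 'k, 'i) color_coalg \<Rightarrow> ('i \<Rightarrow> 'a) \<Rightarrow> ('i \<Rightarrow> 'a) \<Rightarrow> 'i \<Rightarrow> 'a" where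
  "pcomm C \<equiv> group.gcomm (Pts C)"

lemma pconj_eq_conv:
  assumes "color_coalgebra \<phi> C" "point C f" "point C g"
  shows "pconj C f g = conv C (conv C f g) (\<lambda>i. antipode H (f i))"
  by (simp add: group.gconj_def[OF group_Pts[OF assms(1)]] inv_Pts[OF assms(1)] assms)

lemma pcomm_eq_conv:
  assumes "color_coalgebra \<phi> C" "point C f" "point C g"
  shows "pcomm C f g = conv C (conv C (conv C f g) (\<lambda>i. antipode H (f i))) (\<lambda>i. antipode H (g i))"
  by (simp add: group.gcomm_def[OF group_Pts[OF assms(1)]] inv_Pts[OF assms(1)] assms)

text \<open>Expanding the adjoint action on \<open>f(i\<^sub>1)\<close> produces \<open>f(i\<^sub>1) g(i\<^sub>3) S f(i\<^sub>2)\<close> with the sign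
  for exchanging \<open>i\<^sub>2\<close> and \<open>i\<^sub>3\<close>, which cocommutativity removes.\<close>

lemma pconj_eq_adjoint_action:
  assumes C: "color_coalgebra \<phi> C" and f: "point C f" and g: "point C g"
  shows "pconj C f g i = ssum C (\<lambda>j k. adj (f j) (g k)) i"
proof -
  interpret C: color_coalgebra \<phi> C by fact
  have "pconj C f g i = ssum C (\<lambda>j k. ssum C (\<lambda>a b.
      f a * g b * antipode H (f k)) j) i"
    by (simp add: pconj_eq_conv[OF C f g] conv_def mult_sweedler_left)
  also have "\<dots> = ssum C (\<lambda>j k. adj (f j) (g k)) i"
    by (subst C.sweedler_swap_last[OF vector_space]) (simp add: adjoint_action_point[OF f point_homog[OF g]])
  finally show ?thesis .
qed

text \<open>As for conjugates, the sign in the definition of the commutator element is the one of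
  \<open>sweedler_middle_swap\<close>.\<close>

lemma pcomm_eq_commutator_element:
  assumes C: "color_coalgebra \<phi> C" and f: "point C f" and g: "point C g"
  shows "pcomm C f g i = ssum C (\<lambda>j k. comm (f j) (g k)) i"
proof -
  interpret C: color_coalgebra \<phi> C by fact
  have "pcomm C f g i = conv C (conv C f g) (conv C (\<lambda>i. antipode H (f i)) (\<lambda>i. antipode H (g i))) i"
    by (simp add: pcomm_eq_conv[OF C f g] conv_assoc[OF C])
  also have "\<dots> = ssum C (\<lambda>j k. ssum C (\<lambda>a b. ssum C (\<lambda>c d.
      f a * g b * antipode H (f c) * antipode H (g d)) k) j) i"
    by (simp add: conv_def bil_sweedler[OF mult_bil] mult.assoc)
  also have "\<dots> = ssum C (\<lambda>j k. comm (f j) (g k)) i"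
    by (subst C.sweedler_middle_swap[OF vector_space]) (simp add: commutator_element_point[OF f g])
  finally show ?thesis .
qed

end

section \<open>Every subcoalgebra is spanned by a point\<close>

lemma free_scale_one: "free_scale 1 t = t"
  by (rule poly_mapping_eqI) simp

lemma tensor_eq_refl: "tensor_eq sA sB t t"
proof -
  interpret F: vector_space free_scale by (rule vector_space_free_scale)
  show ?thesis by (simp add: tensor_eq_def F.span_zero)
qed

lemma tensor_eq_add:
  assumes "tensor_eq sA sB t u" "tensor_eq sA sB t' u'"
  shows "tensor_eq sA sB (t + t') (u + u')"
proof -
  interpret F: vector_space free_scale by (rule vector_space_free_scale)
  show ?thesis using F.span_add[OF assms[unfolded tensor_eq_def]]
    by (simp add: tensor_eq_def add_diff_add)
qed

lemma tensor_eq_scale: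
  assumes "tensor_eq sA sB t u"
  shows "tensor_eq sA sB (free_scale c t) (free_scale c u)"
proof -
  interpret F: vector_space free_scale by (rule vector_space_free_scale)
  show ?thesis using F.span_scale[OF assms[unfolded tensor_eq_def], of c]
    by (simp add: tensor_eq_def F.scale_right_diff_distrib)
qed

lemma tensor_eq_trans:
  assumes "tensor_eq sA sB t u" "tensor_eq sA sB u v"
  shows "tensor_eq sA sB t v"
proof -
  interpret F: vector_space free_scale by (rule vector_space_free_scale)
  show ?thesis using F.span_add[OF assms[unfolded tensor_eq_def]]
    by (simp add: tensor_eq_def)
qed

lemma tensor3_eq_trilinear_map:
  fixes s :: "'k::field \<Rightarrow> 'a::ab_group_add \<Rightarrow> 'a" and s' :: "'k \<Rightarrow> 'v::ab_group_add \<Rightarrow> 'v"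
  assumes eq: "tensor3_eq s t u" and s': "vector_space s'"
    and "\<And>y z. Vector_Spaces.linear s s' (\<lambda>x. T x y z)"
    and "\<And>x z. Vector_Spaces.linear s s' (\<lambda>y. T x y z)"
    and "\<And>x y. Vector_Spaces.linear s s' (\<lambda>z. T x y z)"
  shows "linear_ext s' (\<lambda>(x, y, z). T x y z) t = linear_ext s' (\<lambda>(x, y, z). T x y z) u"
proof -
  interpret L1: Vector_Spaces.linear s s' "\<lambda>x. T x y z" for y z by fact
  interpret L2: Vector_Spaces.linear s s' "\<lambda>y. T x y z" for x z by fact
  interpret L3: Vector_Spaces.linear s s' "\<lambda>z. T x y z" for x y by fact
  interpret P: vector_space_pair free_scale s'
    by (intro vector_space_pair.intro vector_space_free_scale s')
  note simps = vector_space.linear_ext_diff[OF s'] vector_space.linear_ext_single[OF s']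
    vector_space.linear_ext_free_scale[OF s']
  have "linear_ext s' (\<lambda>(x, y, z). T x y z) (t - u) = 0"
    by (rule P.linear_eq_0_on_span[OF vector_space.linear_linear_ext[OF s'] _ eq[unfolded tensor3_eq_def]])
      (auto simp: simps L1.add L2.add L3.add L1.scale L2.scale L3.scale)
  then show ?thesis by (simp add: simps)
qed

lemma subspace_keys_subset:
  "module.subspace free_scale {t :: 'x \<Rightarrow>\<^sub>0 'k::field. Poly_Mapping.keys t \<subseteq> A}"
proof -
  interpret F: vector_space "free_scale :: 'k \<Rightarrow> ('x \<Rightarrow>\<^sub>0 'k) \<Rightarrow> _" by (rule vector_space_free_scale)
  show ?thesis
  proof (rule F.subspaceI)
    show "t + u \<in> {t. Poly_Mapping.keys t \<subseteq> A}"
      if "t \<in> {t. Poly_Mapping.keys t \<subseteq> A}" "u \<in> {t. Poly_Mapping.keys t \<subseteq> A}" for t u :: "'x \<Rightarrow>\<^sub>0 'k"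
      using that Poly_Mapping.keys_add[of t u] by blast
    show "free_scale c t \<in> {t. Poly_Mapping.keys t \<subseteq> A}"
      if "t \<in> {t. Poly_Mapping.keys t \<subseteq> A}" for c and t :: "'x \<Rightarrow>\<^sub>0 'k"
      using that keys_free_scale[of c t] by blast
  qed simp
qed

lemma keys_linear_ext_subset:
  assumes "\<And>x. x \<in> Poly_Mapping.keys t \<Longrightarrow> Poly_Mapping.keys (f x) \<subseteq> A"
  shows "Poly_Mapping.keys (linear_ext free_scale f t) \<subseteq> A"
  using vector_space.linear_ext_in_subspace[OF vector_space_free_scale subspace_keys_subset, of t f A] assms
  by auto

text \<open>A homogeneous basis, sorted by degree. Coordinates with respect to it give each tensor a
  normal form, which turns the comultiplication, known only up to equality of tensors, into
  structure constants.\<close>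

locale homog_basis = cocommutative_color_hopf \<phi> H
  for \<phi> :: "'g::ab_group_add \<Rightarrow> 'g \<Rightarrow> 'k::field"
    and H :: "('g, 'k, 'a::ring_1) color_hopf" +
  fixes B :: "'g \<Rightarrow> 'a set"
  assumes B_homog: "B g \<subseteq> homog H g"
    and B_span: "homog H g \<subseteq> V.span (B g)"
    and B_independent: "V.independent (\<Union>g. B g)"
begin

abbreviation "BB \<equiv> (\<Union>g. B g)"

lemma span_BB: "x \<in> V.span BB"
proof -
  have "homog_part H x g \<in> V.span BB" for g
    using homog_part_homog[of x g] B_span[of g] V.span_mono[of "B g" BB] by blast
  then have "(\<Sum>g | homog_part H x g \<noteq> 0. homog_part H x g) \<in> V.span BB"
    by (intro V.span_sum) auto
  then show ?thesis by (simp add: sum_homog_part finite_homog_part)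
qed

lemma BB_nonzero: "b \<in> BB \<Longrightarrow> b \<noteq> 0"
  using B_independent V.dependent_zero by metis

definition bdeg where "bdeg b = (SOME g. b \<in> B g)"

lemma B_bdeg: "b \<in> BB \<Longrightarrow> b \<in> B (bdeg b)"
  unfolding bdeg_def by (rule someI_ex) auto

lemma bdeg_homog: "b \<in> BB \<Longrightarrow> b \<in> homog H (bdeg b)"
  using B_bdeg B_homog by blast

lemma bdeg_eq: assumes "b \<in> B g" shows "bdeg b = g"
proof (rule ccontr)
  assume ne: "bdeg b \<noteq> g"
  have "b \<in> BB" using assms by auto
  then have "homog_part H b (bdeg b) = b" using homog_part_of_homog[OF bdeg_homog] by auto
  moreover have "homog_part H b (bdeg b) = 0" using homog_part_of_homog[OF subsetD[OF B_homog assms]] ne by simp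
  ultimately show False using BB_nonzero[OF \<open>b \<in> BB\<close>] by simp
qed

definition coord where "coord x = Abs_poly_mapping (V.representation BB x)"

lemma lookup_coord: "Poly_Mapping.lookup (coord x) = V.representation BB x"
  unfolding coord_def by (rule lookup_Abs_poly_mapping) (rule V.finite_representation)

lemma linear_coord: "Vector_Spaces.linear (scale H) free_scale coord"
  by (rule linear_mapI[OF vector_space vector_space_free_scale]; rule poly_mapping_eqI)
    (simp_all add: lookup_coord lookup_add V.representation_add[OF B_independent span_BB span_BB]
      V.representation_scale[OF B_independent span_BB])

sublocale coord: Vector_Spaces.linear "scale H" free_scale coord by (rule linear_coord)

lemma coord_basis: "b \<in> BB \<Longrightarrow> coord b = pure_tensor b"
  by (rule poly_mapping_eqI) (simp add: lookup_coord V.representation_basis[OF B_independent] lookup_single when_def)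

lemma coord_B: "b \<in> B g \<Longrightarrow> coord b = pure_tensor b"
  by (rule coord_basis) auto

lemma linear_ext_coord: "linear_ext (scale H) (\<lambda>b. b) (coord x) = x"
  using V.sum_nonzero_representation_eq[OF B_independent span_BB, of x]
  by (simp add: linear_ext_def keys.rep_eq lookup_coord)

lemma keys_coord_span: "x \<in> V.span J \<Longrightarrow> J \<subseteq> BB \<Longrightarrow> Poly_Mapping.keys (coord x) \<subseteq> J"
  using V.representation_extend[OF B_independent, of x J]
  by (auto simp: keys.rep_eq lookup_coord dest: V.representation_ne_zero)

lemma keys_coord: "Poly_Mapping.keys (coord x) \<subseteq> BB"
  by (rule keys_coord_span[OF span_BB]) simp

lemma keys_coord_homog: "x \<in> homog H g \<Longrightarrow> Poly_Mapping.keys (coord x) \<subseteq> B g"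
  using B_span by (intro keys_coord_span) auto

lemma linear_coord_expand:
  assumes "Vector_Spaces.linear (scale H) s h"
  shows "h x = linear_ext s h (coord x)"
  using linear_linear_ext_apply[OF assms, of "\<lambda>b. b" "coord x"] by (simp add: linear_ext_coord)

text \<open>The normal form of a pure tensor. The normal form \<open>delta x\<close> of the coproduct of \<open>x\<close> below
  is obtained by applying this bilinear map to any representative.\<close>

definition cpair where
  "cpair x y = linear_ext free_scale (\<lambda>a. linear_ext free_scale (\<lambda>b. pure_tensor (a, b)) (coord y)) (coord x)"

lemma bil_cpair: "bil free_scale cpair"
  by (rule bilI[OF vector_space_free_scale])
    (simp_all add: cpair_def coord.add coord.scale coord.vs2.linear_ext_add
      vector_space.linear_ext_add[OF vector_space_free_scale]
      vector_space.linear_ext_free_scale[OF vector_space_free_scale]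
      vector_space.linear_ext_fun_add[OF vector_space_free_scale]
      vector_space.linear_ext_fun_scale[OF vector_space_free_scale])

lemma cpair_basis: "a \<in> BB \<Longrightarrow> b \<in> BB \<Longrightarrow> cpair a b = pure_tensor (a, b)"
  by (simp add: cpair_def coord_basis vector_space.linear_ext_single[OF vector_space_free_scale] free_scale_one)

lemma keys_cpair:
  assumes "Poly_Mapping.keys (coord x) \<subseteq> I" "Poly_Mapping.keys (coord y) \<subseteq> J"
  shows "Poly_Mapping.keys (cpair x y) \<subseteq> I \<times> J"
  unfolding cpair_def using assms by (intro keys_linear_ext_subset) auto

lemma bilinear_cpair:
  assumes b: "bil s b" and s: "vector_space s"
  shows "linear_ext s (\<lambda>(a, c). b a c) (cpair x y) = b x y"
proof -
  interpret s: vector_space s by fact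
  have "b x y = linear_ext s (\<lambda>a. b a y) (coord x)"
    using b by (intro linear_coord_expand) (simp add: bilinear_map_def)
  moreover have "b a y = linear_ext s (\<lambda>c. b a c) (coord y)" for a
    using b by (intro linear_coord_expand) (simp add: bilinear_map_def)
  ultimately have "b x y = linear_ext s (\<lambda>a. linear_ext s (\<lambda>c. b a c) (coord y)) (coord x)" by simp
  then show ?thesis by (simp add: cpair_def s.linear_ext_bind)
qed

definition delta where "delta x = comult_sum free_scale cpair x"

lemma linear_delta: "Vector_Spaces.linear (scale H) free_scale delta"
  unfolding delta_def[abs_def] by (rule linear_comult_sum[OF bil_cpair vector_space_free_scale])

sublocale delta: Vector_Spaces.linear "scale H" free_scale delta by (rule linear_delta)

lemma comult_sum_delta:
  assumes b: "bil s b" and s: "vector_space s"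
  shows "comult_sum s b x = linear_ext s (\<lambda>(a, c). b a c) (delta x)"
proof -
  interpret s: vector_space s by fact
  show ?thesis unfolding delta_def comult_sum_def
    by (simp add: s.linear_ext_bind case_prod_unfold bilinear_cpair[OF b s, unfolded case_prod_unfold])
qed

lemma keys_delta: "Poly_Mapping.keys (delta x) \<subseteq> BB \<times> BB"
  unfolding delta_def comult_sum_def
  by (rule keys_linear_ext_subset) (auto dest!: subsetD[OF keys_cpair[OF keys_coord keys_coord]])

lemma delta_tensor_eq: "comult_eq x t \<Longrightarrow>
    delta x = linear_ext free_scale (\<lambda>(x, y). cpair x y) t"
  unfolding delta_def comult_sum_def by (rule tensor_eq_bilinear_map[OF _ bil_cpair])

text \<open>The normal form does not depend on the representative, so one may choose a representative
  adapted to the subspace; \<open>keys_delta_deg\<close> uses a homogeneous one in the same way.\<close>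

lemma keys_delta_subcoalgebra:
  assumes J: "J \<subseteq> BB" and t: "comult_eq x t"
    "Poly_Mapping.keys t \<subseteq> V.span J \<times> V.span J"
  shows "Poly_Mapping.keys (delta x) \<subseteq> J \<times> J"
  unfolding delta_tensor_eq[OF t(1)]
proof (rule keys_linear_ext_subset)
  fix xy assume "xy \<in> Poly_Mapping.keys t"
  then obtain x y where "xy = (x, y)" "x \<in> V.span J" "y \<in> V.span J" using t(2) by (cases xy) auto
  then show "Poly_Mapping.keys (case xy of (x, y) \<Rightarrow> cpair x y) \<subseteq> J \<times> J"
    using keys_cpair[of x J y J] keys_coord_span[OF _ J] by auto
qed

lemma keys_delta_deg:
  assumes x: "x \<in> homog H g" and ab: "(a, b) \<in> Poly_Mapping.keys (delta x)"
  shows "bdeg a + bdeg b = g"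
proof -
  obtain t where t: "comult_eq x t"
    "\<And>x y. (x, y)\<in>Poly_Mapping.keys t \<Longrightarrow> \<exists>h. x \<in> homog H h \<and> y \<in> homog H (g - h)"
    using comult_homog[OF x] by blast
  have "Poly_Mapping.keys (delta x) \<subseteq> {(a, b). bdeg a + bdeg b = g}"
    unfolding delta_tensor_eq[OF t(1)]
  proof (rule keys_linear_ext_subset)
    fix xy assume xy: "xy \<in> Poly_Mapping.keys t"
    obtain x y where xy': "xy = (x, y)" by (cases xy)
    obtain h where h: "x \<in> homog H h" "y \<in> homog H (g - h)" using t(2) xy xy' by blast
    have "Poly_Mapping.keys (cpair x y) \<subseteq> B h \<times> B (g - h)"
      by (intro keys_cpair keys_coord_homog h)
    also have "\<dots> \<subseteq> {(a, b). bdeg a + bdeg b = g}" by (auto simp: bdeg_eq)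
    finally show "Poly_Mapping.keys (case xy of (x, y) \<Rightarrow> cpair x y) \<subseteq> {(a, b). bdeg a + bdeg b = g}"
      by (simp add: xy')
  qed
  then show ?thesis using ab by blast
qed

definition ctriple where
  "ctriple x y z = linear_ext free_scale (\<lambda>a. linear_ext free_scale (\<lambda>b. linear_ext free_scale
     (\<lambda>c. pure_tensor (a, b, c)) (coord z)) (coord y)) (coord x)"

lemma linear_ctriple:
  "Vector_Spaces.linear (scale H) free_scale (\<lambda>x. ctriple x y z)"
  "Vector_Spaces.linear (scale H) free_scale (\<lambda>y. ctriple x y z)"
  "Vector_Spaces.linear (scale H) free_scale (\<lambda>z. ctriple x y z)"
  by (rule linear_mapI[OF vector_space vector_space_free_scale];
    simp add: ctriple_def coord.add coord.scale
      vector_space.linear_ext_add[OF vector_space_free_scale]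
      vector_space.linear_ext_free_scale[OF vector_space_free_scale]
      vector_space.linear_ext_fun_add[OF vector_space_free_scale]
      vector_space.linear_ext_fun_scale[OF vector_space_free_scale])+

lemma delta_coassoc:
  "linear_ext free_scale (\<lambda>(j, k). linear_ext free_scale (\<lambda>(a, b). pure_tensor (a, b, k)) (delta j)) (delta x) =
   linear_ext free_scale (\<lambda>(j, k). linear_ext free_scale (\<lambda>(b, c). pure_tensor (j, b, c)) (delta k)) (delta x)"
proof -
  interpret F: vector_space "free_scale :: 'k \<Rightarrow> ('a \<times> 'a \<times> 'a \<Rightarrow>\<^sub>0 'k) \<Rightarrow> _"
    by (rule vector_space_free_scale)
  note fs = vector_space_free_scale
  have bil12: "bil free_scale (\<lambda>x y. ctriple x y z)" and bil23: "bil free_scale (ctriple z)" for z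
    unfolding bilinear_map_def by (simp_all add: linear_ctriple)
  define L where "L x y = linear_ext free_scale (\<lambda>(a, b). ctriple a b y) (delta x)" for x y
  define R where "R x y = linear_ext free_scale (\<lambda>(b, c). ctriple x b c) (delta y)" for x y
  note lin = linear_ctriple[unfolded Vector_Spaces.linear_iff]
  have bilL: "bil free_scale L"
    unfolding L_def
    by (rule bilI[OF fs]) (auto simp: delta.add delta.scale lin F.linear_ext_fun_add[symmetric]
      F.linear_ext_fun_scale[symmetric] case_prod_unfold)
  have bilR: "bil free_scale R"
    unfolding R_def
    by (rule bilI[OF fs]) (auto simp: delta.add delta.scale lin F.linear_ext_fun_add[symmetric]
      F.linear_ext_fun_scale[symmetric] case_prod_unfold)
  have "L j k = linear_ext free_scale (\<lambda>(a, b). pure_tensor (a, b, k)) (delta j)" if "k \<in> BB" for j k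
    unfolding L_def using that subsetD[OF keys_delta[of j]]
    by (intro linear_ext_cong) (auto simp: ctriple_def coord_basis)
  then have "linear_ext free_scale (\<lambda>(j, k). linear_ext free_scale (\<lambda>(a, b). pure_tensor (a, b, k)) (delta j)) (delta x) =
      linear_ext free_scale (\<lambda>(j, k). L j k) (delta x)"
    using subsetD[OF keys_delta[of x]] by (intro linear_ext_cong) auto
  also have "\<dots> = comult_sum free_scale L x" by (rule comult_sum_delta[OF bilL fs, symmetric])
  also have "\<dots> = comult_sum free_scale (\<lambda>x y. comult_sum free_scale (\<lambda>a b. ctriple a b y) x) x"
    by (simp add: L_def[abs_def] comult_sum_delta[OF bil12 fs])
  also have "\<dots> = comult_sum free_scale (\<lambda>x y. comult_sum free_scale (\<lambda>b c. ctriple x b c) y) x"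
    using tensor3_eq_trilinear_map[OF coassoc[of x] fs, of ctriple, OF linear_ctriple]
    by (simp add: comult_sum_def F.linear_ext_bind case_prod_unfold)
  also have "\<dots> = comult_sum free_scale R x"
    by (simp add: R_def[abs_def] comult_sum_delta[OF bil23 fs])
  also have "\<dots> = linear_ext free_scale (\<lambda>(j, k). R j k) (delta x)" by (rule comult_sum_delta[OF bilR fs])
  also have "\<dots> = linear_ext free_scale (\<lambda>(j, k). linear_ext free_scale (\<lambda>(b, c). pure_tensor (j, b, c)) (delta k)) (delta x)"
  proof -
    have "R j k = linear_ext free_scale (\<lambda>(b, c). pure_tensor (j, b, c)) (delta k)" if "j \<in> BB" for j k
      unfolding R_def using that subsetD[OF keys_delta[of k]]
      by (intro linear_ext_cong) (auto simp: ctriple_def coord_basis coord_B)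
    then show ?thesis
      using subsetD[OF keys_delta[of x]] by (intro linear_ext_cong) auto
  qed
  finally show ?thesis .
qed

lemma delta_counit_left: "linear_ext free_scale (\<lambda>(j, k). free_scale (counit H j) (pure_tensor k)) (delta x) = coord x"
proof -
  have bil: "bil free_scale (\<lambda>x y. free_scale (counit H x) (coord y))"
    by (rule bilI[OF vector_space_free_scale]) (auto simp: counit.add counit.scale coord.add coord.scale
      coord.vs2.scale_left_distrib coord.vs2.scale_right_distrib mult.commute)
  have "linear_ext free_scale (\<lambda>(j, k). free_scale (counit H j) (pure_tensor k)) (delta x) =
      linear_ext free_scale (\<lambda>(j, k). free_scale (counit H j) (coord k)) (delta x)"
    using subsetD[OF keys_delta[of x]] by (intro linear_ext_cong) (auto simp: coord_basis)
  also have "\<dots> = comult_sum free_scale (\<lambda>x y. free_scale (counit H x) (coord y)) x"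
    by (rule comult_sum_delta[OF bil vector_space_free_scale, symmetric])
  also have "\<dots> = coord (linear_ext (scale H) (\<lambda>(x, y). scale H (counit H x) y) (comult H x))"
    by (simp add: comult_sum_def linear_linear_ext_apply[OF linear_coord] case_prod_unfold coord.scale)
  finally show ?thesis by (simp add: counit_left)
qed

lemma delta_counit_right: "linear_ext free_scale (\<lambda>(j, k). free_scale (counit H k) (pure_tensor j)) (delta x) = coord x"
proof -
  have bil: "bil free_scale (\<lambda>x y. free_scale (counit H y) (coord x))"
    by (rule bilI[OF vector_space_free_scale]) (auto simp: counit.add counit.scale coord.add coord.scale
      coord.vs2.scale_left_distrib coord.vs2.scale_right_distrib mult.commute)
  have "linear_ext free_scale (\<lambda>(j, k). free_scale (counit H k) (pure_tensor j)) (delta x) =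
      linear_ext free_scale (\<lambda>(j, k). free_scale (counit H k) (coord j)) (delta x)"
    using subsetD[OF keys_delta[of x]] by (intro linear_ext_cong) (auto simp: coord_basis)
  also have "\<dots> = comult_sum free_scale (\<lambda>x y. free_scale (counit H y) (coord x)) x"
    by (rule comult_sum_delta[OF bil vector_space_free_scale, symmetric])
  also have "\<dots> = coord (linear_ext (scale H) (\<lambda>(x, y). scale H (counit H y) x) (comult H x))"
    by (simp add: comult_sum_def linear_linear_ext_apply[OF linear_coord] case_prod_unfold coord.scale)
  finally show ?thesis by (simp add: counit_right)
qed

lemma delta_cocommutative:
  "linear_ext free_scale (\<lambda>(j, k). free_scale (\<phi> (bdeg j) (bdeg k)) (pure_tensor (k, j))) (delta x) = delta x"
proof -
  note fs = vector_space_free_scale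
  have bil: "bil free_scale (\<lambda>x y. cpair y x)"
    using bil_cpair by (simp add: bilinear_map_def)
  have "linear_ext free_scale (\<lambda>(j, k). free_scale (\<phi> (bdeg j) (bdeg k)) (pure_tensor (k, j))) (delta x) =
      linear_ext free_scale (\<lambda>(j, k). color_twist \<phi> H free_scale (\<lambda>x y. cpair y x) j k) (delta x)"
    using subsetD[OF keys_delta[of x]]
    by (intro linear_ext_cong) (auto simp: color_twist_homog[OF bil fs bdeg_homog bdeg_homog] cpair_basis)
  also have "\<dots> = comult_sum free_scale (color_twist \<phi> H free_scale (\<lambda>x y. cpair y x)) x"
    by (rule comult_sum_delta[OF bil_color_twist[OF bil fs] fs, symmetric])
  also have "\<dots> = linear_ext free_scale (\<lambda>(x, y). cpair x y) (braiding \<phi> H (comult H x))"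
    by (simp add: comult_sum_def braiding_def vector_space.linear_ext_bind[OF fs] case_prod_unfold
        color_twist_map[OF vector_space.linear_linear_ext[OF fs]] vector_space.linear_ext_single[OF fs])
  also have "\<dots> = delta x"
    by (rule delta_tensor_eq[OF cocommutative, symmetric])
  finally show ?thesis .
qed

text \<open>Indices outside \<open>J\<close> are made grouplike of degree \<open>0\<close> and are sent to \<open>1\<close> by \<open>basis_point\<close>.
  In this way the whole type serves as the index type, and the coalgebra laws hold without side
  conditions.\<close>

definition basis_coalg :: "'a set \<Rightarrow> ('g, 'k, 'a) color_coalg" where
  "basis_coalg J = \<lparr>cdeg = (\<lambda>i. if i \<in> J then bdeg i else 0),
     cdelta = (\<lambda>i. if i \<in> J then delta i else pure_tensor (i, i)),
     ceps = (\<lambda>i. if i \<in> J then counit H i else 1)\<rparr>"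

definition basis_point :: "'a set \<Rightarrow> 'a \<Rightarrow> 'a" where
  "basis_point J i = (if i \<in> J then i else 1)"

context
  fixes J assumes J: "J \<subseteq> BB"
    and keys_J: "\<And>i. i \<in> J \<Longrightarrow> Poly_Mapping.keys (delta i) \<subseteq> J \<times> J"
begin

lemma basis_coalg_simps [simp]:
  "cdeg (basis_coalg J) i = (if i \<in> J then bdeg i else 0)"
  "cdelta (basis_coalg J) i = (if i \<in> J then delta i else pure_tensor (i, i))"
  "ceps (basis_coalg J) i = (if i \<in> J then counit H i else 1)"
  by (simp_all add: basis_coalg_def)

lemma sweedler_basis_coalg:
  assumes "vector_space s"
  shows "sweedler s (basis_coalg J) F i = (if i \<in> J then linear_ext s (\<lambda>(j, k). F j k) (delta i) else F i i)"
proof -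
  interpret s: vector_space s by fact
  show ?thesis by (simp add: sweedler_def)
qed

lemma color_coalgebra_basis_coalg: "color_coalgebra \<phi> (basis_coalg J)"
proof unfold_locales
  note fs = vector_space_free_scale
  note sw = sweedler_basis_coalg[OF fs]
  have JJ: "j \<in> J" "k \<in> J" if "(j, k) \<in> Poly_Mapping.keys (delta i)" "i \<in> J" for i j k
    using keys_J[OF that(2)] that(1) by auto
  fix i
  show "cdeg (basis_coalg J) j + cdeg (basis_coalg J) k = cdeg (basis_coalg J) i"
    if jk: "(j, k) \<in> Poly_Mapping.keys (cdelta (basis_coalg J) i)" for j k
  proof (cases "i \<in> J")
    case True
    then have "(j, k) \<in> Poly_Mapping.keys (delta i)" using jk by simp
    moreover have "i \<in> homog H (bdeg i)" using True J by (intro bdeg_homog) auto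
    ultimately have "bdeg j + bdeg k = bdeg i" by (intro keys_delta_deg)
    with JJ[OF \<open>(j, k) \<in> Poly_Mapping.keys (delta i)\<close> True] True show ?thesis by simp
  qed (use jk in simp)
  show "cdeg (basis_coalg J) i = 0" if "ceps (basis_coalg J) i \<noteq> 0"
  proof (cases "i \<in> J")
    case True
    then have "i \<in> homog H (bdeg i)" using J by (intro bdeg_homog) auto
    from counit_homog[OF this] that True show ?thesis by auto
  qed simp
  show "sweedler free_scale (basis_coalg J) (\<lambda>j k. sweedler free_scale (basis_coalg J) (\<lambda>a b. pure_tensor (a, b, k)) j) i =
    sweedler free_scale (basis_coalg J) (\<lambda>j k. sweedler free_scale (basis_coalg J) (\<lambda>b c. pure_tensor (j, b, c)) k) i"
  proof (cases "i \<in> J")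
    case True
    have "linear_ext free_scale (\<lambda>(j, k). sweedler free_scale (basis_coalg J) (\<lambda>a b. pure_tensor (a, b, k)) j) (delta i) =
      linear_ext free_scale (\<lambda>(j, k). linear_ext free_scale (\<lambda>(a, b). pure_tensor (a, b, k)) (delta j)) (delta i)"
      using JJ[OF _ True] by (intro linear_ext_cong) (auto simp: sw)
    moreover have "linear_ext free_scale (\<lambda>(j, k). sweedler free_scale (basis_coalg J) (\<lambda>b c. pure_tensor (j, b, c)) k) (delta i) =
      linear_ext free_scale (\<lambda>(j, k). linear_ext free_scale (\<lambda>(b, c). pure_tensor (j, b, c)) (delta k)) (delta i)"
      using JJ[OF _ True] by (intro linear_ext_cong) (auto simp: sw)
    ultimately show ?thesis using True
      by (simp add: sw[of _ i] delta_coassoc)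
  qed (simp add: sw)
  have coord_i: "coord i = pure_tensor i" if "i \<in> J"
    using that J by (intro coord_basis) auto
  show "sweedler free_scale (basis_coalg J) (\<lambda>j k. free_scale (ceps (basis_coalg J) j) (pure_tensor k)) i = pure_tensor i"
  proof (cases "i \<in> J")
    case True
    have "linear_ext free_scale (\<lambda>(j, k). free_scale (ceps (basis_coalg J) j) (pure_tensor k)) (delta i) =
      linear_ext free_scale (\<lambda>(j, k). free_scale (counit H j) (pure_tensor k)) (delta i)"
      using JJ[OF _ True] by (intro linear_ext_cong) auto
    then show ?thesis using True
      by (simp only: sw delta_counit_left coord_i if_True)
  qed (simp add: sw free_scale_one)
  show "sweedler free_scale (basis_coalg J) (\<lambda>j k. free_scale (ceps (basis_coalg J) k) (pure_tensor j)) i = pure_tensor i"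
  proof (cases "i \<in> J")
    case True
    have "linear_ext free_scale (\<lambda>(j, k). free_scale (ceps (basis_coalg J) k) (pure_tensor j)) (delta i) =
      linear_ext free_scale (\<lambda>(j, k). free_scale (counit H k) (pure_tensor j)) (delta i)"
      using JJ[OF _ True] by (intro linear_ext_cong) auto
    then show ?thesis using True
      by (simp only: sw delta_counit_right coord_i if_True)
  qed (simp add: sw free_scale_one)
  show "sweedler free_scale (basis_coalg J) (\<lambda>j k. free_scale (\<phi> (cdeg (basis_coalg J) j) (cdeg (basis_coalg J) k))
      (pure_tensor (k, j))) i = cdelta (basis_coalg J) i"
  proof (cases "i \<in> J")
    case True
    have "linear_ext free_scale (\<lambda>(j, k). free_scale (\<phi> (cdeg (basis_coalg J) j) (cdeg (basis_coalg J) k))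
        (pure_tensor (k, j))) (delta i) =
      linear_ext free_scale (\<lambda>(j, k). free_scale (\<phi> (bdeg j) (bdeg k)) (pure_tensor (k, j))) (delta i)"
      using JJ[OF _ True] by (intro linear_ext_cong) auto
    then show ?thesis using True
      by (simp only: sw delta_cocommutative if_True basis_coalg_simps(2))
  qed (simp add: sw free_scale_one)
qed

lemma point_basis_point: "point (basis_coalg J) (basis_point J)"
proof (rule pointI)
  fix i
  show "basis_point J i \<in> homog H (cdeg (basis_coalg J) i)"
    using J bdeg_homog[of i] homog_one by (auto simp: basis_point_def)
  show "counit H (basis_point J i) = ceps (basis_coalg J) i"
    by (simp add: basis_point_def counit_one)
  fix b :: "'a \<Rightarrow> 'a \<Rightarrow> 'k" assume b: "bil (*) b"
  show "comult_sum (*) b (basis_point J i) =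
      sweedler (*) (basis_coalg J) (\<lambda>j k. b (basis_point J j) (basis_point J k)) i"
  proof (cases "i \<in> J")
    case True
    have "linear_ext (*) (\<lambda>(j, k). b (basis_point J j) (basis_point J k)) (delta i) =
        linear_ext (*) (\<lambda>(j, k). b j k) (delta i)"
      using keys_J[OF True] by (intro linear_ext_cong) (auto simp: basis_point_def)
    with True show ?thesis
      by (simp only: sweedler_basis_coalg[OF vector_space_times] if_True basis_point_def[of J i]
          comult_sum_delta[OF b vector_space_times])
  next
    case False
    then show ?thesis
      by (simp add: sweedler_basis_coalg[OF vector_space_times] basis_point_def
          comult_sum_one[OF b vector_space_times])
  qed
qed

end

end

context cocommutative_color_hopf
begin

text \<open>Subcoalgebras are required to contain \<open>1\<close>, since the values of \<open>basis_point\<close> include it.\<close>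

definition subcoalgebra :: "'a set \<Rightarrow> bool" where
  "subcoalgebra X \<longleftrightarrow> V.subspace X \<and> (\<forall>x\<in>X. \<forall>g. homog_part H x g \<in> X) \<and> 1 \<in> X \<and>
     (\<forall>x\<in>X. \<exists>t. comult_eq x t \<and> Poly_Mapping.keys t \<subseteq> X \<times> X)"

text \<open>A linear relation splits into its homogeneous components.\<close>

lemma independent_Union_homog:
  assumes B: "\<And>g. B g \<subseteq> homog H g" and ind: "\<And>g. V.independent (B g)"
  shows "V.independent (\<Union>g. B g)"
  unfolding V.independent_explicit_module
proof (intro allI impI)
  fix T u v assume T: "finite T" "T \<subseteq> (\<Union>g. B g)" "(\<Sum>v\<in>T. scale H (u v) v) = 0" "v \<in> T"
  obtain g where g: "v \<in> B g" using T by auto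
  interpret P: Vector_Spaces.linear "scale H" "scale H" "\<lambda>x. homog_part H x g"
    by (rule linear_mapI[OF vector_space vector_space]) (simp_all add: homog_part_add homog_part_scale)
  have part: "homog_part H w g = (if w \<in> B g then w else 0)" if wT: "w \<in> T" for w
  proof (cases "w \<in> B g")
    case True then show ?thesis using B[of g] homog_part_of_homog[of w g g] by auto
  next
    case False
    obtain h where h: "w \<in> B h" using wT T by auto
    then have "h \<noteq> g" using False by auto
    then show ?thesis using False homog_part_of_homog[of w h g] h B[of h] by auto
  qed
  have "(\<Sum>v\<in>T \<inter> B g. scale H (u v) v) = (\<Sum>v\<in>T. scale H (u v) (homog_part H v g))"
    using T(1) by (intro sum.mono_neutral_cong_left) (auto simp: part)
  also have "\<dots> = homog_part H (\<Sum>v\<in>T. scale H (u v) v) g"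
    by (simp add: P.sum P.scale)
  finally have "(\<Sum>v\<in>T \<inter> B g. scale H (u v) v) = 0" using T(3) by simp
  then show "u v = 0"
    using ind[of g, unfolded V.independent_explicit_module, rule_format, of "T \<inter> B g" u v] T g by auto
qed

text \<open>In each degree a basis of the component of \<open>X\<close> is extended to a basis of the whole
  component.\<close>

lemma homog_basis_adapted:
  assumes X: "V.subspace X" "\<And>x g. x \<in> X \<Longrightarrow> homog_part H x g \<in> X"
  obtains B J where "homog_basis \<phi> H B" "J \<subseteq> (\<Union>g. B g)" "V.span J = X"
proof -
  have "\<forall>g. \<exists>J. J \<subseteq> X \<inter> homog H g \<and> V.independent J \<and> X \<inter> homog H g \<subseteq> V.span J"
    by (metis V.maximal_independent_subset)
  from choice[OF this] obtain J where J: "\<And>g. J g \<subseteq> X \<inter> homog H g" "\<And>g. V.independent (J g)"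
    "\<And>g. X \<inter> homog H g \<subseteq> V.span (J g)" by blast
  have "\<forall>g. \<exists>B. J g \<subseteq> B \<and> B \<subseteq> homog H g \<and> V.independent B \<and> homog H g \<subseteq> V.span B"
  proof
    fix g
    have "J g \<subseteq> homog H g" using J(1)[of g] by blast
    from V.maximal_independent_subset_extend[OF this J(2)]
    show "\<exists>B. J g \<subseteq> B \<and> B \<subseteq> homog H g \<and> V.independent B \<and> homog H g \<subseteq> V.span B" by metis
  qed
  from choice[OF this] obtain B where B: "\<And>g. J g \<subseteq> B g" "\<And>g. B g \<subseteq> homog H g" "\<And>g. V.independent (B g)"
    "\<And>g. homog H g \<subseteq> V.span (B g)" by blast
  have "homog_basis \<phi> H B"
    by unfold_locales (simp_all add: B independent_Union_homog)
  moreover have "V.span (\<Union>g. J g) = X"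
  proof
    show "V.span (\<Union>g. J g) \<subseteq> X" using J(1) X(1) by (intro V.span_minimal) auto
    show "X \<subseteq> V.span (\<Union>g. J g)"
    proof
      fix x assume x: "x \<in> X"
      have "homog_part H x g \<in> V.span (\<Union>g. J g)" for g
        using J(3)[of g] X(2)[OF x, of g] homog_part_homog[of x g] V.span_mono[of "J g" "\<Union>g. J g"] by blast
      then have "(\<Sum>g | homog_part H x g \<noteq> 0. homog_part H x g) \<in> V.span (\<Union>g. J g)"
        by (intro V.span_sum) auto
      then show "x \<in> V.span (\<Union>g. J g)" by (simp add: sum_homog_part finite_homog_part)
    qed
  qed
  moreover have "(\<Union>g. J g) \<subseteq> (\<Union>g. B g)" using B(1) by blast
  ultimately show ?thesis using that by blast
qed

theorem subcoalgebra_point: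
  assumes X: "subcoalgebra X"
  obtains C :: "('g, 'k, 'a) color_coalg" and f
  where "color_coalgebra \<phi> C" "point C f" "\<And>i. f i \<in> X" "X = V.span (range f)"
proof -
  obtain B J where B: "homog_basis \<phi> H B" and J: "J \<subseteq> (\<Union>g. B g)" "V.span J = X"
    using X homog_basis_adapted[of X] unfolding subcoalgebra_def by metis
  interpret homog_basis \<phi> H B by (rule B)
  have keys: "Poly_Mapping.keys (delta i) \<subseteq> J \<times> J" if "i \<in> J" for i
  proof -
    have "i \<in> X" using that J V.span_base by auto
    then obtain t where "tensor_eq (scale H) (scale H) (comult H i) t" "Poly_Mapping.keys t \<subseteq> V.span J \<times> V.span J"
      using X J unfolding subcoalgebra_def by metis
    then show ?thesis by (rule keys_delta_subcoalgebra[OF J(1)])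
  qed
  have in_X: "basis_point J i \<in> X" for i
    using X J V.span_base by (auto simp: basis_point_def subcoalgebra_def)
  have "X = V.span (range (basis_point J))"
  proof
    have "J \<subseteq> range (basis_point J)" by (auto simp: basis_point_def)
    then show "X \<subseteq> V.span (range (basis_point J))" using J(2) V.span_mono by metis
    show "V.span (range (basis_point J)) \<subseteq> X"
      using in_X X by (intro V.span_minimal) (auto simp: subcoalgebra_def)
  qed
  then show ?thesis
    using that color_coalgebra_basis_coalg[OF J(1) keys] point_basis_point[OF J(1) keys] in_X by metis
qed

lemma subcoalgebra_span:
  assumes "1 \<in> V.span U" "\<And>u g. u \<in> U \<Longrightarrow> homog_part H u g \<in> V.span U"
    and "\<And>u. u \<in> U \<Longrightarrow> \<exists>t. comult_eq u t \<and>
      Poly_Mapping.keys t \<subseteq> V.span U \<times> V.span U"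
  shows "subcoalgebra (V.span U)"
  unfolding subcoalgebra_def
proof (intro conjI ballI allI)
  show "V.subspace (V.span U)" by (rule V.subspace_span)
  show "1 \<in> V.span U" by fact
  fix x assume x: "x \<in> V.span U"
  show "homog_part H x g \<in> V.span U" for g
    using x
  proof (induct rule: V.span_induct_alt)
    case base then show ?case by (simp add: V.span_zero)
  next
    case (step c u y)
    then show ?case
      by (simp add: homog_part_add homog_part_scale V.span_add V.span_scale assms(2))
  qed
  show "\<exists>t. comult_eq x t \<and> Poly_Mapping.keys t \<subseteq> V.span U \<times> V.span U"
    using x
  proof (induct rule: V.span_induct_alt)
    case base
    interpret F: vector_space "free_scale :: 'k \<Rightarrow> ('a \<times> 'a \<Rightarrow>\<^sub>0 'k) \<Rightarrow> _" by (rule vector_space_free_scale)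
    have "tensor_eq (scale H) (scale H) (comult H 0) (free_scale 0 (comult H 0))"
      using comult_scale[of 0 0] by simp
    then show ?case by (intro exI[of _ 0]) simp
  next
    case (step c u y)
    then obtain t t' where t: "comult_eq u t" "Poly_Mapping.keys t \<subseteq> V.span U \<times> V.span U"
      "tensor_eq (scale H) (scale H) (comult H y) t'" "Poly_Mapping.keys t' \<subseteq> V.span U \<times> V.span U"
      using assms(3) by metis
    have "tensor_eq (scale H) (scale H) (comult H (scale H c u + y)) (free_scale c t + t')"
      by (rule tensor_eq_trans[OF comult_add tensor_eq_add[OF tensor_eq_trans[OF comult_scale tensor_eq_scale[OF t(1)]] t(3)]])
    moreover have "Poly_Mapping.keys (free_scale c t + t') \<subseteq> V.span U \<times> V.span U"
      using Poly_Mapping.keys_add[of "free_scale c t" t'] keys_free_scale[of c t] t(2,4) by blast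
    ultimately show ?case by blast
  qed
qed

text \<open>Conversely to \<open>subcoalgebra_point\<close>, values of points on arbitrary index types span
  subcoalgebras. By the two lemmas together, the values of a point and \<open>1\<close> have the same span as
  the values of a point on the index type \<open>'a\<close>.\<close>

lemma subcoalgebra_span_point:
  assumes f: "point C f"
  shows "subcoalgebra (V.span (insert 1 (range f)))"
proof (rule subcoalgebra_span)
  let ?U = "V.span (insert 1 (range f))"
  have in_U: "1 \<in> ?U" "f i \<in> ?U" for i by (auto intro: V.span_base)
  show "1 \<in> ?U" by (rule in_U)
  fix u assume u: "u \<in> insert 1 (range f)"
  have "\<exists>h. u \<in> homog H h" using u point_homog[OF f] homog_one by auto
  then show "homog_part H u g \<in> ?U" for g
    using u in_U V.span_zero[of "insert 1 (range f)"] by (auto simp: homog_part_of_homog)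
  show "\<exists>t. comult_eq u t \<and> Poly_Mapping.keys t \<subseteq> ?U \<times> ?U"
  proof (cases "u = 1")
    case True
    then show ?thesis using comult_one in_U by (intro exI[of _ "pure_tensor (1, 1)"]) auto
  next
    case False
    then obtain i where i: "u = f i" using u by auto
    have "Poly_Mapping.keys (sweedler free_scale C (\<lambda>j k. pure_tensor (f j, f k)) i) \<subseteq> ?U \<times> ?U"
      unfolding sweedler_def using in_U by (intro keys_linear_ext_subset) (auto split: prod.splits)
    then show ?thesis using f i unfolding point_def by blast
  qed
qed

section \<open>Points with values in a color Hopf subalgebra\<close>

lemma bil_span:
  assumes b: "bil (scale H) b" and W: "V.subspace W" and fg: "\<And>i j. b (f i) (g j) \<in> W"
    and x: "x \<in> V.span (range f)" and y: "y \<in> V.span (range g)"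
  shows "b x y \<in> W"
proof -
  note bD = bilinear_mapD[OF b]
  have 1: "b (f i) y \<in> W" for i
    using y by (induct rule: V.span_induct_alt)
      (auto simp: bD fg intro!: V.subspace_0[OF W] V.subspace_add[OF W] V.subspace_scale[OF W])
  show ?thesis
    using x by (induct rule: V.span_induct_alt)
      (auto simp: bD 1 intro!: V.subspace_0[OF W] V.subspace_add[OF W] V.subspace_scale[OF W])
qed

lemma bil_comp_linear:
  "bil (scale H) b \<Longrightarrow> Vector_Spaces.linear (scale H) s h \<Longrightarrow> bil s (\<lambda>x y. h (b x y))"
  by (simp add: bilinear_map_def Vector_Spaces.linear_iff)

lemma linear_adjoint_action: "Vector_Spaces.linear (scale H) (scale H) (adj a)"
  and linear_commutator_element: "Vector_Spaces.linear (scale H) (scale H) (comm a)"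
  using bil_adjoint_action bil_commutator_element by (simp_all add: bilinear_map_def)

lemma subspace_preimage:
  assumes "Vector_Spaces.linear (scale H) (scale H) h" "V.subspace W"
  shows "V.subspace {x. h x \<in> W}"
proof -
  interpret h: Vector_Spaces.linear "scale H" "scale H" h by fact
  show ?thesis
    by (rule V.subspaceI) (auto simp: h.zero h.add h.scale V.subspace_0[OF assms(2)]
        V.subspace_add[OF assms(2)] V.subspace_scale[OF assms(2)])
qed

lemma subspace_preimage_all:
  assumes "\<And>a. Vector_Spaces.linear (scale H) (scale H) (h a)" "V.subspace W"
  shows "V.subspace {x. \<forall>a\<in>A. h a x \<in> W}"
proof -
  have "{x. \<forall>a\<in>A. h a x \<in> W} = (\<Inter>a\<in>A. {x. h a x \<in> W})" by auto
  then show ?thesis using subspace_preimage[OF assms] by (auto intro: V.subspace_Inter)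
qed

lemma graded_subalgebraD:
  assumes "graded_subalgebra H W"
  shows "V.subspace W" "1 \<in> W" "\<And>x y. x \<in> W \<Longrightarrow> y \<in> W \<Longrightarrow> x * y \<in> W"
    "\<And>x g. x \<in> W \<Longrightarrow> homog_part H x g \<in> W"
  using assms by (auto simp: graded_subalgebra_def)

lemma conv_in:
  assumes "graded_subalgebra H W" "\<And>i. f i \<in> W" "\<And>i. g i \<in> W"
  shows "conv C f g i \<in> W"
  unfolding conv_def
  by (rule V.sweedler_in_subspace) (simp_all add: graded_subalgebraD[OF assms(1)] assms(2,3))

lemma fst_point_in: "V.subspace W \<Longrightarrow> (\<And>i. f i \<in> W) \<Longrightarrow> fst_point D f x \<in> W"
  and snd_point_in: "V.subspace W \<Longrightarrow> (\<And>i. g i \<in> W) \<Longrightarrow> snd_point C g y \<in> W"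
  by (cases x, simp add: fst_point_def V.subspace_scale) (cases y, simp add: snd_point_def V.subspace_scale)

lemma pcomm_in:
  assumes "color_coalgebra \<phi> C" "point C f" "point C g" "V.subspace W"
    and "\<And>j k. comm (f j) (g k) \<in> W"
  shows "pcomm C f g i \<in> W"
  unfolding pcomm_eq_commutator_element[OF assms(1-3)]
  by (rule V.sweedler_in_subspace[OF assms(4)]) (rule assms(5))

lemma pconj_in:
  assumes "color_coalgebra \<phi> C" "point C f" "point C g" "V.subspace W"
    and "\<And>j k. adj (f j) (g k) \<in> W"
  shows "pconj C f g i \<in> W"
  unfolding pconj_eq_adjoint_action[OF assms(1-3)]
  by (rule V.sweedler_in_subspace[OF assms(4)]) (rule assms(5))

lemma color_hopf_subalgebra_iff:
  "color_hopf_subalgebra H X \<longleftrightarrow> graded_subalgebra H X \<and> subcoalgebra X \<and> (\<forall>x\<in>X. antipode H x \<in> X)"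
  by (auto simp: color_hopf_subalgebra_def graded_subalgebra_def subcoalgebra_def)

lemma normal_color_hopf_subalgebraD:
  assumes "normal_sub X"
  shows "graded_subalgebra H X" "subcoalgebra X" "V.subspace X" "\<And>x. x \<in> X \<Longrightarrow> antipode H x \<in> X"
    "\<And>a x. x \<in> X \<Longrightarrow> adj a x \<in> X"
  using assms by (auto simp: normal_color_hopf_subalgebra_def color_hopf_subalgebra_iff graded_subalgebra_def)

definition Pts_in :: "('g, 'k, 'i) color_coalg \<Rightarrow> 'a set \<Rightarrow> ('i \<Rightarrow> 'a) set" where
  "Pts_in C X = {f. point C f \<and> (\<forall>i. f i \<in> X)}"

lemma normal_Pts_in:
  assumes C: "color_coalgebra \<phi> C" and X: "normal_sub X"
  shows "Pts_in C X \<lhd> Pts C"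
proof -
  interpret G: Group.group "Pts C" by (rule group_Pts[OF C])
  note XD = normal_color_hopf_subalgebraD[OF X]
  have "subgroup (Pts_in C X) (Pts C)"
  proof (rule G.subgroupI)
    show "Pts_in C X \<noteq> {}"
      using point_conv_one[OF C] V.subspace_scale[OF XD(3) graded_subalgebraD(2)[OF XD(1)]]
      by (auto simp: Pts_in_def conv_one_def)
    show "inv\<^bsub>Pts C\<^esub> f \<in> Pts_in C X" if "f \<in> Pts_in C X" for f
      using that by (simp add: Pts_in_def inv_Pts[OF C] point_antipode[OF C] XD)
    show "f \<otimes>\<^bsub>Pts C\<^esub> g \<in> Pts_in C X" if "f \<in> Pts_in C X" "g \<in> Pts_in C X" for f g
      using that by (simp add: Pts_in_def point_conv[OF C] conv_in[OF XD(1)])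
  qed (auto simp: Pts_in_def)
  moreover have "x \<otimes>\<^bsub>Pts C\<^esub> h \<otimes>\<^bsub>Pts C\<^esub> inv\<^bsub>Pts C\<^esub> x \<in> Pts_in C X"
    if x: "x \<in> carrier (Pts C)" and h: "h \<in> Pts_in C X" for x h
  proof -
    have "point C x" "point C h" using x h by (auto simp: Pts_in_def)
    moreover have "pconj C x h i \<in> X" for i
      using calculation h by (intro pconj_in[OF C]) (auto simp: XD Pts_in_def)
    moreover have "point C (pconj C x h)" using calculation G.gconj_closed[of x h] by simp
    ultimately show ?thesis unfolding Pts_in_def G.gconj_def by simp
  qed
  ultimately show ?thesis by (simp add: G.normal_inv_iff)
qed

lemma Pts_inD: "f \<in> Pts_in C X \<Longrightarrow> point C f" "f \<in> Pts_in C X \<Longrightarrow> f i \<in> X"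
  by (simp_all add: Pts_in_def)

lemma Pts_in_carrier: "f \<in> Pts_in C X \<Longrightarrow> f \<in> carrier (Pts C)"
  by (simp add: Pts_in_def)

text \<open>A pair of points with values in \<open>X\<close> and \<open>Y\<close> that is generic: to show that a bilinear map
  sends all of \<open>X \<times> Y\<close> into a subspace, it suffices to convolve it with the pair. For the
  commutator map this convolution is the group commutator of the two points.\<close>

definition generic_pair :: "('g, 'k, 'a \<times> 'a) color_coalg \<Rightarrow> ('a \<times> 'a \<Rightarrow> 'a) \<Rightarrow> ('a \<times> 'a \<Rightarrow> 'a) \<Rightarrow>
    'a set \<Rightarrow> 'a set \<Rightarrow> bool" where
  "generic_pair T f g X Y \<longleftrightarrow> color_coalgebra \<phi> T \<and> f \<in> Pts_in T X \<and> g \<in> Pts_in T Y \<and>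
     (\<forall>b W x y. bil (scale H) b \<longrightarrow> V.subspace W \<longrightarrow>
       (\<forall>t. ssum T (\<lambda>j k. b (f j) (g k)) t \<in> W) \<longrightarrow> x \<in> X \<longrightarrow> y \<in> Y \<longrightarrow> b x y \<in> W)"

lemma generic_pairD:
  assumes "generic_pair T f g X Y"
  shows "color_coalgebra \<phi> T" "f \<in> Pts_in T X" "g \<in> Pts_in T Y"
    and "\<lbrakk>bil (scale H) b; V.subspace W; \<And>t. ssum T (\<lambda>j k. b (f j) (g k)) t \<in> W;
      x \<in> X; y \<in> Y\<rbrakk> \<Longrightarrow> b x y \<in> W"
  using assms by (auto simp: generic_pair_def)

text \<open>The analogue for two nested bilinear maps, such as a commutator of a commutator or of a
  product.\<close>

definition generic_triple :: "('g, 'k, 'a \<times> 'a \<times> 'a) color_coalg \<Rightarrow> ('a \<times> 'a \<times> 'a \<Rightarrow> 'a) \<Rightarrow>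
    ('a \<times> 'a \<times> 'a \<Rightarrow> 'a) \<Rightarrow> ('a \<times> 'a \<times> 'a \<Rightarrow> 'a) \<Rightarrow> 'a set \<Rightarrow> 'a set \<Rightarrow> 'a set \<Rightarrow> bool" where
  "generic_triple T e f g A X Y \<longleftrightarrow>
     color_coalgebra \<phi> T \<and> e \<in> Pts_in T A \<and> f \<in> Pts_in T X \<and> g \<in> Pts_in T Y \<and>
     (\<forall>b b' W a x y. bil (scale H) b \<longrightarrow> bil (scale H) b' \<longrightarrow> V.subspace W \<longrightarrow>
       (\<forall>t. ssum T (\<lambda>i j. b' (e i) (ssum T (\<lambda>p q. b (f p) (g q)) j)) t \<in> W) \<longrightarrow>
       a \<in> A \<longrightarrow> x \<in> X \<longrightarrow> y \<in> Y \<longrightarrow> b' a (b x y) \<in> W)"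

lemma generic_tripleD:
  assumes "generic_triple T e f g A X Y"
  shows "color_coalgebra \<phi> T" "e \<in> Pts_in T A" "f \<in> Pts_in T X" "g \<in> Pts_in T Y"
    and "\<lbrakk>bil (scale H) b; bil (scale H) b'; V.subspace W;
      \<And>t. ssum T (\<lambda>i j. b' (e i) (ssum T (\<lambda>p q. b (f p) (g q)) j)) t \<in> W;
      a \<in> A; x \<in> X; y \<in> Y\<rbrakk> \<Longrightarrow> b' a (b x y) \<in> W"
  using assms by (auto simp: generic_triple_def)

text \<open>The projections of the tensor product of coalgebras that parametrize \<open>X\<close> and \<open>Y\<close>.\<close>

lemma subcoalgebra_pair:
  assumes X: "subcoalgebra X" and Y: "subcoalgebra Y"
  obtains T f g where "generic_pair T f g X Y"
proof -
  obtain C :: "('g, 'k, 'a) color_coalg" and f where C: "color_coalgebra \<phi> C" and f: "point C f"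
    "\<And>i. f i \<in> X" "X = V.span (range f)"
    using subcoalgebra_point[OF X] by metis
  obtain D :: "('g, 'k, 'a) color_coalg" and g where D: "color_coalgebra \<phi> D" and g: "point D g"
    "\<And>i. g i \<in> Y" "Y = V.span (range g)"
    using subcoalgebra_point[OF Y] by metis
  have sub: "V.subspace X" "V.subspace Y" using X Y by (simp_all add: subcoalgebra_def)
  have "generic_pair (tensor_coalg C D) (fst_point D f) (snd_point C g) X Y"
    unfolding generic_pair_def
  proof (intro conjI allI impI)
    show "color_coalgebra \<phi> (tensor_coalg C D)" by (rule color_coalgebra_tensor_coalg[OF C D])
    show "fst_point D f \<in> Pts_in (tensor_coalg C D) X"
      by (simp add: Pts_in_def point_fst_point[OF C D f(1)] fst_point_in[OF sub(1)] f(2))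
    show "snd_point C g \<in> Pts_in (tensor_coalg C D) Y"
      by (simp add: Pts_in_def point_snd_point[OF C D g(1)] snd_point_in[OF sub(2)] g(2))
    fix b W x y assume b: "bil (scale H) b" and W: "V.subspace W" and xy: "x \<in> X" "y \<in> Y"
      and sw: "\<forall>t. ssum (tensor_coalg C D) (\<lambda>j k. b (fst_point D f j) (snd_point C g k)) t \<in> W"
    have "b (f i) (g j) \<in> W" for i j
      using sw[rule_format, of "(i, j)"] by (simp add: sweedler_fst_snd_point[OF C D b vector_space])
    then show "b x y \<in> W"
      by (rule bil_span[OF b W]) (use xy f(3) g(3) in simp_all)
  qed
  then show ?thesis by (rule that)
qed

lemma subcoalgebra_triple:
  assumes A: "subcoalgebra A" and X: "subcoalgebra X" and Y: "subcoalgebra Y"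
  obtains T e f g where "generic_triple T e f g A X Y"
proof -
  obtain C :: "('g, 'k, 'a) color_coalg" and e where C: "color_coalgebra \<phi> C" and e: "point C e"
    "\<And>i. e i \<in> A" "A = V.span (range e)"
    using subcoalgebra_point[OF A] by metis
  obtain D f g where gp: "generic_pair D f g X Y"
    using subcoalgebra_pair[OF X Y] by blast
  note D = generic_pairD(1)[OF gp] and f = generic_pairD(2)[OF gp] and g = generic_pairD(3)[OF gp]
    and pair = generic_pairD(4)[OF gp]
  have sub: "V.subspace A" "V.subspace X" "V.subspace Y" using A X Y by (simp_all add: subcoalgebra_def)
  let ?T = "tensor_coalg C D"
  have "generic_triple ?T (fst_point D e) (snd_point C f) (snd_point C g) A X Y"
    unfolding generic_triple_def
  proof (intro conjI allI impI)
    show "color_coalgebra \<phi> ?T" by (rule color_coalgebra_tensor_coalg[OF C D])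
    show "fst_point D e \<in> Pts_in ?T A"
      by (simp add: Pts_in_def point_fst_point[OF C D e(1)] fst_point_in[OF sub(1)] e(2))
    show "snd_point C f \<in> Pts_in ?T X" "snd_point C g \<in> Pts_in ?T Y"
      using f g by (simp_all add: Pts_in_def point_snd_point[OF C D] snd_point_in[OF sub(2)] snd_point_in[OF sub(3)]
        del: split_paired_All)
    fix b b' W a x y assume b: "bil (scale H) b" and b': "bil (scale H) b'" and W: "V.subspace W"
      and axy: "a \<in> A" "x \<in> X" "y \<in> Y"
      and sw: "\<forall>t. ssum ?T (\<lambda>i j. b' (fst_point D e i)
        (ssum ?T (\<lambda>p q. b (snd_point C f p) (snd_point C g q)) j)) t \<in> W"
    define m where "m = ssum D (\<lambda>p q. b (f p) (g q))"
    have "ssum ?T (\<lambda>p q. b (snd_point C f p) (snd_point C g q)) = snd_point C m"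
      by (rule ext) (clarify, simp only: sweedler_snd_point[OF C D b vector_space], simp add: snd_point_def m_def)
    then have em: "b' (e i) (m j) \<in> W" for i j
      using sw[rule_format, of "(i, j)"] by (simp add: sweedler_fst_snd_point[OF C D b' vector_space])
    have "b x y \<in> V.span (range m)"
      by (rule pair[OF b V.subspace_span _ axy(2,3)]) (simp add: m_def V.span_base)
    then show "b' a (b x y) \<in> W"
      using axy(1) e(3) by (intro bil_span[OF b' W em]) simp_all
  qed
  then show ?thesis by (rule that)
qed

section \<open>The largest subcoalgebra of a subspace\<close>

definition core :: "'a set \<Rightarrow> 'a set" where
  "core P = \<Union>{D. subcoalgebra D \<and> D \<subseteq> P}"

lemma core_subset: "core P \<subseteq> P"
  by (auto simp: core_def)

lemma subset_core: "subcoalgebra D \<Longrightarrow> D \<subseteq> P \<Longrightarrow> D \<subseteq> core P"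
  by (auto simp: core_def)

lemma subcoalgebra_one: "subcoalgebra (V.span {1})"
proof (rule subcoalgebra_span)
  show "1 \<in> V.span {1}" by (simp add: V.span_base)
  show "homog_part H u g \<in> V.span {1}" if "u \<in> {1}" for u g
    using that by (simp add: homog_part_of_homog[OF homog_one] V.span_base V.span_zero)
  show "\<exists>t. comult_eq u t \<and>
      Poly_Mapping.keys t \<subseteq> V.span {1} \<times> V.span {1}" if "u \<in> {1}" for u
    using that comult_one by (intro exI[of _ "pure_tensor (1, 1)"]) (simp add: V.span_base)
qed

lemma subcoalgebra_sum:
  assumes "subcoalgebra D" "subcoalgebra D'"
  shows "subcoalgebra (V.span (D \<union> D'))"
proof (rule subcoalgebra_span)
  have base: "D \<union> D' \<subseteq> V.span (D \<union> D')" by (rule V.span_superset)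
  show "1 \<in> V.span (D \<union> D')" using assms(1) base by (auto simp: subcoalgebra_def)
  show "homog_part H u g \<in> V.span (D \<union> D')" if "u \<in> D \<union> D'" for u g
    using that assms base by (auto simp: subcoalgebra_def)
  fix u assume "u \<in> D \<union> D'"
  then obtain E where E: "subcoalgebra E" "u \<in> E" "E \<subseteq> V.span (D \<union> D')"
    using assms base by blast
  then obtain t where "comult_eq u t" "Poly_Mapping.keys t \<subseteq> E \<times> E"
    unfolding subcoalgebra_def by blast
  with E(3) show "\<exists>t. comult_eq u t \<and>
      Poly_Mapping.keys t \<subseteq> V.span (D \<union> D') \<times> V.span (D \<union> D')" by blast
qed

lemma subcoalgebra_core:
  assumes P: "V.subspace P" "1 \<in> P"
  shows "subcoalgebra (core P)"
  unfolding subcoalgebra_def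
proof (intro conjI ballI allI)
  have one: "V.span {1} \<subseteq> core P"
    using P by (intro subset_core subcoalgebra_one V.span_minimal) auto
  show 1: "1 \<in> core P" using one V.span_base by blast
  have add: "x + y \<in> core P" if xy: "x \<in> core P" "y \<in> core P" for x y
  proof -
    obtain D D' where D: "subcoalgebra D" "D \<subseteq> P" "x \<in> D" "subcoalgebra D'" "D' \<subseteq> P" "y \<in> D'"
      using xy by (auto simp: core_def)
    have "V.span (D \<union> D') \<subseteq> core P"
      using D P by (intro subset_core subcoalgebra_sum V.span_minimal) auto
    moreover have "x + y \<in> V.span (D \<union> D')"
      using D by (intro V.span_add) (auto intro: V.span_base)
    ultimately show ?thesis by blast
  qed
  show "V.subspace (core P)"
  proof (rule V.subspaceI)
    show "0 \<in> core P" using one V.span_zero by blast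
    fix c x assume "x \<in> core P"
    then obtain D where D: "subcoalgebra D" "D \<subseteq> P" "x \<in> D" by (auto simp: core_def)
    then have "scale H c x \<in> D" by (intro V.subspace_scale) (auto simp: subcoalgebra_def)
    then show "scale H c x \<in> core P" using subset_core[OF D(1,2)] by blast
  qed (rule add)
  fix x assume "x \<in> core P"
  then obtain D where D: "subcoalgebra D" "D \<subseteq> P" "x \<in> D" by (auto simp: core_def)
  have sub: "D \<subseteq> core P" by (rule subset_core[OF D(1,2)])
  show "homog_part H x g \<in> core P" for g using D sub by (auto simp: subcoalgebra_def)
  show "\<exists>t. comult_eq x t \<and> Poly_Mapping.keys t \<subseteq> core P \<times> core P"
  proof -
    obtain t where "comult_eq x t" "Poly_Mapping.keys t \<subseteq> D \<times> D"
      using D(1,3) unfolding subcoalgebra_def by blast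
    moreover have "D \<times> D \<subseteq> core P \<times> core P" using sub by blast
    ultimately show ?thesis by (meson order_trans)
  qed
qed

lemma point_in_core:
  assumes P: "V.subspace P" "1 \<in> P" and f: "point C f" "\<And>i. f i \<in> P"
  shows "f i \<in> core P"
proof -
  have "V.span (insert 1 (range f)) \<subseteq> core P"
    using P f by (intro subset_core subcoalgebra_span_point[OF f(1)] V.span_minimal) auto
  then show ?thesis using V.span_base[of "f i" "insert 1 (range f)"] by auto
qed

text \<open>The products of values of two points are the values of their convolution, which is again a
  point; the span of its values is a subcoalgebra of \<open>P\<close> and hence lies in the core.\<close>

lemma graded_subalgebra_core:
  assumes P: "V.subspace P" "1 \<in> P" and mult: "\<And>x y. x \<in> core P \<Longrightarrow> y \<in> core P \<Longrightarrow> x * y \<in> P"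
  shows "graded_subalgebra H (core P)"
proof -
  have core: "subcoalgebra (core P)" by (rule subcoalgebra_core[OF P])
  then have sub: "V.subspace (core P)" by (simp add: subcoalgebra_def)
  obtain T f g where gp: "generic_pair T f g (core P) (core P)"
    using subcoalgebra_pair[OF core core] by blast
  note T = generic_pairD(1)[OF gp] and f = generic_pairD(2)[OF gp] and g = generic_pairD(3)[OF gp]
    and pair = generic_pairD(4)[OF gp]
  have "conv T f g t \<in> core P" for t
  proof (rule point_in_core[OF P, of T "conv T f g"])
    show "point T (conv T f g)" by (rule point_conv[OF T Pts_inD(1)[OF f] Pts_inD(1)[OF g]])
    show "conv T f g t \<in> P" for t
      unfolding conv_def by (rule V.sweedler_in_subspace[OF P(1)]) (rule mult[OF Pts_inD(2)[OF f] Pts_inD(2)[OF g]])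
  qed
  then have "x * y \<in> core P" if "x \<in> core P" "y \<in> core P" for x y
    using that by (intro pair[OF mult_bil sub]) (simp_all add: conv_def)
  then show ?thesis using core by (auto simp: graded_subalgebra_def subcoalgebra_def)
qed

section \<open>Huq commutators\<close>

lemma commutator_in_huq: "x \<in> X \<Longrightarrow> y \<in> Y \<Longrightarrow> comm x y \<in> huq X Y"
  by (auto simp: huq_commutator_def)

lemma graded_subalgebra_huq: "graded_subalgebra H (huq X Y)"
  unfolding graded_subalgebra_def huq_commutator_def
  by (intro conjI V.subspace_Inter ballI allI InterI) (auto simp: graded_subalgebra_def)

lemma huq_subset:
  "graded_subalgebra H Z \<Longrightarrow> (\<And>x y. x \<in> X \<Longrightarrow> y \<in> Y \<Longrightarrow> comm x y \<in> Z) \<Longrightarrow>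
    huq X Y \<subseteq> Z"
  unfolding huq_commutator_def by (rule Inter_lower) auto

lemma huq_mono: "X \<subseteq> X' \<Longrightarrow> Y \<subseteq> Y' \<Longrightarrow> huq X Y \<subseteq> huq X' Y'"
  by (intro huq_subset graded_subalgebra_huq commutator_in_huq) auto

text \<open>The induction principle for Huq commutators. The commutator elements of \<open>X\<close> and \<open>Y\<close> are
  the values of a point and so span a subcoalgebra. In checking products one may therefore
  assume that the factors come from subcoalgebras on which \<open>P\<close> holds.\<close>

lemma huq_subset_core:
  assumes X: "subcoalgebra X" and Y: "subcoalgebra Y" and P: "V.subspace P" "1 \<in> P"
    and mult: "\<And>x y. x \<in> core P \<Longrightarrow> y \<in> core P \<Longrightarrow> x * y \<in> P"
    and gen: "\<And>x y. x \<in> X \<Longrightarrow> y \<in> Y \<Longrightarrow> comm x y \<in> P"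
  shows "huq X Y \<subseteq> core P"
proof (rule huq_subset)
  show core: "graded_subalgebra H (core P)" by (rule graded_subalgebra_core[OF P mult])
  fix x y assume xy: "x \<in> X" "y \<in> Y"
  obtain T f g where gp: "generic_pair T f g X Y"
    using subcoalgebra_pair[OF X Y] by blast
  note T = generic_pairD(1)[OF gp] and f = generic_pairD(2)[OF gp] and g = generic_pairD(3)[OF gp]
    and pair = generic_pairD(4)[OF gp]
  interpret G: Group.group "Pts T" by (rule group_Pts[OF T])
  note fg = Pts_inD(1)[OF f] Pts_inD(1)[OF g]
  have "pcomm T f g t \<in> core P" for t
  proof (rule point_in_core[OF P, of T "pcomm T f g"])
    show "point T (pcomm T f g)" using G.gcomm_closed[of f g] fg by simp
    show "pcomm T f g t \<in> P" for t
      by (rule pcomm_in[OF T fg P(1)]) (rule gen[OF Pts_inD(2)[OF f] Pts_inD(2)[OF g]])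
  qed
  then show "comm x y \<in> core P"
    using xy by (intro pair[OF bil_commutator_element graded_subalgebraD(1)[OF core]])
      (simp_all add: pcomm_eq_commutator_element[OF T fg, symmetric])
qed

lemma subcoalgebra_huq:
  assumes "subcoalgebra X" "subcoalgebra Y"
  shows "subcoalgebra (huq X Y)"
proof -
  let ?W = "huq X Y"
  note W = graded_subalgebraD[OF graded_subalgebra_huq[of X Y]]
  have "?W \<subseteq> core ?W"
    using core_subset[of ?W] by (intro huq_subset_core assms W commutator_in_huq) auto
  then show ?thesis using subcoalgebra_core[OF W(1,2)] core_subset[of ?W] by (simp add: subset_antisym)
qed

lemma antipode_one: "antipode H 1 = 1"
  using antipode_right[of 1] comult_sum_one[OF mult_antipode_bil vector_space]
  by (simp add: comult_sum_def counit_one)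

lemma adjoint_action_one: "adj a 1 = scale H (counit H a) 1"
  using antipode_right[of a]
  by (simp add: adjoint_action_eq color_twist_homog_right[OF bil_adjoint_kernel vector_space homog_one]
      comult_sum_def)

lemma commutator_element_one: "comm a 1 = scale H (counit H a) 1"
  using antipode_right[of a]
  by (simp add: commutator_element_eq comult_sum_one[OF bil_commutator_kernel1 vector_space] antipode_one
      color_twist_homog_right[OF bil_adjoint_kernel vector_space homog_one])
    (simp add: comult_sum_def)

lemma subcoalgebra_UNIV: "subcoalgebra UNIV"
  unfolding subcoalgebra_def using tensor_eq_refl by (auto simp: V.subspace_UNIV)

lemma normal_UNIV: "normal_sub UNIV"
  by (simp add: normal_color_hopf_subalgebra_def color_hopf_subalgebra_iff subcoalgebra_UNIV
      graded_subalgebra_def V.subspace_UNIV)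

lemma commutator_in_normal:
  assumes X: "normal_sub X" and x: "x \<in> X"
  shows "comm a x \<in> X"
proof -
  note XD = normal_color_hopf_subalgebraD[OF X]
  obtain T f g where gp: "generic_pair T f g UNIV X"
    using subcoalgebra_pair[OF subcoalgebra_UNIV XD(2)] by blast
  note T = generic_pairD(1)[OF gp] and f = generic_pairD(2)[OF gp] and g = generic_pairD(3)[OF gp]
    and pair = generic_pairD(4)[OF gp]
  interpret G: Group.group "Pts T" by (rule group_Pts[OF T])
  interpret N: normal "Pts_in T X" "Pts T" by (rule normal_Pts_in[OF T X])
  have "pcomm T f g \<in> Pts_in T X"
    unfolding G.gcomm_eq_gconj_mult[OF Pts_in_carrier[OF f] Pts_in_carrier[OF g]]
    by (intro N.m_closed N.m_inv_closed G.gconj_in_normal[OF N.normal_axioms] Pts_in_carrier[OF f] g)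
  then show ?thesis
    using x by (intro pair[OF bil_commutator_element XD(3)])
      (simp_all add: pcomm_eq_commutator_element[OF T Pts_inD(1)[OF f] Pts_inD(1)[OF g], symmetric] Pts_inD(2))
qed

(* Points on tensor coalgebras are functions of pairs, and statements about all their values
   are used without splitting the argument. *)
declare split_paired_All [simp del]

lemma pcomm_Pts_in:
  assumes T: "color_coalgebra \<phi> T" and f: "f \<in> Pts_in T X" and g: "g \<in> Pts_in T Y"
  shows "pcomm T f g \<in> Pts_in T (huq X Y)"
proof -
  interpret G: Group.group "Pts T" by (rule group_Pts[OF T])
  note fg = Pts_inD(1)[OF f] Pts_inD(1)[OF g]
  have "pcomm T f g t \<in> huq X Y" for t
    by (rule pcomm_in[OF T fg graded_subalgebraD(1)[OF graded_subalgebra_huq]])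
      (rule commutator_in_huq[OF Pts_inD(2)[OF f] Pts_inD(2)[OF g]])
  then show ?thesis using G.gcomm_closed[of f g] fg by (simp add: Pts_in_def)
qed

lemma pconj_Pts_in:
  assumes T: "color_coalgebra \<phi> T" and f: "point T f" and g: "g \<in> Pts_in T X"
    and X: "V.subspace X" "\<And>a x. x \<in> X \<Longrightarrow> adj a x \<in> X"
  shows "pconj T f g \<in> Pts_in T X"
proof -
  interpret G: Group.group "Pts T" by (rule group_Pts[OF T])
  have "pconj T f g t \<in> X" for t
    by (rule pconj_in[OF T f Pts_inD(1)[OF g] X(1)]) (rule X(2)[OF Pts_inD(2)[OF g]])
  then show ?thesis using G.gconj_closed[of f g] f g by (simp add: Pts_in_def)
qed

lemma inv_Pts_in:
  assumes T: "color_coalgebra \<phi> T" and f: "f \<in> Pts_in T X" and X: "\<And>x. x \<in> X \<Longrightarrow> antipode H x \<in> X"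
  shows "inv\<^bsub>Pts T\<^esub> f \<in> Pts_in T X"
  using f by (simp add: Pts_in_def inv_Pts[OF T] point_antipode[OF T] X)

text \<open>For products this is the rule for the inverse of a product in the group of points. The
  antipode of a commutator element belongs to the inverse of a commutator \<open>[x, y]\<close>, which equals
  \<open>[inv x, x y (inv x)]\<close>; by normality of \<open>Y\<close> this is again a commutator of points of \<open>X\<close> and
  \<open>Y\<close>.\<close>

lemma antipode_huq:
  assumes X: "normal_sub X" and Y: "normal_sub Y"
    and z: "z \<in> huq X Y"
  shows "antipode H z \<in> huq X Y"
proof -
  let ?W = "huq X Y" let ?P = "{z. antipode H z \<in> ?W}"
  note XD = normal_color_hopf_subalgebraD[OF X] and YD = normal_color_hopf_subalgebraD[OF Y]
  note WD = graded_subalgebraD[OF graded_subalgebra_huq[of X Y]]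
  have P: "V.subspace ?P" "1 \<in> ?P"
    using WD(2) by (simp_all add: subspace_preimage[OF antipode_linear WD(1)] antipode_one)
  note bilS = bil_comp_linear[OF _ antipode_linear]
  have core: "subcoalgebra (core ?P)" by (rule subcoalgebra_core[OF P])
  have "?W \<subseteq> core ?P"
  proof (rule huq_subset_core[OF XD(2) YD(2) P])
    fix x y assume xy: "x \<in> core ?P" "y \<in> core ?P"
    obtain T f g where gp: "generic_pair T f g (core ?P) (core ?P)"
      using subcoalgebra_pair[OF core core] by blast
    note T = generic_pairD(1)[OF gp] and f = generic_pairD(2)[OF gp] and g = generic_pairD(3)[OF gp]
      and pair = generic_pairD(4)[OF gp]
    interpret G: Group.group "Pts T" by (rule group_Pts[OF T])
    have fg: "point T f" "point T g" by (rule Pts_inD[OF f] Pts_inD[OF g])+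
    have "antipode H (conv T f g t) = (inv\<^bsub>Pts T\<^esub> (f \<otimes>\<^bsub>Pts T\<^esub> g)) t" for t
      by (simp add: inv_Pts[OF T point_conv[OF T fg]])
    also have "\<dots> t = conv T (\<lambda>i. antipode H (g i)) (\<lambda>i. antipode H (f i)) t" for t
      using fg by (subst G.inv_mult_group) (simp_all add: inv_Pts[OF T])
    also have "\<dots> t \<in> ?W" for t
      using core_subset[of ?P] Pts_inD(2)[OF f] Pts_inD(2)[OF g] by (intro conv_in[OF graded_subalgebra_huq]) blast+
    finally have "antipode H (conv T f g t) \<in> ?W" for t .
    then have "antipode H (x * y) \<in> ?W"
      by (intro pair[OF bilS[OF mult_bil] WD(1) _ xy])
        (simp add: conv_def sweedler_map[OF antipode_linear])
    then show "x * y \<in> ?P" by simp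
  next
    fix x y assume xy: "x \<in> X" "y \<in> Y"
    obtain T f g where gp: "generic_pair T f g X Y"
      using subcoalgebra_pair[OF XD(2) YD(2)] by blast
    note T = generic_pairD(1)[OF gp] and f = generic_pairD(2)[OF gp] and g = generic_pairD(3)[OF gp]
      and pair = generic_pairD(4)[OF gp]
    interpret G: Group.group "Pts T" by (rule group_Pts[OF T])
    note fg = Pts_in_carrier[OF f] Pts_in_carrier[OF g]
    have "pcomm T (inv\<^bsub>Pts T\<^esub> f) (pconj T f g) \<in> Pts_in T ?W"
      using fg by (intro pcomm_Pts_in[OF T] inv_Pts_in[OF T f] pconj_Pts_in[OF T _ g] XD(4) YD) simp_all
    then have "inv\<^bsub>Pts T\<^esub> (pcomm T f g) \<in> Pts_in T ?W"
      by (simp only: G.inv_gcomm_eq_gcomm_inv[OF fg])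
    then have "antipode H (pcomm T f g t) \<in> ?W" for t
      using G.gcomm_closed[OF fg] by (simp add: Pts_in_def inv_Pts[OF T])
    then have "antipode H (comm x y) \<in> ?W"
      using fg by (intro pair[OF bilS[OF bil_commutator_element] WD(1) _ xy])
        (simp add: pcomm_eq_commutator_element[OF T] sweedler_map[OF antipode_linear])
    then show "comm x y \<in> ?P" by simp
  qed
  then show ?thesis using z core_subset[of ?P] by blast
qed

text \<open>Conjugation is an automorphism of the group of points and preserves the points of \<open>X\<close> and
  of \<open>Y\<close>.\<close>

lemma adjoint_action_huq:
  assumes X: "normal_sub X" and Y: "normal_sub Y"
    and z: "z \<in> huq X Y"
  shows "adj a z \<in> huq X Y"
proof -
  let ?W = "huq X Y" let ?P = "{z. \<forall>a\<in>UNIV. adj a z \<in> ?W}"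
  note XD = normal_color_hopf_subalgebraD[OF X] and YD = normal_color_hopf_subalgebraD[OF Y]
  note WD = graded_subalgebraD[OF graded_subalgebra_huq[of X Y]]
  have P: "V.subspace ?P" by (rule subspace_preimage_all[OF linear_adjoint_action WD(1)])
  have P1: "1 \<in> ?P"
    using WD(2) by (simp add: adjoint_action_one V.subspace_scale[OF WD(1)])
  have core: "subcoalgebra (core ?P)" by (rule subcoalgebra_core[OF P P1])
  have "?W \<subseteq> core ?P"
  proof (rule huq_subset_core[OF XD(2) YD(2) P P1])
    fix x y assume xy: "x \<in> core ?P" "y \<in> core ?P"
    obtain T e f g where gp: "generic_triple T e f g UNIV (core ?P) (core ?P)"
      using subcoalgebra_triple[OF subcoalgebra_UNIV core core] by blast
    note T = generic_tripleD(1)[OF gp] and e = generic_tripleD(2)[OF gp] and f = generic_tripleD(3)[OF gp]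
      and g = generic_tripleD(4)[OF gp] and triple = generic_tripleD(5)[OF gp]
    interpret G: Group.group "Pts T" by (rule group_Pts[OF T])
    note efg = Pts_in_carrier[OF e] Pts_in_carrier[OF f] Pts_in_carrier[OF g]
    have "pconj T e h t \<in> ?W" if h: "h \<in> Pts_in T (core ?P)" for h t
      using core_subset[of ?P] Pts_inD(2)[OF h] by (intro pconj_in[OF T Pts_inD(1)[OF e] Pts_inD(1)[OF h] WD(1)]) blast
    then have "conv T (pconj T e f) (pconj T e g) t \<in> ?W" for t
      using f g by (intro conv_in[OF graded_subalgebra_huq]) auto
    then have "pconj T e (conv T f g) t \<in> ?W" for t
      using G.gconj_mult[OF efg] by simp
    then have "adj a (x * y) \<in> ?W" for a
      using efg by (intro triple[OF mult_bil bil_adjoint_action WD(1) _ UNIV_I xy])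
        (simp add: conv_def[symmetric] pconj_eq_adjoint_action[OF T _ point_conv[OF T], symmetric])
    then show "x * y \<in> ?P" by simp
  next
    fix x y assume xy: "x \<in> X" "y \<in> Y"
    obtain T e f g where gp: "generic_triple T e f g UNIV X Y"
      using subcoalgebra_triple[OF subcoalgebra_UNIV XD(2) YD(2)] by blast
    note T = generic_tripleD(1)[OF gp] and e = generic_tripleD(2)[OF gp] and f = generic_tripleD(3)[OF gp]
      and g = generic_tripleD(4)[OF gp] and triple = generic_tripleD(5)[OF gp]
    interpret G: Group.group "Pts T" by (rule group_Pts[OF T])
    note efg = Pts_in_carrier[OF e] Pts_in_carrier[OF f] Pts_in_carrier[OF g]
    have pt: "point T e" "point T (pcomm T f g)"
      using efg G.gcomm_closed[OF efg(2,3)] by simp_all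
    have "pcomm T (pconj T e f) (pconj T e g) \<in> Pts_in T ?W"
      using efg by (intro pcomm_Pts_in[OF T] pconj_Pts_in[OF T pt(1)] f g XD YD)
    then have "pconj T e (pcomm T f g) \<in> Pts_in T ?W"
      by (simp only: G.gconj_gcomm[OF efg])
    then have "pconj T e (pcomm T f g) t \<in> ?W" for t by (rule Pts_inD)
    then have "adj a (comm x y) \<in> ?W" for a
      using efg by (intro triple[OF bil_commutator_element bil_adjoint_action WD(1) _ UNIV_I xy])
        (simp add: pcomm_eq_commutator_element[OF T, symmetric] pconj_eq_adjoint_action[OF T pt])
    then show "comm x y \<in> ?P" by simp
  qed
  then show ?thesis using z core_subset[of ?P] by blast
qed

theorem normal_huq:
  assumes "normal_sub X" "normal_sub Y"
  shows "normal_sub (huq X Y)"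
  unfolding normal_color_hopf_subalgebra_def color_hopf_subalgebra_iff
  using assms by (auto simp: graded_subalgebra_huq antipode_huq adjoint_action_huq
      intro: subcoalgebra_huq normal_color_hopf_subalgebraD)

text \<open>The commutator \<open>[y, x]\<close> is the inverse of \<open>[x, y]\<close>, and \<open>huq X Y\<close> is closed under the
  antipode.\<close>

lemma huq_commute_subset:
  assumes X: "normal_sub X" and Y: "normal_sub Y"
  shows "huq Y X \<subseteq> huq X Y"
proof (rule huq_subset[OF graded_subalgebra_huq])
  let ?W = "huq X Y"
  note XD = normal_color_hopf_subalgebraD[OF X] and YD = normal_color_hopf_subalgebraD[OF Y]
  note WD = normal_color_hopf_subalgebraD[OF normal_huq[OF X Y]]
  fix y x assume yx: "y \<in> Y" "x \<in> X"
  obtain T g f where gp: "generic_pair T g f Y X"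
    using subcoalgebra_pair[OF YD(2) XD(2)] by blast
  note T = generic_pairD(1)[OF gp] and g = generic_pairD(2)[OF gp] and f = generic_pairD(3)[OF gp]
    and pair = generic_pairD(4)[OF gp]
  interpret G: Group.group "Pts T" by (rule group_Pts[OF T])
  note fg = Pts_in_carrier[OF f] Pts_in_carrier[OF g]
  have "inv\<^bsub>Pts T\<^esub> (pcomm T f g) \<in> Pts_in T ?W"
    by (rule inv_Pts_in[OF T pcomm_Pts_in[OF T f g] WD(4)])
  then have "pcomm T g f t \<in> ?W" for t
    unfolding G.inv_gcomm[OF fg] by (rule Pts_inD)
  then show "comm y x \<in> ?W"
    using fg by (intro pair[OF bil_commutator_element WD(3) _ yx])
      (simp add: pcomm_eq_commutator_element[OF T, symmetric])
qed

lemma huq_commute: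
  "normal_sub X \<Longrightarrow> normal_sub Y \<Longrightarrow>
    huq X Y = huq Y X"
  by (intro subset_antisym huq_commute_subset)

lemma huq_subset_right:
  "normal_sub Y \<Longrightarrow> huq X Y \<subseteq> Y"
  by (intro huq_subset commutator_in_normal) (auto dest: normal_color_hopf_subalgebraD)

section \<open>Centralizers and the three subgroups lemma\<close>

text \<open>The subspace of all \<open>z\<close> that commute with \<open>A\<close> modulo \<open>W\<close> need not be closed under
  products; its core is, as products of points can be treated by a group identity.\<close>

definition centralizer :: "'a set \<Rightarrow> 'a set \<Rightarrow> 'a set" where
  "centralizer A W = core {z. \<forall>a\<in>A. comm a z \<in> W}"

context
  fixes A W assumes A: "subcoalgebra A" and W: "normal_sub W"
begin

lemma subspace_centralizing: "V.subspace {z. \<forall>a\<in>A. comm a z \<in> W}"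
  by (rule subspace_preimage_all[OF linear_commutator_element normal_color_hopf_subalgebraD(3)[OF W]])

lemma one_centralizing: "1 \<in> {z. \<forall>a\<in>A. comm a z \<in> W}"
  using graded_subalgebraD[OF normal_color_hopf_subalgebraD(1)[OF W]]
  by (simp add: commutator_element_one V.subspace_scale)

lemma subcoalgebra_centralizer: "subcoalgebra (centralizer A W)"
  unfolding centralizer_def by (rule subcoalgebra_core[OF subspace_centralizing one_centralizing])

lemma commutator_centralizer: "a \<in> A \<Longrightarrow> z \<in> centralizer A W \<Longrightarrow> comm a z \<in> W"
  using core_subset unfolding centralizer_def by blast

text \<open>From \<open>[a, x y] = [a, x] (x [a, y] (inv x))\<close> and the normality of \<open>W\<close>.\<close>

lemma mult_centralizing:
  assumes xy: "x \<in> centralizer A W" "y \<in> centralizer A W" and a: "a \<in> A"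
  shows "comm a (x * y) \<in> W"
proof -
  note WD = normal_color_hopf_subalgebraD[OF W]
  obtain T e f g where gp: "generic_triple T e f g A (centralizer A W) (centralizer A W)"
    using subcoalgebra_triple[OF A subcoalgebra_centralizer subcoalgebra_centralizer] by blast
  note T = generic_tripleD(1)[OF gp] and e = generic_tripleD(2)[OF gp] and f = generic_tripleD(3)[OF gp]
    and g = generic_tripleD(4)[OF gp] and triple = generic_tripleD(5)[OF gp]
  interpret G: Group.group "Pts T" by (rule group_Pts[OF T])
  interpret N: normal "Pts_in T W" "Pts T" by (rule normal_Pts_in[OF T W])
  note efg = Pts_in_carrier[OF e] Pts_in_carrier[OF f] Pts_in_carrier[OF g]
  have comm: "pcomm T e h \<in> Pts_in T W" if h: "h \<in> Pts_in T (centralizer A W)" for h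
  proof -
    have "pcomm T e h t \<in> W" for t
      by (rule pcomm_in[OF T Pts_inD(1)[OF e] Pts_inD(1)[OF h] WD(3)])
        (rule commutator_centralizer[OF Pts_inD(2)[OF e] Pts_inD(2)[OF h]])
    then show ?thesis using G.gcomm_closed[OF Pts_in_carrier[OF e] Pts_in_carrier[OF h]] by (simp add: Pts_in_def)
  qed
  have "pcomm T e (f \<otimes>\<^bsub>Pts T\<^esub> g) \<in> Pts_in T W"
    unfolding G.gcomm_mult_right[OF efg]
    by (intro N.m_closed G.gconj_in_normal[OF N.normal_axioms] comm f g efg)
  then have "pcomm T e (conv T f g) t \<in> W" for t by (simp add: Pts_in_def)
  then show ?thesis
    using efg by (intro triple[OF mult_bil bil_commutator_element WD(3) _ a xy])
      (simp add: conv_def[symmetric] pcomm_eq_commutator_element[OF T _ point_conv[OF T], symmetric])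
qed

lemma graded_subalgebra_centralizer: "graded_subalgebra H (centralizer A W)"
  unfolding centralizer_def
  by (rule graded_subalgebra_core[OF subspace_centralizing one_centralizing])
    (simp add: mult_centralizing[unfolded centralizer_def])

end

text \<open>The subspace of all \<open>z\<close> with \<open>[A, z] \<subseteq> W\<close> contains the commutator elements of \<open>X\<close> and \<open>Y\<close>
  by \<open>three_subgroups\<close>, applied to the normal subgroup of points of \<open>W\<close>, and the products of
  elements of its core by \<open>mult_centralizing\<close>.\<close>

theorem huq_three_subgroups:
  assumes A: "normal_sub A" and X: "normal_sub X"
    and Y: "normal_sub Y" and W: "normal_sub W"
    and 1: "huq X (huq Y A) \<subseteq> W"
    and 2: "huq Y (huq A X) \<subseteq> W"
  shows "huq A (huq X Y) \<subseteq> W"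
proof -
  note AD = normal_color_hopf_subalgebraD[OF A] and XD = normal_color_hopf_subalgebraD[OF X]
    and YD = normal_color_hopf_subalgebraD[OF Y] and WD = normal_color_hopf_subalgebraD[OF W]
  let ?P = "{z. \<forall>a\<in>A. comm a z \<in> W}"
  have "huq X Y \<subseteq> core ?P"
  proof (rule huq_subset_core[OF XD(2) YD(2) subspace_centralizing[OF AD(2) W] one_centralizing[OF AD(2) W]])
    show "x * y \<in> ?P" if "x \<in> core ?P" "y \<in> core ?P" for x y
      using that mult_centralizing[OF AD(2) W] by (simp add: centralizer_def)
    fix x y assume xy: "x \<in> X" "y \<in> Y"
    obtain T e f g where gp: "generic_triple T e f g A X Y"
      using subcoalgebra_triple[OF AD(2) XD(2) YD(2)] by blast
    note T = generic_tripleD(1)[OF gp] and e = generic_tripleD(2)[OF gp] and f = generic_tripleD(3)[OF gp]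
      and g = generic_tripleD(4)[OF gp] and triple = generic_tripleD(5)[OF gp]
    interpret G: Group.group "Pts T" by (rule group_Pts[OF T])
    note efg = Pts_in_carrier[OF e] Pts_in_carrier[OF f] Pts_in_carrier[OF g]
    have pt: "point T e" "point T (pcomm T f g)"
      using efg G.gcomm_closed[OF efg(2,3)] by simp_all
    have in_W: "h \<in> Pts_in T W" if "h \<in> Pts_in T V'" "V' \<subseteq> W" for h V'
      using that by (auto simp: Pts_in_def)
    have "pcomm T e (pcomm T f g) \<in> Pts_in T W"
      by (intro G.three_subgroups[OF normal_Pts_in[OF T W] efg] in_W[OF _ 1] in_W[OF _ 2]
          pcomm_Pts_in[OF T] inv_Pts_in[OF T] e f g AD(4) XD(4) YD(4))
    then have "pcomm T e (pcomm T f g) t \<in> W" for t by (rule Pts_inD)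
    then have "comm a (comm x y) \<in> W" if "a \<in> A" for a
      using efg by (intro triple[OF bil_commutator_element bil_commutator_element WD(3) _ that xy])
        (simp add: pcomm_eq_commutator_element[OF T, symmetric] pcomm_eq_commutator_element[OF T pt])
    then show "comm x y \<in> ?P" by simp
  qed
  then show ?thesis
    using core_subset[of ?P] by (intro huq_subset[OF WD(1)]) blast
qed

lemma huq_centralizer:
  "normal_sub W \<Longrightarrow> huq UNIV (centralizer UNIV W) \<subseteq> W"
  using commutator_centralizer[OF subcoalgebra_UNIV] by (intro huq_subset) (auto dest: normal_color_hopf_subalgebraD)

lemma subset_centralizer:
  assumes "subcoalgebra D" "huq A D \<subseteq> W"
  shows "D \<subseteq> centralizer A W"
  unfolding centralizer_def using assms commutator_in_huq by (intro subset_core) blast+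

text \<open>Conjugation by \<open>a\<close> changes \<open>z\<close> by the factor \<open>[a, z]\<close>, which lies in \<open>W\<close> and so in the
  centralizer. For the antipode, \<open>[a, inv z]\<close> is conjugate to the inverse of \<open>[a, z]\<close>.\<close>

lemma normal_centralizer:
  assumes W: "normal_sub W"
  shows "normal_sub (centralizer UNIV W)"
proof -
  let ?Z = "centralizer UNIV W" let ?P = "{z. \<forall>a\<in>UNIV. comm a z \<in> W}"
  note WD = normal_color_hopf_subalgebraD[OF W] and U = subcoalgebra_UNIV
  have Z: "graded_subalgebra H ?Z" "subcoalgebra ?Z"
    by (rule graded_subalgebra_centralizer[OF U W] subcoalgebra_centralizer[OF U W])+
  note ZD = graded_subalgebraD[OF Z(1)]
  have WZ: "W \<subseteq> ?Z" by (rule subset_centralizer[OF WD(2) huq_subset_right[OF W]])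
  note P = subspace_centralizing[OF U W] one_centralizing[OF U W]
  obtain C :: "('g, 'k, 'a) color_coalg" and h where C: "color_coalgebra \<phi> C" and h: "point C h"
    "\<And>i. h i \<in> ?Z" "?Z = V.span (range h)"
    using subcoalgebra_point[OF Z(2)] by metis
  obtain T e f where gp: "generic_pair T e f UNIV ?Z"
    using subcoalgebra_pair[OF U Z(2)] by blast
  note T = generic_pairD(1)[OF gp] and e = generic_pairD(2)[OF gp] and f = generic_pairD(3)[OF gp]
    and pair = generic_pairD(4)[OF gp]
  interpret G: Group.group "Pts T" by (rule group_Pts[OF T])
  interpret N: normal "Pts_in T W" "Pts T" by (rule normal_Pts_in[OF T W])
  note ef = Pts_in_carrier[OF e] Pts_in_carrier[OF f]
  have pt: "point T e" "point T f" "point T (\<lambda>i. antipode H (f i))"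
    using ef point_antipode[OF T] by simp_all
  have comm: "pcomm T e f \<in> Pts_in T W"
  proof -
    have "pcomm T e f t \<in> W" for t
      by (rule pcomm_in[OF T pt(1,2) WD(3)]) (rule commutator_centralizer[OF U W UNIV_I Pts_inD(2)[OF f]])
    then show ?thesis using G.gcomm_closed[OF ef] by (simp add: Pts_in_def)
  qed
  have adj: "adj a z \<in> ?Z" if z: "z \<in> ?Z" for a z
  proof (rule pair[OF bil_adjoint_action ZD(1) _ UNIV_I z])
    have "pconj T e f = conv T (pcomm T e f) f" using G.gconj_eq_gcomm_mult[OF ef] by simp
    moreover have "pcomm T e f i \<in> ?Z" for i using Pts_inD(2)[OF comm] WZ by blast
    ultimately have "pconj T e f t \<in> ?Z" for t
      using Pts_inD(2)[OF f] by (simp add: conv_in[OF Z(1)])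
    then show "ssum T (\<lambda>j k. adj (e j) (f k)) t \<in> ?Z" for t
      by (simp add: pconj_eq_adjoint_action[OF T pt(1,2), symmetric])
  qed
  have "antipode H z \<in> ?P" if z: "z \<in> ?Z" for z
  proof -
    have "pcomm T e (inv\<^bsub>Pts T\<^esub> f) \<in> Pts_in T W"
      unfolding G.gcomm_inv_right[OF ef]
      by (intro G.gconj_in_normal[OF N.normal_axioms] G.inv_closed N.m_inv_closed comm ef)
    then have "pcomm T e (\<lambda>i. antipode H (f i)) t \<in> W" for t
      by (simp add: Pts_in_def inv_Pts[OF T pt(2)])
    moreover have b: "bil (scale H) (\<lambda>a z. comm a (antipode H z))"
      using bil_commutator_element by (simp add: bilinear_map_def Vector_Spaces.linear_iff S.add S.scale)
    ultimately have "comm a (antipode H z) \<in> W" for a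
      by (intro pair[OF b WD(3) _ UNIV_I z])
        (simp_all add: pcomm_eq_commutator_element[OF T pt(1,3), symmetric])
    then show ?thesis by simp
  qed
  then have "antipode H (h i) \<in> ?Z" for i
    using h(2) unfolding centralizer_def[of UNIV W]
    by (intro point_in_core[OF P point_antipode[OF C h(1)], of i]) (auto simp: centralizer_def)
  then have "?Z \<subseteq> {z. antipode H z \<in> ?Z}"
    unfolding h(3) using subspace_preimage[OF antipode_linear ZD(1)] h(3)
    by (intro V.span_minimal) auto
  then show ?thesis
    unfolding normal_color_hopf_subalgebra_def color_hopf_subalgebra_iff using Z adj by blast
qed

section \<open>Hall's argument\<close>

abbreviation "series \<equiv> gamma_iter \<phi> H"

definition descend :: "nat \<Rightarrow> 'a set \<Rightarrow> 'a set" where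
  "descend k = (\<lambda>X. huq UNIV X) ^^ k"

lemma descend_0 [simp]: "descend 0 X = X"
  and descend_Suc: "descend (Suc k) X = huq UNIV (descend k X)"
  by (simp_all add: descend_def)

lemma descend_add: "descend (k + l) X = descend k (descend l X)"
  by (simp add: descend_def funpow_add)

lemma normal_descend: "normal_sub X \<Longrightarrow> normal_sub (descend k X)"
  by (induct k) (simp_all add: descend_Suc normal_huq normal_UNIV)

lemma descend_mono: "X \<subseteq> Y \<Longrightarrow> descend k X \<subseteq> descend k Y"
  by (induct k) (simp_all add: descend_Suc huq_mono)

lemma descend_antimono:
  assumes "normal_sub X" "k \<le> l" shows "descend l X \<subseteq> descend k X"
  using assms(2)
proof (induct l rule: dec_induct)
  case (step n)
  have "descend (Suc n) X \<subseteq> descend n X"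
    unfolding descend_Suc by (rule huq_subset_right[OF normal_descend[OF assms(1)]])
  with step show ?case by blast
qed simp

text \<open>The operation \<open>X \<mapsto> [E, X]\<close> satisfies a Leibniz rule for commutators. Instead of joins of
  subalgebras, the induction enlarges the target: \<open>D\<^sup>k\<^sup>+\<^sup>1 Z\<close> lies in \<open>W\<close> as soon as \<open>D\<^sup>k Z\<close>
  lies in the centralizer of \<open>E\<close> modulo \<open>W\<close>, and the three subgroups lemma shows that the
  hypotheses pass from \<open>W\<close> to this centralizer.\<close>

lemma descend_huq_subset:
  assumes X: "normal_sub X" and Y: "normal_sub Y"
  shows "normal_sub W \<Longrightarrow> (\<And>a b. a + b = k \<Longrightarrow> huq (descend a X) (descend b Y) \<subseteq> W) \<Longrightarrow> descend k (huq X Y) \<subseteq> W"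
proof (induct k arbitrary: W)
  case 0
  then show ?case using "0"(2)[of 0 0] by simp
next
  case (Suc k)
  let ?Z = "centralizer UNIV W"
  have "descend k (huq X Y) \<subseteq> ?Z"
  proof (rule Suc(1)[OF normal_centralizer[OF Suc(2)]])
    fix a b assume ab: "a + b = k"
    note D = normal_descend[OF X, of a] normal_descend[OF Y, of b]
    have "huq UNIV (huq (descend a X) (descend b Y)) \<subseteq> W"
    proof (rule huq_three_subgroups[OF normal_UNIV D Suc(2)])
      show "huq (descend a X) (huq (descend b Y) UNIV) \<subseteq> W"
        using Suc(3)[of a "Suc b"] ab by (simp add: descend_Suc huq_commute[OF D(2) normal_UNIV])
      show "huq (descend b Y) (huq UNIV (descend a X)) \<subseteq> W"
        using Suc(3)[of "Suc a" b] ab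
        by (simp add: descend_Suc huq_commute[OF D(2) normal_huq[OF normal_UNIV D(1)]])
    qed
    then show "huq (descend a X) (descend b Y) \<subseteq> ?Z"
      by (intro subset_centralizer) (auto intro: normal_color_hopf_subalgebraD normal_huq D)
  qed
  then have "descend (Suc k) (huq X Y) \<subseteq> huq UNIV ?Z"
    unfolding descend_Suc by (intro huq_mono) auto
  then show ?case using huq_centralizer[OF Suc(2)] by blast
qed

lemma series_0 [simp]: "series A 0 = A"
  and series_Suc: "series A (Suc n) = huq A (series A n)"
  by (simp_all add: gamma_iter_def)

lemma normal_series: "normal_sub N \<Longrightarrow> normal_sub (series N n)"
  by (induct n) (simp_all add: series_Suc normal_huq)

lemma series_UNIV: "series UNIV n = descend n UNIV"
  by (simp add: gamma_iter_def descend_def)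

lemma huq_derived_series_subset:
  assumes N: "normal_sub N"
  shows "huq (series N 1) (series N n) \<subseteq> series N (n + 2)"
proof -
  note S = normal_series[OF N]
  have "huq (series N n) (huq N N) \<subseteq> series N (n + 2)"
  proof (rule huq_three_subgroups[OF S N N S])
    show "huq N (huq N (series N n)) \<subseteq> series N (n + 2)" by (simp add: series_Suc)
    show "huq N (huq (series N n) N) \<subseteq> series N (n + 2)"
      by (simp add: series_Suc huq_commute[OF S N])
  qed
  then show ?thesis using huq_commute[OF S[of 1] S[of n]] by (simp add: series_Suc)
qed

text \<open>The case distinction is the pigeonhole principle for \<open>a + b = (i + 2) e + 1\<close>: either \<open>a\<close>
  reaches the \<open>e + 1\<close> steps that bring \<open>N\<close> into \<open>[N, N]\<close>, or \<open>b\<close> reaches the number of steps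
  from the induction hypothesis.\<close>

lemma descend_series_subset:
  assumes N: "normal_sub N" and d: "descend (Suc e) UNIV \<subseteq> series N 1"
  shows "descend ((i + 1) * e + 1) (series N i) \<subseteq> series N (i + 1)"
proof (induct i)
  case 0
  show ?case using descend_mono[of N UNIV "Suc e"] d by auto
next
  case (Suc i)
  note S = normal_series[OF N]
  have "descend ((Suc i + 1) * e + 1) (huq N (series N i)) \<subseteq> series N (i + 2)"
  proof (rule descend_huq_subset[OF N S S])
    fix a b assume ab: "a + b = (Suc i + 1) * e + 1"
    show "huq (descend a N) (descend b (series N i)) \<subseteq> series N (i + 2)"
    proof (cases "a \<ge> Suc e")
      case True
      have "descend a N \<subseteq> series N 1"
        using descend_antimono[OF N True] descend_mono[of N UNIV "Suc e"] d by blast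
      moreover have "descend b (series N i) \<subseteq> series N i"
        using descend_antimono[OF S, of 0 b] by simp
      ultimately show ?thesis using huq_mono huq_derived_series_subset[OF N, of i] by blast
    next
      case False
      then have "(i + 1) * e + 1 \<le> b" using ab by simp
      then have "descend b (series N i) \<subseteq> series N (i + 1)"
        using descend_antimono[OF S] Suc by blast
      moreover have "descend a N \<subseteq> N" using descend_antimono[OF N, of 0 a] by simp
      ultimately show ?thesis using huq_mono[of "descend a N" N] by (simp add: series_Suc)
    qed
  qed
  then show ?case by (simp add: series_Suc)
qed

text \<open>The number of steps is the sum of \<open>i e + 1\<close> over \<open>i = 1, \<dots>, c + 1\<close>.\<close>

lemma hall_subset:
  assumes N: "normal_sub N" and d: "descend (Suc e) UNIV \<subseteq> series N 1"
  shows "descend ((Suc c * (Suc c + 1) div 2) * e + Suc c) UNIV \<subseteq> series N (Suc c)"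
proof (induct c)
  case 0
  show ?case using d by simp
next
  case (Suc c)
  define m where "m = (Suc c * (Suc c + 1) div 2) * e + Suc c"
  define k where "k = (Suc c + 1) * e + 1"
  have "Suc (Suc c) * (Suc (Suc c) + 1) = Suc c * (Suc c + 1) + 2 * (Suc c + 1)" by simp
  then have "Suc (Suc c) * (Suc (Suc c) + 1) div 2 = Suc c * (Suc c + 1) div 2 + (Suc c + 1)" by simp
  then have "(Suc (Suc c) * (Suc (Suc c) + 1) div 2) * e + Suc (Suc c) = k + m"
    by (simp add: m_def k_def algebra_simps)
  moreover have "descend k (descend m UNIV) \<subseteq> descend k (series N (Suc c))"
    using Suc by (intro descend_mono) (simp only: m_def)
  moreover have "descend k (series N (Suc c)) \<subseteq> series N (Suc (Suc c))"
    using descend_series_subset[OF N d, of "Suc c"] by (simp only: k_def Suc_eq_plus1)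
  ultimately show ?case by (simp only: descend_add)
qed

abbreviation trivial :: "'a set" where
  "trivial \<equiv> range (\<lambda>c. scale H c 1)"

lemma trivial_subset: "graded_subalgebra H X \<Longrightarrow> trivial \<subseteq> X"
  using V.subspace_scale by (auto simp: graded_subalgebra_def)

lemma series_eq_trivial: "normal_sub N \<Longrightarrow> series N n \<subseteq> trivial \<Longrightarrow> series N n = trivial"
  using trivial_subset[OF normal_color_hopf_subalgebraD(1)[OF normal_series]] by blast

end

section \<open>Images under a morphism\<close>

locale cocommutative_color_hopf_morphism =
  A: cocommutative_color_hopf \<phi> A + B: cocommutative_color_hopf \<phi> B + color_hopf_morphism \<phi> A B f
  for \<phi> :: "'g::ab_group_add \<Rightarrow> 'g \<Rightarrow> 'k::field"
    and A :: "('g, 'k, 'a::ring_1) color_hopf"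
    and B :: "('g, 'k, 'b::ring_1) color_hopf"
    and f :: "'a \<Rightarrow> 'b"
begin

sublocale f: Vector_Spaces.linear "scale A" "scale B" f by (rule map_linear)

lemma map_point:
  assumes p: "A.point C p"
  shows "B.point C (\<lambda>i. f (p i))"
proof (rule B.pointI)
  show "f (p i) \<in> homog B (cdeg C i)" for i by (rule map_homog[OF A.point_homog[OF p]])
  show "counit B (f (p i)) = ceps C i" for i by (simp add: map_counit A.point_counit[OF p])
  fix b i assume b: "B.bil (*) b"
  have bil: "A.bil (*) (\<lambda>x y. b (f x) (f y))"
    by (rule A.bilI[OF vector_space_times]) (simp_all add: bilinear_mapD[OF b] f.add f.scale)
  have "B.comult_sum (*) b (f (p i)) = A.comult_sum (*) (\<lambda>x y. b (f x) (f y)) (p i)"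
    unfolding B.comult_sum_def A.comult_sum_def tensor_eq_bilinear_map[OF map_comult b]
    by (simp add: vector_space.linear_ext_bind[OF vector_space_times] case_prod_unfold
        vector_space.linear_ext_single[OF vector_space_times])
  then show "B.comult_sum (*) b (f (p i)) = sweedler (*) C (\<lambda>j k. b (f (p j)) (f (p k))) i"
    by (simp add: A.comult_sum_point[OF p bil vector_space_times])
qed

text \<open>Both sides are convolution inverses of the point \<open>f \<circ> p\<close>.\<close>

lemma map_antipode_point:
  assumes C: "color_coalgebra \<phi> C" and p: "A.point C p"
  shows "f (antipode A (p i)) = antipode B (f (p i))"
proof -
  interpret G: Group.group "B.Pts C" by (rule B.group_Pts[OF C])
  have "B.conv C (\<lambda>i. f (antipode A (p i))) (\<lambda>i. f (p i)) = (\<lambda>i. f (A.conv C (\<lambda>i. antipode A (p i)) p i))"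
    by (simp add: A.conv_def B.conv_def sweedler_map[OF map_linear] map_mult)
  also have "\<dots> = B.conv_one C"
    by (rule ext) (simp add: A.conv_antipode_left[OF p] A.conv_one_def B.conv_one_def f.scale map_one)
  finally have "inv\<^bsub>B.Pts C\<^esub> (\<lambda>i. f (p i)) = (\<lambda>i. f (antipode A (p i)))"
    by (intro G.inv_equality) (simp_all add: map_point[OF p] map_point[OF A.point_antipode[OF C p]])
  then show ?thesis by (metis B.inv_Pts[OF C map_point[OF p]])
qed

lemma map_commutator_point:
  assumes C: "color_coalgebra \<phi> C" "A.point C p" and D: "color_coalgebra \<phi> D" "A.point D q"
  shows "f (commutator_element \<phi> A (p i) (q j)) = commutator_element \<phi> B (f (p i)) (f (q j))"
  unfolding A.commutator_element_point[OF C(2) D(2)] B.commutator_element_point[OF map_point[OF C(2)] map_point[OF D(2)]]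
  by (simp add: sweedler_map[OF map_linear] f.scale map_mult map_antipode_point[OF C] map_antipode_point[OF D])

lemma map_homog_part: "homog_part B (f x) g = f (homog_part A x g)"
proof -
  have "homog_decomp B (f x) (\<lambda>g. f (homog_part A x g))"
  proof (rule B.homog_decompI)
    show "f (homog_part A x g) \<in> homog B g" for g by (rule map_homog[OF A.homog_part_homog])
    show "finite {g. homog_part A x g \<noteq> 0}" by (rule A.finite_homog_part)
    show "f x = (\<Sum>g | homog_part A x g \<noteq> 0. f (homog_part A x g))"
      by (simp add: f.sum[symmetric] A.sum_homog_part A.finite_homog_part)
  qed (simp add: f.zero)
  then show ?thesis by (simp add: B.homog_part_eqI)
qed

lemma graded_subalgebra_preimage:
  assumes W: "graded_subalgebra B W"
  shows "graded_subalgebra A {x. f x \<in> W}"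
  using B.graded_subalgebraD[OF W]
  by (auto simp: graded_subalgebra_def map_one map_mult map_homog_part[symmetric] f.zero f.add f.scale
      B.V.subspace_0 B.V.subspace_add B.V.subspace_scale intro!: A.V.subspaceI)

lemma map_huq:
  assumes X: "A.subcoalgebra X" and Y: "A.subcoalgebra Y" and XX: "f ` X \<subseteq> X'" and YY: "f ` Y \<subseteq> Y'"
  shows "f ` huq_commutator \<phi> A X Y \<subseteq> huq_commutator \<phi> B X' Y'"
proof -
  let ?V = "{z. f z \<in> huq_commutator \<phi> B X' Y'}"
  have V: "graded_subalgebra A ?V" by (rule graded_subalgebra_preimage[OF B.graded_subalgebra_huq])
  obtain C :: "('g, 'k, 'a) color_coalg" and p where C: "color_coalgebra \<phi> C" and p: "A.point C p"
    "\<And>i. p i \<in> X" "X = A.V.span (range p)"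
    using A.subcoalgebra_point[OF X] by metis
  obtain D :: "('g, 'k, 'a) color_coalg" and q where D: "color_coalgebra \<phi> D" and q: "A.point D q"
    "\<And>i. q i \<in> Y" "Y = A.V.span (range q)"
    using A.subcoalgebra_point[OF Y] by metis
  have pq: "commutator_element \<phi> A (p i) (q j) \<in> ?V" for i j
    using p(2)[of i] q(2)[of j] XX YY
    by (auto simp: map_commutator_point[OF C p(1) D q(1)] intro!: B.commutator_in_huq)
  have "commutator_element \<phi> A x y \<in> ?V" if "x \<in> X" "y \<in> Y" for x y
    by (rule A.bil_span[OF A.bil_commutator_element A.graded_subalgebraD(1)[OF V] pq])
      (use that p(3) q(3) in simp_all)
  then have "huq_commutator \<phi> A X Y \<subseteq> ?V" by (rule A.huq_subset[OF V])
  then show ?thesis by blast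
qed

lemma map_series: "f ` gamma_iter \<phi> A UNIV n \<subseteq> gamma_iter \<phi> B UNIV n"
proof (induct n)
  case (Suc n)
  show ?case unfolding A.series_Suc B.series_Suc
    by (intro map_huq Suc A.subcoalgebra_UNIV
        A.normal_color_hopf_subalgebraD(2)[OF A.normal_series[OF A.normal_UNIV]]) auto
qed simp

text \<open>On \<open>X\<close> the map \<open>f\<close> is the counit, so \<open>x\<^sub>1 \<otimes> f(x\<^sub>2)\<close> collapses to \<open>x \<otimes> 1\<close> by the counit
  law; for this \<open>x\<^sub>2\<close> has to lie in \<open>X\<close>, which is why \<open>X\<close> must be a subcoalgebra.\<close>

lemma subset_Hker:
  assumes X: "A.subcoalgebra X" and fX: "f ` X \<subseteq> B.trivial"
  shows "X \<subseteq> Hker A B f"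
proof
  fix x assume "x \<in> X"
  then obtain t where t: "tensor_eq (scale A) (scale A) (comult A x) t" "Poly_Mapping.keys t \<subseteq> X \<times> X"
    using X unfolding A.subcoalgebra_def by blast
  have f_eq: "f v = scale B (counit A v) 1" if vX: "v \<in> X" for v
  proof -
    obtain c where c: "f v = scale B c 1" using fX vX by auto
    have "counit A v = counit B (f v)" by (simp add: map_counit)
    also have "\<dots> = c" by (simp add: c B.counit.scale B.counit_one)
    finally show ?thesis using c by simp
  qed
  have "tensor_eq (scale A) (scale B) (linear_ext free_scale (\<lambda>(x, y). pure_tensor (x, f y)) (comult A x)) (pure_tensor (x, 1))"
  proof (rule tensor_eqI[OF A.vector_space B.vector_space])
    fix b assume b: "bilinear_map (scale A) (scale B) (*) b"
    note bD = bilinear_mapD[OF b]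
    have bil1: "A.bil (*) (\<lambda>u v. b u (f v))"
      by (rule A.bilI[OF vector_space_times]) (simp_all add: bD f.add f.scale)
    have bil2: "A.bil (*) (\<lambda>u v. b (scale A (counit A v) u) 1)"
      by (rule A.bilI[OF vector_space_times]) (simp_all add: bD A.counit.add A.counit.scale distrib_left distrib_right)
    have lin: "Vector_Spaces.linear (scale A) (*) (\<lambda>u. b u 1)" using b by (simp add: bilinear_map_def)
    have "linear_ext (*) (\<lambda>(x, y). b x y) (linear_ext free_scale (\<lambda>(x, y). pure_tensor (x, f y)) (comult A x)) =
        linear_ext (*) (\<lambda>(u, v). b u (f v)) (comult A x)"
      by (simp add: vector_space.linear_ext_bind[OF vector_space_times] case_prod_unfold
        vector_space.linear_ext_single[OF vector_space_times])
    also have "\<dots> = linear_ext (*) (\<lambda>(u, v). b u (f v)) t"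
      by (rule tensor_eq_bilinear_map[OF t(1) bil1])
    also have "\<dots> = linear_ext (*) (\<lambda>(u, v). b (scale A (counit A v) u) 1) t"
      using t(2) by (intro linear_ext_cong) (auto simp: f_eq bD)
    also have "\<dots> = linear_ext (*) (\<lambda>(u, v). b (scale A (counit A v) u) 1) (comult A x)"
      by (rule tensor_eq_bilinear_map[OF t(1) bil2, symmetric])
    also have "\<dots> = b (linear_ext (scale A) (\<lambda>(u, v). scale A (counit A v) u) (comult A x)) 1"
      by (simp add: linear_linear_ext_apply[OF lin] case_prod_unfold)
    also have "\<dots> = linear_ext (*) (\<lambda>(x, y). b x y) (pure_tensor (x, 1))"
      by (simp add: A.counit_right vector_space.linear_ext_single[OF vector_space_times])
    finally show "linear_ext (*) (\<lambda>(x, y). b x y) (linear_ext free_scale (\<lambda>(x, y). pure_tensor (x, f y)) (comult A x)) =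
      linear_ext (*) (\<lambda>(x, y). b x y) (pure_tensor (x, 1))" .
  qed
  then show "x \<in> Hker A B f" by (simp add: Hker_def)
qed

end

(* The bound requires c = 0 \<longrightarrow> d = 0: for N = k1 (class 0) the map p is an isomorphism,
   and E has class d while the bound is 0. *)
theorem proposition4p1:
  fixes \<phi> :: "'g::ab_group_add \<Rightarrow> 'g \<Rightarrow> 'k::field"
    and E :: "('g, 'k, 'e::ring_1) color_hopf"
    and B :: "('g, 'k, 'b::ring_1) color_hopf"
    and p :: "'e \<Rightarrow> 'b"
    and N :: "'e set"
  assumes "CHAR('k) \<noteq> 2"
    and "finitely_generated_group TYPE('g)"
    and "skew_bicharacter \<phi>"
    and "cocommutative_color_hopf_algebra \<phi> E"
    and "cocommutative_color_hopf_algebra \<phi> B"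
    and "color_hopf_morphism \<phi> E B p"
    and "surj p"
    and "nilpotent \<phi> B UNIV"
    and "normal_color_hopf_subalgebra \<phi> E N"
    and "nilpotent \<phi> E N"
    and "Hker E B p \<subseteq> huq_commutator \<phi> E N N"
  shows "nilpotent \<phi> E UNIV \<and>
    (\<forall>c d. nilpotency_class \<phi> E N = c \<and> nilpotency_class \<phi> B UNIV = d \<and> (c = 0 \<longrightarrow> d = 0) \<longrightarrow>
       int (nilpotency_class \<phi> E UNIV) \<le> (int c * (int c + 1) div 2) * (int d - 1) + int c)"
proof -
  interpret cocommutative_color_hopf_morphism \<phi> E B p
    by (intro cocommutative_color_hopf_morphism.intro cocommutative_color_hopf.intro assms)
  define c where "c = nilpotency_class \<phi> E N"
  define d where "d = nilpotency_class \<phi> B UNIV"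
  note N = assms(9)
  have c: "gamma_iter \<phi> E N c = A.trivial"
    unfolding c_def nilpotency_class_def by (rule LeastI_ex) (use assms(10) in \<open>simp add: nilpotent_def\<close>)
  have d: "gamma_iter \<phi> B UNIV d = B.trivial"
    unfolding d_def nilpotency_class_def by (rule LeastI_ex) (use assms(8) in \<open>simp add: nilpotent_def\<close>)
  have "gamma_iter \<phi> E UNIV d \<subseteq> Hker E B p"
    using map_series[of d] d
    by (intro subset_Hker A.normal_color_hopf_subalgebraD(2)[OF A.normal_series[OF A.normal_UNIV]]) simp
  then have dN: "A.descend d UNIV \<subseteq> gamma_iter \<phi> E N 1"
    using assms(11) by (simp add: A.series_UNIV A.series_Suc)
  have class_le: "nilpotency_class \<phi> E A \<le> n" if "gamma_iter \<phi> E A n = A.trivial" for A n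
    unfolding nilpotency_class_def using that by (rule Least_le)
  consider (zero) "d = 0" | (Nzero) "d \<noteq> 0" "c = 0" | (pos) e c' where "d = Suc e" "c = Suc c'"
    by (metis not0_implies_Suc)
  then show ?thesis
  proof cases
    \<comment> \<open>\<open>E = Hker p\<close>, so \<open>E = N = [N, N]\<close>, and a perfect nilpotent algebra is trivial.\<close>
    case zero
    then have N1: "gamma_iter \<phi> E N 1 = UNIV" using dN by auto
    then have "N = UNIV" using A.huq_subset_right[OF N] by (auto simp: A.series_Suc)
    then have "gamma_iter \<phi> E N n = UNIV" for n
      using N1 by (induct n) (simp_all add: A.series_Suc)
    then have triv: "A.trivial = UNIV" using c by simp
    then have "nilpotency_class \<phi> E UNIV = 0" using class_le[of UNIV 0] by simp
    moreover have "nilpotent \<phi> E UNIV" unfolding nilpotent_def using triv by (intro exI[of _ 0]) simp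
    moreover have "c = 0" unfolding c_def using \<open>N = UNIV\<close> calculation by simp
    ultimately show ?thesis by (simp add: c_def)
  next
    \<comment> \<open>\<open>[N, N]\<close> is trivial, so \<open>E\<close> is nilpotent; the bound is not claimed when \<open>c = 0\<close> and \<open>d \<noteq> 0\<close>.\<close>
    case Nzero
    have "A.descend d UNIV \<subseteq> A.trivial"
      using dN A.huq_subset_right[OF N, of N] c Nzero by (simp add: A.series_Suc)
    then have "nilpotent \<phi> E UNIV"
      unfolding nilpotent_def using A.series_eq_trivial[OF A.normal_UNIV, of d] by (auto simp: A.series_UNIV)
    then show ?thesis using Nzero by (simp add: c_def d_def)
  next
    case pos
    let ?n = "(c * (c + 1) div 2) * e + c"
    have "A.descend ?n UNIV \<subseteq> gamma_iter \<phi> E N c"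
      unfolding pos(2) by (rule A.hall_subset[OF N]) (use dN pos(1) in simp)
    then have n: "gamma_iter \<phi> E UNIV ?n = A.trivial"
      using c by (intro A.series_eq_trivial[OF A.normal_UNIV]) (simp add: A.series_UNIV)
    have "int (nilpotency_class \<phi> E UNIV) \<le> int ?n" using class_le[OF n] by (simp only: of_nat_le_iff)
    also have "\<dots> = (int c * (int c + 1) div 2) * (int d - 1) + int c"
      by (simp add: pos(1) zdiv_int algebra_simps)
    finally show ?thesis
      using n by (auto simp: nilpotent_def c_def d_def)
  qed
qed

end
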